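(* Let $X,Y$ be Banach spaces, let $A:D(A)\subset X\to X$ generate a $C_0$-semigroup $T(\cdot)$ on $X$, and let $C\in\mathcal L(X,Y)$. Assume that there are closed, $T(\cdot)$-invariant subspaces $X_u,X_s\subset X$ with $X=X_u\oplus X_s$ and $\dim X_u<\infty$, where $X_u$ is the spectral subspace of $A$ associated with the spectrum in the closed right half-plane, and that there exist constants $M_s,\omega_s>0$ such that $$\|T(t)x_s\|_X\le M_se^{-\omega_st}\|x_s\|_X\quad\forall x_s\in X_s,\ \forall t\ge0.$$ Let $A_u$ be the generator of $T_u(t):=T(t)|_{X_u}$ and $C_u:=C|_{X_u}$. Then the following statements are equivalent: (i) The system $\dot x(t)=Ax(t)$, $y(t)=Cx(t)$ is exponentially detectable. (ii) The system $\dot x(t)=Ax(t)$, $y(t)=Cx(t)$ is eOSS. (iii) The system $\dot x(t)=Ax(t)$, $y(t)=Cx(t)$ is exponentially zero-detectable. (iv) The pair $(A_u,C_u)$ is exponentially zero-detectable. (v) The pair $(A_u,C_u)$ is exponentially detectable. (vi) The pair $(A_u,C_u)$ is observable. In particular, all of the following statements about the system $\dot x(t)=Ax(t)$, $y(t)=Cx(t)$ are equivalent: it is exponentially detectable; it admits a coercive eOSS Lyapunov function in dissipation form with linear Lyapunov gain; it admits a coercive eOSS Lyapunov function in implication form with linear Lyapunov gain; it is eOSS with linear gain; it is eOSS; it is OSS with linear gain; it is OSS; it is UGESMO; it is exponentially zero-detectable.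
   Context: $\mathcal L(X,Y)$ denotes the bounded linear operators from $X$ to $Y$. For real Banach spaces, spectral notions are understood via complexification. A subspace $V\subset X$ is $T(\cdot)$-invariant if $T(t)V\subset V$ for all $t\ge0$. $X=X_u\oplus X_s$ denotes an internal direct sum of closed subspaces ($X_u\cap X_s=\{0\}$ and every $x\in X$ is uniquely $x=x_u+x_s$ with $x_u\in X_u$, $x_s\in X_s$). That $X_u$ is the spectral subspace associated with the spectrum in the closed right half-plane entails that the spectrum of $A_u$ is contained in $\{\lambda\in\mathbb C:\operatorname{Re}\lambda\ge0\}$. $\mathbb R_+=[0,\infty)$. The mild solution with initial state $x\in X$ is $\phi(t,x)=T(t)x$ and the output trajectory is $y(t,x)=CT(t)x$, $t\ge0$. The properties below are defined for a system/pair $(A,C)$ and apply likewise to the pair $(A_u,C_u)$, with state space $X_u$, semigroup $T_u(\cdot)$ and output space $Y$. $(A_u,C_u)$ is observable if $C_uT_u(t)x_u=0$ for all $t\ge0$ implies $x_u=0$. Comparison functions: $\mathcal K$ is the set of continuous strictly increasing $\gamma:\mathbb R_+\to\mathbb R_+$ with $\gamma(0)=0$; $\mathcal K_\infty$ is the set of unbounded $\gamma\in\mathcal K$. $\mathcal L$ is the set of continuous strictly decreasing functions $\mathbb R_+\to\mathbb R_+$ tending to $0$ at infinity. $\mathcal{KL}$ is the set of continuous $\beta:\mathbb R_+\times\mathbb R_+\to\mathbb R_+$ such that $\beta(\cdot,t)\in\mathcal K$ for all $t\ge0$ and $\beta(r,\cdot)\in\mathcal L$ for all $r>0$. Exponentially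 detectable: there exists $L\in\mathcal L(Y,X)$ such that $A+LC$ generates a uniformly exponentially stable $C_0$-semigroup, i.e. a semigroup $S(\cdot)$ with $\|S(t)x\|_X\le Me^{-\mu t}\|x\|_X$ for all $x\in X$, $t\ge0$ and some $M,\mu>0$. OSS: there exist $\beta\in\mathcal{KL}$, $\gamma\in\mathcal K$ such that for all $x\in X$, $t\ge0$: $\|\phi(t,x)\|_X\le\beta(\|x\|_X,t)+\gamma\bigl(\max_{s\in[0,t]}\|y(s,x)\|_Y\bigr)$; with linear gain if $\gamma$ can be chosen linear. eOSS: there exist $M,\mu>0$, $\gamma\in\mathcal K$ such that for all $x\in X$, $t\ge0$: $\|\phi(t,x)\|_X\le Me^{-\mu t}\|x\|_X+\gamma\bigl(\max_{s\in[0,t]}\|y(s,x)\|_Y\bigr)$; with linear gain if $\gamma$ can be chosen linear. UGESMO: there exist $\rho>0$ and $M,\mu>0$ such that for all $x\in X$, $\tau\ge0$: if $\|\phi(t,x)\|_X\ge\rho\|y(t,x)\|_Y$ for all $t\in[0,\tau]$, then $\|\phi(t,x)\|_X\le Me^{-\mu t}\|x\|_X$ for all $t\in[0,\tau]$. Exponentially zero-detectable: there exist $M,\omega>0$ such that for all $x\in X$: $y(\cdot,x)\equiv0$ implies $\|\phi(t,x)\|_X\le Me^{-\omega t}\|x\|_X$ for all $t\ge0$. Lie derivative: $\dot V(x):=\limsup_{\tau\to+0}\frac{V(\phi(\tau,x))-V(x)}{\tau}$ (limsup in the extended real line), provided $t\mapsto V(\phi(t,x))$ is continuous at $t=0$.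 $V:X\to\mathbb R_+$ is a coercive eOSS Lyapunov function in dissipation form if: (a) there exist $k_1,k_2,p>0$ with $k_1\|x\|_X^p\le V(x)\le k_2\|x\|_X^p$ for all $x\in X$; (b) for every $x\in X$ the map $t\mapsto V(\phi(t,x))$, $t\ge0$, is continuous; (c) there exist $\alpha>0$ and $\sigma\in\mathcal K_\infty$ such that, with $p$ as in (a), $\dot V(x)\le-\alpha\|x\|_X^p+\sigma(\|Cx\|_Y)$ for all $x\in X$. It is a coercive eOSS Lyapunov function in implication form if (a), (b) hold and (c) is replaced by: (c') there exist $\tilde\alpha>0$ and $\chi\in\mathcal K_\infty$ such that, with $p$ as in (a), for every $x\in X$: $\|x\|_X\ge\chi(\|Cx\|_Y)\Rightarrow\dot V(x)\le-\tilde\alpha\|x\|_X^p$. Linear Lyapunov gain means that $\sigma$, respectively $\chi$, can be chosen linear. *)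

theory Defs
  imports "HOL-Complex_Analysis.Complex_Analysis"
begin

text \<open>
  \<^bold>\<open>Scalars.\<close> A Banach space is a type of class \<open>banach\<close> together with a value of type
  \<open>('a \<Rightarrow> 'a) option\<close>: \<open>None\<close> means that the space is considered over the reals,
  \<open>Some J\<close> that it is a complex Banach space in which \<open>J\<close> is multiplication by the imaginary unit.

  \<^bold>\<open>Carriers.\<close> State spaces are closed subspaces \<open>H\<close> of a type. Every notion below looks at
  \<open>T t\<close> and \<open>C\<close> on \<open>H\<close> and for \<open>t \<ge> 0\<close> only, so that passing an invariant subspace \<open>H\<close> together with
  \<open>T\<close> and \<open>C\<close> amounts to the restrictions of \<open>T\<close> and \<open>C\<close> to \<open>H\<close>.
\<close>

definition cscale :: "('a::real_vector \<Rightarrow> 'a) \<Rightarrow> complex \<Rightarrow> 'a \<Rightarrow> 'a" where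
  "cscale J c x = Re c *\<^sub>R x + Im c *\<^sub>R J x"

definition complex_structure :: "('a::real_normed_vector \<Rightarrow> 'a) \<Rightarrow> bool" where
  "complex_structure J \<longleftrightarrow>
     linear J \<and> (\<forall>x. J (J x) = - x) \<and> (\<forall>c x. norm (cscale J c x) = cmod c * norm x)"

definition same_scalar_field ::
  "('x::real_normed_vector \<Rightarrow> 'x) option \<Rightarrow> ('y::real_normed_vector \<Rightarrow> 'y) option \<Rightarrow> bool" where
  "same_scalar_field JX JY \<longleftrightarrow>
     (JX = None \<and> JY = None) \<or>
     (\<exists>I K. JX = Some I \<and> JY = Some K \<and> complex_structure I \<and> complex_structure K)"

definition closed_subspace :: "('x::real_normed_vector \<Rightarrow> 'x) option \<Rightarrow> 'x set \<Rightarrow> bool" where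
  "closed_subspace JX H \<longleftrightarrow>
     subspace H \<and> closed H \<and> (\<forall>I. JX = Some I \<longrightarrow> I ` H \<subseteq> H)"

definition bounded_ops ::
  "('x::real_normed_vector \<Rightarrow> 'x) option \<Rightarrow> ('y::real_normed_vector \<Rightarrow> 'y) option
     \<Rightarrow> 'x set \<Rightarrow> 'y set \<Rightarrow> ('x \<Rightarrow> 'y) set" where
  "bounded_ops JX JY H G =
     {f. f ` H \<subseteq> G
       \<and> (\<forall>x\<in>H. \<forall>y\<in>H. f (x + y) = f x + f y)
       \<and> (\<forall>r. \<forall>x\<in>H. f (r *\<^sub>R x) = r *\<^sub>R f x)
       \<and> (\<forall>I K. JX = Some I \<and> JY = Some K \<longrightarrow> (\<forall>x\<in>H. f (I x) = K (f x)))
       \<and> (\<exists>M. \<forall>x\<in>H. norm (f x) \<le> M * norm x)}"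

definition C0_semigroup ::
  "('x::real_normed_vector \<Rightarrow> 'x) option \<Rightarrow> 'x set \<Rightarrow> (real \<Rightarrow> 'x \<Rightarrow> 'x) \<Rightarrow> bool" where
  "C0_semigroup JX H T \<longleftrightarrow>
     (\<forall>t\<ge>0. T t \<in> bounded_ops JX JX H H)
   \<and> (\<forall>x\<in>H. T 0 x = x)
   \<and> (\<forall>s\<ge>0. \<forall>t\<ge>0. \<forall>x\<in>H. T (s + t) x = T s (T t x))
   \<and> (\<forall>x\<in>H. ((\<lambda>t. T t x) \<longlongrightarrow> x) (at_right 0))"

text \<open>An unbounded operator is given by its domain \<open>D\<close> and a function, relevant on \<open>D\<close> only.\<close>

definition generates ::
  "('x::real_normed_vector \<Rightarrow> 'x) option \<Rightarrow> 'x set \<Rightarrow> 'x set \<Rightarrow> ('x \<Rightarrow> 'x)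
     \<Rightarrow> (real \<Rightarrow> 'x \<Rightarrow> 'x) \<Rightarrow> bool" where
  "generates JX H D A T \<longleftrightarrow>
     C0_semigroup JX H T
   \<and> D = {x\<in>H. \<exists>y. ((\<lambda>h. (T h x - x) /\<^sub>R h) \<longlongrightarrow> y) (at_right 0)}
   \<and> (\<forall>x\<in>D. ((\<lambda>h. (T h x - x) /\<^sub>R h) \<longlongrightarrow> A x) (at_right 0))"

definition exp_stable :: "'x::real_normed_vector set \<Rightarrow> (real \<Rightarrow> 'x \<Rightarrow> 'x) \<Rightarrow> bool" where
  "exp_stable H S \<longleftrightarrow>
     (\<exists>M>0. \<exists>\<mu>>0. \<forall>x\<in>H. \<forall>t\<ge>0. norm (S t x) \<le> M * exp (- \<mu> * t) * norm x)"

section \<open>Spectral subspaces\<close>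

definition is_resolvent ::
  "('z::real_normed_vector \<Rightarrow> 'z) \<Rightarrow> 'z set \<Rightarrow> ('z \<Rightarrow> 'z) \<Rightarrow> complex \<Rightarrow> ('z \<Rightarrow> 'z) \<Rightarrow> bool" where
  "is_resolvent J D A \<zeta> R \<longleftrightarrow>
     bounded_linear R
   \<and> (\<forall>z. R z \<in> D \<and> cscale J \<zeta> (R z) - A (R z) = z)
   \<and> (\<forall>z\<in>D. R (cscale J \<zeta> z - A z) = z)"

definition spectrum ::
  "('z::real_normed_vector \<Rightarrow> 'z) \<Rightarrow> 'z set \<Rightarrow> ('z \<Rightarrow> 'z) \<Rightarrow> complex set" where
  "spectrum J D A = {\<zeta>. \<nexists>R. is_resolvent J D A \<zeta> R}"

definition resolvent ::
  "('z::real_normed_vector \<Rightarrow> 'z) \<Rightarrow> 'z set \<Rightarrow> ('z \<Rightarrow> 'z) \<Rightarrow> complex \<Rightarrow> 'z \<Rightarrow> 'z" where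
  "resolvent J D A \<zeta> = (THE R. is_resolvent J D A \<zeta> R)"

text \<open>
  The Riesz (Dunford) integral of the resolvent along a cycle, i.e. a finite list of closed paths;
  as in the library's contour integral, \<open>d\<zeta>\<close> is the vector derivative of the path.
\<close>

definition riesz_projection ::
  "('z::banach \<Rightarrow> 'z) \<Rightarrow> 'z set \<Rightarrow> ('z \<Rightarrow> 'z) \<Rightarrow> (real \<Rightarrow> complex) list \<Rightarrow> 'z \<Rightarrow> 'z" where
  "riesz_projection J D A \<Gamma> z =
     cscale J (1 / (2 * of_real pi * \<i>))
       (\<Sum>g\<leftarrow>\<Gamma>. integral {0..1}
          (\<lambda>t. cscale J (vector_derivative g (at t within {0..1})) (resolvent J D A (g t) z)))"

text \<open>
  \<open>U\<close> is the spectral subspace for the part of the spectrum in \<open>S\<close>: the range of the Riesz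
  projection for a cycle in the resolvent set that winds once around the spectrum inside \<open>S\<close> and
  not at all around the rest. All such cycles are homologous in the resolvent set and hence give the
  same projection.
\<close>

definition complex_spectral_subspace ::
  "('z::banach \<Rightarrow> 'z) \<Rightarrow> 'z set \<Rightarrow> ('z \<Rightarrow> 'z) \<Rightarrow> complex set \<Rightarrow> 'z set \<Rightarrow> bool" where
  "complex_spectral_subspace J D A S U \<longleftrightarrow>
     (\<exists>\<Gamma>. (\<forall>g\<in>set \<Gamma>. valid_path g \<and> pathfinish g = pathstart g
                        \<and> path_image g \<inter> spectrum J D A = {})
        \<and> (\<forall>\<zeta> \<in> spectrum J D A \<inter> S. (\<Sum>g\<leftarrow>\<Gamma>. winding_number g \<zeta>) = 1)
        \<and> (\<forall>\<zeta> \<in> spectrum J D A - S. (\<Sum>g\<leftarrow>\<Gamma>. winding_number g \<zeta>) = 0)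
        \<and> U = range (riesz_projection J D A \<Gamma>))"

text \<open>
  Over the reals, pass to the complexification \<open>'x \<times> 'x\<close>, where \<open>(x, y)\<close> stands for \<open>x + \<i> y\<close>.
  The product norm is not homogeneous for complex scalars, but it is equivalent to the usual
  complexification norms, and spectrum and Riesz projection depend on the topology only.
\<close>

definition spectral_subspace ::
  "('x::banach \<Rightarrow> 'x) option \<Rightarrow> 'x set \<Rightarrow> ('x \<Rightarrow> 'x) \<Rightarrow> complex set \<Rightarrow> 'x set \<Rightarrow> bool" where
  "spectral_subspace JX D A S U \<longleftrightarrow>
     (case JX of
        None \<Rightarrow> complex_spectral_subspace (\<lambda>(x, y). (- y, x)) (D \<times> D) (map_prod A A) S (U \<times> U)
      | Some J \<Rightarrow> complex_spectral_subspace J D A S U)"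

section \<open>Comparison functions\<close>

definition class_K :: "(real \<Rightarrow> real) set" where
  "class_K = {\<gamma>. \<gamma> \<in> {0..} \<rightarrow> {0..} \<and> continuous_on {0..} \<gamma> \<and> strict_mono_on {0..} \<gamma> \<and> \<gamma> 0 = 0}"

definition class_K_inf :: "(real \<Rightarrow> real) set" where
  "class_K_inf = {\<gamma> \<in> class_K. \<not> bdd_above (\<gamma> ` {0..})}"

definition class_L :: "(real \<Rightarrow> real) set" where
  "class_L = {\<gamma>. \<gamma> \<in> {0..} \<rightarrow> {0..} \<and> continuous_on {0..} \<gamma>
                 \<and> (\<forall>s\<ge>0. \<forall>t>s. \<gamma> t < \<gamma> s) \<and> (\<gamma> \<longlongrightarrow> 0) at_top}"

definition class_KL :: "(real \<Rightarrow> real \<Rightarrow> real) set" where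
  "class_KL = {\<beta>. continuous_on ({0..} \<times> {0..}) (\<lambda>(r, t). \<beta> r t)
                 \<and> (\<forall>t\<ge>0. (\<lambda>r. \<beta> r t) \<in> class_K) \<and> (\<forall>r>0. \<beta> r \<in> class_L)}"

definition linear_gain :: "(real \<Rightarrow> real) \<Rightarrow> bool" where
  "linear_gain \<gamma> \<longleftrightarrow> (\<exists>c. \<forall>r\<ge>0. \<gamma> r = c * r)"

section \<open>Detectability and output-to-state stability\<close>

definition exp_detectable ::
  "('x::real_normed_vector \<Rightarrow> 'x) option \<Rightarrow> ('y::real_normed_vector \<Rightarrow> 'y) option
     \<Rightarrow> 'x set \<Rightarrow> 'x set \<Rightarrow> ('x \<Rightarrow> 'x) \<Rightarrow> ('x \<Rightarrow> 'y) \<Rightarrow> bool" where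
  "exp_detectable JX JY H D A C \<longleftrightarrow>
     (\<exists>L \<in> bounded_ops JY JX UNIV H. \<exists>S.
        generates JX H D (\<lambda>x. A x + L (C x)) S \<and> exp_stable H S)"

text \<open>For \<open>x \<in> H\<close> the supremum below is a maximum, since the output is continuous in time.\<close>

definition max_output ::
  "(real \<Rightarrow> 'x \<Rightarrow> 'x) \<Rightarrow> ('x \<Rightarrow> 'y::real_normed_vector) \<Rightarrow> real \<Rightarrow> 'x \<Rightarrow> real" where
  "max_output T C t x = (SUP s\<in>{0..t}. norm (C (T s x)))"

definition OSS_gain ::
  "'x::real_normed_vector set \<Rightarrow> (real \<Rightarrow> 'x \<Rightarrow> 'x) \<Rightarrow> ('x \<Rightarrow> 'y::real_normed_vector)
     \<Rightarrow> (real \<Rightarrow> real) \<Rightarrow> bool" where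
  "OSS_gain H T C \<gamma> \<longleftrightarrow> \<gamma> \<in> class_K \<and>
     (\<exists>\<beta> \<in> class_KL. \<forall>x\<in>H. \<forall>t\<ge>0.
        norm (T t x) \<le> \<beta> (norm x) t + \<gamma> (max_output T C t x))"

definition eOSS_gain ::
  "'x::real_normed_vector set \<Rightarrow> (real \<Rightarrow> 'x \<Rightarrow> 'x) \<Rightarrow> ('x \<Rightarrow> 'y::real_normed_vector)
     \<Rightarrow> (real \<Rightarrow> real) \<Rightarrow> bool" where
  "eOSS_gain H T C \<gamma> \<longleftrightarrow> \<gamma> \<in> class_K \<and>
     (\<exists>M>0. \<exists>\<mu>>0. \<forall>x\<in>H. \<forall>t\<ge>0.
        norm (T t x) \<le> M * exp (- \<mu> * t) * norm x + \<gamma> (max_output T C t x))"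

definition OSS ::
  "'x::real_normed_vector set \<Rightarrow> (real \<Rightarrow> 'x \<Rightarrow> 'x) \<Rightarrow> ('x \<Rightarrow> 'y::real_normed_vector) \<Rightarrow> bool" where
  "OSS H T C \<longleftrightarrow> (\<exists>\<gamma>. OSS_gain H T C \<gamma>)"

definition OSS_linear_gain ::
  "'x::real_normed_vector set \<Rightarrow> (real \<Rightarrow> 'x \<Rightarrow> 'x) \<Rightarrow> ('x \<Rightarrow> 'y::real_normed_vector) \<Rightarrow> bool" where
  "OSS_linear_gain H T C \<longleftrightarrow> (\<exists>\<gamma>. linear_gain \<gamma> \<and> OSS_gain H T C \<gamma>)"

definition eOSS ::
  "'x::real_normed_vector set \<Rightarrow> (real \<Rightarrow> 'x \<Rightarrow> 'x) \<Rightarrow> ('x \<Rightarrow> 'y::real_normed_vector) \<Rightarrow> bool" where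
  "eOSS H T C \<longleftrightarrow> (\<exists>\<gamma>. eOSS_gain H T C \<gamma>)"

definition eOSS_linear_gain ::
  "'x::real_normed_vector set \<Rightarrow> (real \<Rightarrow> 'x \<Rightarrow> 'x) \<Rightarrow> ('x \<Rightarrow> 'y::real_normed_vector) \<Rightarrow> bool" where
  "eOSS_linear_gain H T C \<longleftrightarrow> (\<exists>\<gamma>. linear_gain \<gamma> \<and> eOSS_gain H T C \<gamma>)"

definition UGESMO ::
  "'x::real_normed_vector set \<Rightarrow> (real \<Rightarrow> 'x \<Rightarrow> 'x) \<Rightarrow> ('x \<Rightarrow> 'y::real_normed_vector) \<Rightarrow> bool" where
  "UGESMO H T C \<longleftrightarrow>
     (\<exists>\<rho>>0. \<exists>M>0. \<exists>\<mu>>0. \<forall>x\<in>H. \<forall>\<tau>\<ge>0.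
        (\<forall>t\<in>{0..\<tau>}. norm (T t x) \<ge> \<rho> * norm (C (T t x)))
        \<longrightarrow> (\<forall>t\<in>{0..\<tau>}. norm (T t x) \<le> M * exp (- \<mu> * t) * norm x))"

definition exp_zero_detectable ::
  "'x::real_normed_vector set \<Rightarrow> (real \<Rightarrow> 'x \<Rightarrow> 'x) \<Rightarrow> ('x \<Rightarrow> 'y::real_normed_vector) \<Rightarrow> bool" where
  "exp_zero_detectable H T C \<longleftrightarrow>
     (\<exists>M>0. \<exists>\<omega>>0. \<forall>x\<in>H. (\<forall>t\<ge>0. C (T t x) = 0)
        \<longrightarrow> (\<forall>t\<ge>0. norm (T t x) \<le> M * exp (- \<omega> * t) * norm x))"

definition observable ::
  "'x::real_normed_vector set \<Rightarrow> (real \<Rightarrow> 'x \<Rightarrow> 'x) \<Rightarrow> ('x \<Rightarrow> 'y::real_normed_vector) \<Rightarrow> bool" where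
  "observable H T C \<longleftrightarrow> (\<forall>x\<in>H. (\<forall>t\<ge>0. C (T t x) = 0) \<longrightarrow> x = 0)"

section \<open>Lyapunov functions\<close>

definition lie_derivative :: "(real \<Rightarrow> 'x \<Rightarrow> 'x) \<Rightarrow> ('x \<Rightarrow> real) \<Rightarrow> 'x \<Rightarrow> ereal" where
  "lie_derivative T V x = Limsup (at_right 0) (\<lambda>\<tau>. ereal ((V (T \<tau> x) - V x) / \<tau>))"

text \<open>The Lyapunov gains \<open>\<sigma>\<close> and \<open>\<kappa>\<close> are arguments, so that they can be required to be linear.\<close>

definition eOSS_Lyapunov_dissipation ::
  "'x::real_normed_vector set \<Rightarrow> (real \<Rightarrow> 'x \<Rightarrow> 'x) \<Rightarrow> ('x \<Rightarrow> 'y::real_normed_vector)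
     \<Rightarrow> ('x \<Rightarrow> real) \<Rightarrow> (real \<Rightarrow> real) \<Rightarrow> bool" where
  "eOSS_Lyapunov_dissipation H T C V \<sigma> \<longleftrightarrow>
     \<sigma> \<in> class_K_inf
   \<and> (\<forall>x\<in>H. V x \<ge> 0)
   \<and> (\<forall>x\<in>H. continuous_on {0..} (\<lambda>t. V (T t x)))
   \<and> (\<exists>k1>0. \<exists>k2>0. \<exists>p>0. \<exists>\<alpha>>0.
        (\<forall>x\<in>H. k1 * norm x powr p \<le> V x \<and> V x \<le> k2 * norm x powr p)
      \<and> (\<forall>x\<in>H. lie_derivative T V x \<le> ereal (- \<alpha> * norm x powr p + \<sigma> (norm (C x)))))"

definition eOSS_Lyapunov_implication ::
  "'x::real_normed_vector set \<Rightarrow> (real \<Rightarrow> 'x \<Rightarrow> 'x) \<Rightarrow> ('x \<Rightarrow> 'y::real_normed_vector)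
     \<Rightarrow> ('x \<Rightarrow> real) \<Rightarrow> (real \<Rightarrow> real) \<Rightarrow> bool" where
  "eOSS_Lyapunov_implication H T C V \<kappa> \<longleftrightarrow>
     \<kappa> \<in> class_K_inf
   \<and> (\<forall>x\<in>H. V x \<ge> 0)
   \<and> (\<forall>x\<in>H. continuous_on {0..} (\<lambda>t. V (T t x)))
   \<and> (\<exists>k1>0. \<exists>k2>0. \<exists>p>0. \<exists>\<alpha>>0.
        (\<forall>x\<in>H. k1 * norm x powr p \<le> V x \<and> V x \<le> k2 * norm x powr p)
      \<and> (\<forall>x\<in>H. norm x \<ge> \<kappa> (norm (C x)) \<longrightarrow>
             lie_derivative T V x \<le> ereal (- \<alpha> * norm x powr p)))"

section \<open>Equivalence of several statements\<close>

definition all_equivalent :: "bool list \<Rightarrow> bool" where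
  "all_equivalent Ps \<longleftrightarrow> (\<forall>P \<in> set Ps. \<forall>Q \<in> set Ps. P \<longleftrightarrow> Q)"

end

theory Submission
  imports Defs
begin

text \<open>
  \<^bold>\<open>Idea.\<close> All properties in question are sandwiched between exponential detectability, which yields
  an exponentially decaying observer, and exponential zero-detectability, which only speaks about
  states that produce no output. The splitting \<open>X = Xu \<oplus> Xs\<close> closes the circle: \<open>Xs\<close> is stable already, and on
  the finite-dimensional space \<open>Xu\<close> zero-detectability amounts to observability, from which \<open>L\<close> is constructed.

  \<^bold>\<open>From detectability to the estimates.\<close> If \<open>A + L C\<close> generates the exponentially stable semigroup
  \<open>S\<close>, then \<open>V x = sup\<^sub>t exp (\<mu> t / 2) \<parallel>S t x\<parallel>\<close> is an equivalent norm that decays along \<open>S\<close>. On the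
  domain of \<open>A\<close> the semigroups \<open>T\<close> and \<open>S\<close> differ to first order by the output injection, so \<open>V\<close>
  satisfies a differential inequality along \<open>T\<close> (\<open>V_estimate\<close>). It gives eOSS with linear gain and
  makes \<open>V\<close> a Lyapunov function in both forms, with exponent 1 and linear gain.

  \<^bold>\<open>From the estimates to zero-detectability.\<close> For a state without output every gain term vanishes. What
  remains is exponential decay; for OSS it is a bound by a \<open>KL\<close> function, which linearity upgrades to
  exponential decay, and for Lyapunov functions a Dini derivative argument (\<open>Lyapunov_decay\<close>).

  \<^bold>\<open>From zero-detectability to observability of \<open>(Au, Cu)\<close>.\<close> An unobservable state of \<open>Xu\<close> would have
  an exponentially decaying orbit in \<open>Xu\<close>. Such orbits span an invariant subspace of \<open>Xu\<close>, which
  contains an eigenvector with an eigenvalue of negative real part. The Riesz projection kills this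
  eigenvector, since the cycle has winding number 0 around the eigenvalue; but the Riesz projection
  is injective on its finite-dimensional range \<open>Xu\<close>
  (\<open>no_stable_orbit_in_unstable_subspace\<close>). Real spaces are complexified first.

  \<^bold>\<open>From observability to detectability.\<close> The discounted backward Gramian of \<open>(Au, Cu)\<close>, formed with
  finitely many functionals on \<open>Y\<close> that separate the outputs of \<open>Xu\<close>, is positive definite and turns into
  a Lyapunov function once the injection \<open>L = - W\<^sup>-\<^sup>1 C\<^sup>*\<close> is added (\<open>stabilizing_output_injection\<close>). As \<open>L\<close>
  takes values in \<open>Xu\<close>, the operator \<open>A + L C\<close> is block triangular with respect to \<open>Xu \<oplus> Xs\<close>, and its
  semigroup is given by variation of constants (\<open>generates_S\<close>, \<open>exp_stable_S\<close>). It leaves \<open>Xu\<close> invariant, so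
  the same \<open>L\<close> serves the pair \<open>(Au, Cu)\<close>.
\<close>

section \<open>Finite-dimensional subspaces of normed spaces\<close>

lemma closed_if_balls_compact:
  fixes V :: "'a::real_normed_vector set"
  assumes "\<And>r. compact (V \<inter> cball 0 r)"
  shows "closed V"
proof -
  have "x \<in> V" if "x \<in> closure V" for x
  proof -
    have "\<exists>y\<in>V \<inter> cball 0 (norm x + 1). dist y x < e" if "e > 0" for e
    proof -
      obtain y where y: "y \<in> V" "dist y x < min e 1"
        using \<open>x \<in> closure V\<close> \<open>e > 0\<close> by (metis closure_approachable min_less_iff_conj zero_less_one)
      have "norm y \<le> norm x + dist y x"
        by (metis dist_norm norm_triangle_sub)
      with y show ?thesis by (intro bexI[of _ y]) auto
    qed
    then have "x \<in> closure (V \<inter> cball 0 (norm x + 1))"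
      by (auto simp: closure_approachable)
    then show ?thesis
      using compact_imp_closed[OF assms] by (metis Int_iff closure_closed)
  qed
  then show ?thesis
    by (metis closure_subset_eq subsetI)
qed

text \<open>
  The distance \<open>d\<close> of \<open>b\<close> from \<open>V\<close> is positive, and \<open>K = 1 / d\<close> works. This is the reason why coordinates
  on a finite-dimensional subspace are continuous.
\<close>
lemma coefficient_bound:
  fixes V :: "'a::real_normed_vector set"
  assumes "closed V" "subspace V" "b \<notin> V"
  obtains K where "K > 0" "\<And>c v. v \<in> V \<Longrightarrow> \<bar>c\<bar> \<le> K * norm (c *\<^sub>R b + v)"
proof -
  have ne: "V \<noteq> {}" using assms(2) subspace_0 by blast
  define d where "d = infdist b V"
  have d: "d > 0"
    unfolding d_def using assms ne in_closed_iff_infdist_zero infdist_nonneg by (metis less_eq_real_def)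
  have "\<bar>c\<bar> \<le> (1/d) * norm (c *\<^sub>R b + v)" if "v \<in> V" for c v
  proof (cases "c = 0")
    case False
    have "(- 1/c) *\<^sub>R v \<in> V" using that assms(2) subspace_scale by blast
    then have "d \<le> dist b ((- 1/c) *\<^sub>R v)" unfolding d_def by (rule infdist_le)
    also have "\<dots> = norm ((1/c) *\<^sub>R (c *\<^sub>R b + v))"
      using False by (simp add: dist_norm scaleR_add_right)
    also have "\<dots> = norm (c *\<^sub>R b + v) / \<bar>c\<bar>" by simp
    finally show ?thesis using d False by (simp add: field_simps)
  qed (use d in auto)
  then show ?thesis using that[of "1/d"] d by auto
qed

text \<open>
  The generators are added one at a time: by the coefficient bound, a ball of the larger span is a closed
  part of the image of an interval times a ball of the smaller span.
\<close>
lemma compact_span_Int_cball: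
  fixes B :: "'a::real_normed_vector set"
  assumes "finite B"
  shows "compact (span B \<inter> cball 0 r)"
  using assms
proof (induction B arbitrary: r rule: finite_induct)
  case empty
  have "span {} \<inter> cball 0 r \<subseteq> {0::'a}" by auto
  then show ?case by (metis finite.emptyI finite_imp_compact finite_insert finite_subset)
next
  case (insert b B)
  have closed: "closed (span B)" by (rule closed_if_balls_compact) (rule insert.IH)
  show ?case
  proof (cases "b \<in> span B")
    case True
    then show ?thesis using insert.IH by (simp add: span_redundant)
  next
    case False
    obtain K where K: "K > 0" "\<And>c v. v \<in> span B \<Longrightarrow> \<bar>c\<bar> \<le> K * norm (c *\<^sub>R b + v)"
      using coefficient_bound[OF closed subspace_span False] by blast
    define Q where "Q = (\<lambda>(c, v). c *\<^sub>R b + v) ` ({- K * r..K * r} \<times> (span B \<inter> cball 0 (r + K * r * norm b)))"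
    have "compact Q"
      unfolding Q_def
      by (intro compact_continuous_image compact_Times insert.IH compact_Icc)
         (auto intro!: continuous_intros simp: case_prod_unfold)
    moreover have "span (insert b B) \<inter> cball 0 r = Q \<inter> cball 0 r"
    proof (intro equalityI subsetI)
      fix x assume x: "x \<in> span (insert b B) \<inter> cball 0 r"
      then obtain c where c: "x - c *\<^sub>R b \<in> span B" by (auto simp: span_insert)
      define v where "v = x - c *\<^sub>R b"
      have xv: "x = c *\<^sub>R b + v" by (simp add: v_def)
      have v: "v \<in> span B" using c by (simp add: v_def)
      have "\<bar>c\<bar> \<le> K * norm x" using K(2)[OF v, of c] xv by simp
      also have "\<dots> \<le> K * r" using x K(1) by auto
      finally have cb: "\<bar>c\<bar> \<le> K * r" .
      have "norm v \<le> norm x + \<bar>c\<bar> * norm b"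
        unfolding v_def by (metis norm_scaleR norm_triangle_ineq4)
      also have "\<dots> \<le> r + K * r * norm b"
        using x cb by (intro add_mono mult_right_mono) auto
      finally have "v \<in> span B \<inter> cball 0 (r + K * r * norm b)" using v by auto
      moreover have "c \<in> {- K * r..K * r}" using cb by auto
      ultimately show "x \<in> Q \<inter> cball 0 r" using x xv by (auto simp: Q_def)
    next
      fix x assume "x \<in> Q \<inter> cball 0 r"
      then show "x \<in> span (insert b B) \<inter> cball 0 r"
        using span_mono[of B "insert b B"] unfolding Q_def by (auto intro!: span_add span_scale intro: span_base)
    qed
    ultimately show ?thesis by (simp add: compact_Int_closed)
  qed
qed

lemma compact_span_Int_sphere:
  fixes B :: "'a::real_normed_vector set"
  assumes "finite B"
  shows "compact (span B \<inter> sphere 0 r)"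
proof -
  have "closed (sphere (0::'a) r)"
    unfolding sphere_def by (intro closed_Collect_eq continuous_intros)
  then have "compact ((span B \<inter> cball 0 r) \<inter> sphere 0 r)"
    by (rule compact_Int_closed[OF compact_span_Int_cball[OF assms]])
  moreover have "(span B \<inter> cball 0 r) \<inter> sphere 0 r = span B \<inter> sphere 0 r" by auto
  ultimately show ?thesis by simp
qed

lemma closed_span_finite:
  fixes B :: "'a::real_normed_vector set"
  assumes "finite B"
  shows "closed (span B)"
  by (rule closed_if_balls_compact) (rule compact_span_Int_cball[OF assms])

text \<open>
  For a single map this is the continuity of linear maps on finite-dimensional spaces. For families it is the
  uniform boundedness principle, which in finite dimension is a statement about the images of a basis.
\<close>
lemma uniformly_bounded_on_span:
  fixes F :: "('a::real_normed_vector \<Rightarrow> 'b::real_normed_vector) set"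
  assumes "finite B"
    and add: "\<And>f x y. f \<in> F \<Longrightarrow> x \<in> span B \<Longrightarrow> y \<in> span B \<Longrightarrow> f (x + y) = f x + f y"
    and scale: "\<And>f c x. f \<in> F \<Longrightarrow> x \<in> span B \<Longrightarrow> f (c *\<^sub>R x) = c *\<^sub>R f x"
    and pointwise: "\<And>b. b \<in> B \<Longrightarrow> \<exists>m. \<forall>f\<in>F. norm (f b) \<le> m"
  obtains K where "K \<ge> 0" "\<And>f x. f \<in> F \<Longrightarrow> x \<in> span B \<Longrightarrow> norm (f x) \<le> K * norm x"
proof -
  have "\<exists>K\<ge>0. \<forall>f\<in>F. \<forall>x\<in>span B. norm (f x) \<le> K * norm x"
    using assms
  proof (induction B rule: finite_induct)
    case empty
    have "f 0 = 0" if "f \<in> F" for f using empty(1)[of f 0 0] that by simp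
    then show ?case by auto
  next
    case (insert b B)
    have sub: "span B \<subseteq> span (insert b B)" by (rule span_mono) auto
    have bb: "b \<in> span (insert b B)" by (simp add: span_base)
    have "\<exists>K\<ge>0. \<forall>f\<in>F. \<forall>x\<in>span B. norm (f x) \<le> K * norm x"
      by (rule insert.IH; rule insert.prems) (use sub in auto)
    then obtain K0 where K0: "K0 \<ge> 0" "\<And>f x. f \<in> F \<Longrightarrow> x \<in> span B \<Longrightarrow> norm (f x) \<le> K0 * norm x"
      by blast
    obtain m0 where m0: "\<forall>f\<in>F. norm (f b) \<le> m0" using insert.prems(3)[of b] by auto
    define m where "m = max m0 0"
    have m: "m \<ge> 0" "\<And>f. f \<in> F \<Longrightarrow> norm (f b) \<le> m" using m0 by (auto simp: m_def le_max_iff_disj)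
    show ?case
    proof (cases "b \<in> span B")
      case True
      then show ?thesis using K0 by (auto simp: span_redundant)
    next
      case False
      obtain K where K: "K > 0" "\<And>c v. v \<in> span B \<Longrightarrow> \<bar>c\<bar> \<le> K * norm (c *\<^sub>R b + v)"
        using coefficient_bound[OF closed_span_finite[OF insert(1)] subspace_span False] by blast
      have "norm (f x) \<le> (K * m + K0 * (1 + K * norm b)) * norm x"
        if x: "x \<in> span (insert b B)" and f: "f \<in> F" for f x
      proof -
        obtain c where c: "x - c *\<^sub>R b \<in> span B" using x by (auto simp: span_insert)
        define v where "v = x - c *\<^sub>R b"
        have xv: "x = c *\<^sub>R b + v" by (simp add: v_def)
        have v: "v \<in> span B" using c by (simp add: v_def)
        have cb: "\<bar>c\<bar> \<le> K * norm x" using K(2)[OF v, of c] xv by simp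
        have "norm v \<le> norm x + \<bar>c\<bar> * norm b"
          unfolding v_def by (metis norm_scaleR norm_triangle_ineq4)
        also have "\<dots> \<le> norm x + K * norm x * norm b" using cb by (intro add_left_mono mult_right_mono) auto
        finally have nv: "norm v \<le> (1 + K * norm b) * norm x" by (simp add: algebra_simps)
        have "f x = c *\<^sub>R f b + f v"
          unfolding xv by (subst insert.prems(1)) (use v sub bb f insert.prems(2) span_scale in auto)
        then have "norm (f x) \<le> \<bar>c\<bar> * norm (f b) + norm (f v)" by (metis norm_scaleR norm_triangle_ineq)
        also have "\<dots> \<le> (K * norm x) * m + K0 * ((1 + K * norm b) * norm x)"
          using K(1) by (intro add_mono mult_mono cb m(2)[OF f]
              order_trans[OF K0(2)[OF f v] mult_left_mono[OF nv K0(1)]]) auto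
        finally show ?thesis by (simp add: algebra_simps)
      qed
      moreover have "K * m + K0 * (1 + K * norm b) \<ge> 0" using K K0 m by simp
      ultimately show ?thesis by blast
    qed
  qed
  with that show ?thesis by blast
qed

text \<open>
  The image of a basis spans and has no more elements than the basis, hence is a basis again.
\<close>
lemma linear_surj_imp_inj_on_span:
  fixes f :: "'a::real_vector \<Rightarrow> 'a"
  assumes lin: "linear f" and fin: "finite B" and surj: "f ` span B = span B"
  shows "inj_on f (span B)"
proof -
  obtain B' where B': "B' \<subseteq> span B" "independent B'" "span B \<subseteq> span B'" "card B' = dim (span B)"
    using basis_exists[of "span B"] by blast
  have sp: "span B' = span B"
    using B' by (metis span_minimal subset_antisym subspace_span)
  have fin': "finite B'" using independent_span_bound[OF fin B'(2) B'(1)] by blast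
  have im: "span (f ` B') = span B"
    using linear_span_image[OF lin, of B'] sp surj by simp
  have "card B' \<le> card (f ` B')"
    using independent_span_bound[OF finite_imageI[OF fin'] B'(2)] im B'(1) by blast
  then have card: "card (f ` B') = card B'" using card_image_le[OF fin', of f] by linarith
  then have inj: "inj_on f B'" using eq_card_imp_inj_on fin' by blast
  have "independent (f ` B')"
  proof -
    obtain B2 where B2: "B2 \<subseteq> f ` B'" "independent B2" "f ` B' \<subseteq> span B2"
      using real_vector.maximal_independent_subset[of "f ` B'"] by blast
    have "span (f ` B') \<subseteq> span B2" using B2(3) by (simp add: span_minimal)
    then have "B' \<subseteq> span B2" using im B'(1) by blast
    moreover have fin2: "finite B2" using B2(1) fin' by (meson finite_imageI finite_subset)
    ultimately have "card B' \<le> card B2" using independent_span_bound B'(2) by blast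
    then have "B2 = f ` B'"
      using card B2(1) card_seteq[of "f ` B'" B2] fin' by simp
    then show ?thesis using B2(2) by simp
  qed
  then show ?thesis
    using linear_inj_on_span_iff_independent_image[OF lin, of B'] inj sp by simp
qed

text \<open>
  Compactness of the unit sphere of \<open>U\<close> takes the place of the open mapping theorem: the sphere has a
  positive distance from \<open>V\<close>, whose inverse bounds the projection.
\<close>
lemma bounded_projection_onto_span:
  fixes U V :: "'a::real_normed_vector set"
  assumes U: "U = span B" "finite B" and V: "subspace V" "closed V"
    and int: "U \<inter> V = {0}" and dec: "\<And>x. \<exists>u\<in>U. \<exists>v\<in>V. x = u + v"
  obtains \<pi> where "bounded_linear \<pi>" "\<And>x. \<pi> x \<in> U" "\<And>x. x - \<pi> x \<in> V"
    "\<And>u. u \<in> U \<Longrightarrow> \<pi> u = u" "\<And>v. v \<in> V \<Longrightarrow> \<pi> v = 0"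
proof -
  have sU: "subspace U" using U by simp
  have "\<exists>u\<in>U. x - u \<in> V" for x using dec[of x] by (metis add_diff_cancel_left')
  then obtain \<pi> where \<pi>: "\<And>x. \<pi> x \<in> U" "\<And>x. x - \<pi> x \<in> V" by metis
  have uniq: "\<pi> x = u" if "u \<in> U" "x - u \<in> V" for x u
  proof -
    have "\<pi> x - u \<in> U" using \<pi> that sU subspace_diff by blast
    moreover have "(x - u) - (x - \<pi> x) \<in> V" using \<pi> that V(1) subspace_diff by blast
    ultimately have "\<pi> x - u \<in> U \<inter> V" by simp
    then show ?thesis using int by auto
  qed
  have add: "\<pi> (x + y) = \<pi> x + \<pi> y" for x y
  proof (rule uniq)
    show "\<pi> x + \<pi> y \<in> U" using \<pi> sU subspace_add by blast
    have "(x - \<pi> x) + (y - \<pi> y) \<in> V" using \<pi> V(1) subspace_add by blast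
    then show "x + y - (\<pi> x + \<pi> y) \<in> V" by (simp add: algebra_simps)
  qed
  have scale: "\<pi> (c *\<^sub>R x) = c *\<^sub>R \<pi> x" for c x
  proof (rule uniq)
    show "c *\<^sub>R \<pi> x \<in> U" using \<pi> sU subspace_scale by blast
    have "c *\<^sub>R (x - \<pi> x) \<in> V" using \<pi> V(1) subspace_scale by blast
    then show "c *\<^sub>R x - c *\<^sub>R \<pi> x \<in> V" by (simp add: algebra_simps)
  qed
  have "\<exists>K. \<forall>x. norm (\<pi> x) \<le> norm x * K"
  proof (cases "U \<inter> sphere 0 1 = {}")
    case True
    have "\<pi> x = 0" for x
    proof (rule ccontr)
      assume "\<pi> x \<noteq> 0"
      then have "(1 / norm (\<pi> x)) *\<^sub>R \<pi> x \<in> U \<inter> sphere 0 1"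
        using \<pi>(1)[of x] subspace_scale[OF sU] by simp
      with True show False by blast
    qed
    then show ?thesis by (intro exI[of _ 0]) auto
  next
    case False
    have "compact (U \<inter> sphere 0 1)" unfolding U(1) by (rule compact_span_Int_sphere[OF U(2)])
    moreover have "continuous_on (U \<inter> sphere 0 1) (\<lambda>u. infdist u V)" by (intro continuous_intros)
    ultimately obtain w where w: "w \<in> U \<inter> sphere 0 1" "\<And>u. u \<in> U \<inter> sphere 0 1 \<Longrightarrow> infdist w V \<le> infdist u V"
      using continuous_attains_inf[of "U \<inter> sphere 0 1"] False by metis
    define d where "d = infdist w V"
    have "w \<notin> V"
    proof
      assume "w \<in> V"
      then have "w \<in> U \<inter> V" using w(1) by blast
      then have "w = 0" unfolding int by blast
      then show False using w(1) by simp
    qed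
    then have d: "d > 0"
      using in_closed_iff_infdist_zero[OF V(2), of w] infdist_nonneg[of w V] subspace_0[OF V(1)]
      unfolding d_def by (metis empty_iff less_eq_real_def)
    have "norm (\<pi> x) \<le> norm x * (1/d)" for x
    proof (cases "\<pi> x = 0")
      case False
      define n where "n = norm (\<pi> x)"
      have n: "n > 0" using False by (simp add: n_def)
      have "(1 / n) *\<^sub>R \<pi> x \<in> U \<inter> sphere 0 1"
        using \<pi>(1)[of x] subspace_scale[OF sU] n by (simp add: n_def)
      then have "d \<le> infdist ((1 / n) *\<^sub>R \<pi> x) V" unfolding d_def by (rule w(2))
      also have "\<dots> \<le> dist ((1 / n) *\<^sub>R \<pi> x) ((- 1/n) *\<^sub>R (x - \<pi> x))"
        by (rule infdist_le) (use \<pi>(2) V(1) subspace_scale in blast)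
      also have "\<dots> = norm ((1/n) *\<^sub>R x)" by (simp add: dist_norm algebra_simps)
      also have "\<dots> = norm x / n" using n by simp
      finally show ?thesis using n d by (simp add: n_def field_simps)
    qed (use d in auto)
    then show ?thesis by blast
  qed
  then obtain K where K: "\<And>x. norm (\<pi> x) \<le> norm x * K" by blast
  have "bounded_linear \<pi>" by (rule bounded_linear_intro[OF add scale K])
  moreover have "\<pi> u = u" if "u \<in> U" for u by (rule uniq) (use that V subspace_0 in auto)
  moreover have "\<pi> v = 0" if "v \<in> V" for v by (rule uniq) (use that sU subspace_0 in auto)
  ultimately show ?thesis using that \<pi> by blast
qed

text \<open>
  This excludes proper dense subspaces, such as a generator domain strictly inside a finite-dimensional space.
\<close>
lemma closed_subspace_of_finite_span:
  fixes V :: "'a::real_normed_vector set"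
  assumes "subspace V" "V \<subseteq> span B" "finite B"
  shows "closed V"
proof -
  obtain B' where B': "B' \<subseteq> V" "independent B'" "V \<subseteq> span B'" "card B' = dim V"
    using basis_exists[of V] by blast
  have "finite B'"
    using independent_span_bound[OF assms(3) B'(2)] B'(1) assms(2) by (meson order_trans)
  moreover have "V = span B'" using B' assms(1) by (metis span_minimal subset_antisym)
  ultimately show ?thesis using closed_span_finite by simp
qed

lemma nontrivial_relation_in_span:
  fixes f :: "nat \<Rightarrow> 'a::real_vector"
  assumes B: "finite B" and f: "\<And>i. f i \<in> span B"
  obtains c where "\<exists>i\<le>card B. c i \<noteq> 0" "(\<Sum>i\<le>card B. c i *\<^sub>R f i) = 0"
proof (cases "inj_on f {..card B}")
  case True
  have "dependent (f ` {..card B})"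
  proof (rule ccontr)
    assume "\<not> dependent (f ` {..card B})"
    then have "card (f ` {..card B}) \<le> card B" using independent_span_bound[OF B] f by blast
    then show False using card_image[OF True] by simp
  qed
  then obtain u where u: "\<exists>v\<in>f ` {..card B}. u v \<noteq> 0" "(\<Sum>v\<in>f ` {..card B}. u v *\<^sub>R v) = 0"
    using dependent_finite[of "f ` {..card B}"] by auto
  show ?thesis
    by (rule that[of "\<lambda>i. u (f i)"]) (use u sum.reindex[OF True, of "\<lambda>v. u v *\<^sub>R v"] in auto)
next
  case False
  then obtain i j where ij: "i \<le> card B" "j \<le> card B" "i \<noteq> j" "f i = f j"
    by (auto simp: inj_on_def)
  define c where "c k = (if k = i then 1 else if k = j then -1 else 0 :: real)" for k
  have "(\<Sum>k\<le>card B. c k *\<^sub>R f k) = (\<Sum>k\<le>card B. (if k = i then f k else 0) - (if k = j then f k else 0))"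
    by (rule sum.cong) (use ij in \<open>auto simp: c_def\<close>)
  also have "\<dots> = f i - f j" using ij by (simp add: sum_subtractf)
  finally show ?thesis using ij by (intro that[of c]) (auto simp: c_def)
qed

section \<open>Dini derivatives\<close>

lemma exp_decay_tendsto_0: "\<omega> > 0 \<Longrightarrow> ((\<lambda>t. exp (- \<omega> * t)) \<longlongrightarrow> 0) at_top" for \<omega> :: real
  by (intro filterlim_compose[OF exp_at_bot] filterlim_tendsto_neg_mult_at_bot[OF tendsto_const] filterlim_ident) auto

lemma exp_right_difference_quotient:
  fixes a :: real
  shows "((\<lambda>h. (exp (a * h) - 1) / h) \<longlongrightarrow> a) (at_right 0)"
proof -
  have "((\<lambda>h. exp (a * h)) has_real_derivative a) (at 0)" by (auto intro!: derivative_eq_intros)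
  then have "((\<lambda>h. (exp (a * h) - 1) / h) \<longlongrightarrow> a) (at 0)" by (simp add: DERIV_def)
  then show ?thesis by (rule tendsto_mono[rotated]) (simp add: at_le)
qed

text \<open>
  It suffices that \<open>f b\<close> is not above the line of slope \<open>e > 0\<close> through \<open>(a, f a)\<close>. If it were, there would be a last
  point \<open>c < b\<close> with \<open>f\<close> on or below the line, and the derivative bound at \<open>c\<close> would produce a later one.
\<close>
lemma nonincreasing_if_upper_Dini_nonpos:
  fixes f :: "real \<Rightarrow> real"
  assumes "a \<le> b" and cont: "continuous_on {a..b} f"
    and dini: "\<And>s e. a \<le> s \<Longrightarrow> s < b \<Longrightarrow> e > 0 \<Longrightarrow> \<forall>\<^sub>F h in at_right 0. f (s + h) \<le> f s + e * h"
  shows "f b \<le> f a"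
proof -
  have "f b \<le> f a + e * (b - a)" if e: "e > 0" for e
  proof (rule ccontr)
    assume "\<not> ?thesis"
    define g where "g s = f s - f a - e * (s - a)" for s
    have gb: "g b > 0" using \<open>\<not> _\<close> by (simp add: g_def)
    define S where "S = {s \<in> {a..b}. g s \<le> 0}"
    have "continuous_on {a..b} g" unfolding g_def by (intro continuous_intros cont)
    then have "closed ({a..b} \<inter> g -` {..0})" by (intro continuous_closed_preimage) auto
    moreover have "S = {a..b} \<inter> g -` {..0}" by (auto simp: S_def)
    ultimately have "compact S" using compact_Int_closed[of "{a..b}" S] by (metis compact_Icc inf.left_idem)
    moreover have "a \<in> S" using \<open>a \<le> b\<close> by (simp add: S_def g_def)
    ultimately obtain c where c: "c \<in> S" "\<And>s. s \<in> S \<Longrightarrow> s \<le> c"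
      using compact_attains_sup by (metis empty_iff)
    have cb: "c < b" using c(1) gb by (auto simp: S_def less_le)
    have ac: "a \<le> c" using c(1) by (simp add: S_def)
    have "\<forall>\<^sub>F h in at_right 0. f (c + h) \<le> f c + e * h" by (rule dini[OF ac cb e])
    moreover have "\<forall>\<^sub>F h in at_right 0. h \<in> {0<..<b - c}"
      using cb by (intro eventually_at_right_real) simp
    ultimately have "\<forall>\<^sub>F h in at_right (0::real). False"
    proof eventually_elim
      case (elim h)
      have "g (c + h) \<le> g c" using elim(1) by (simp add: g_def algebra_simps)
      then have "c + h \<in> S" using elim ac c(1) by (auto simp: S_def)
      then show ?case using c(2)[of "c + h"] elim by auto
    qed
    then show False by simp
  qed
  note * = this
  show ?thesis
  proof (rule field_le_epsilon)
    fix e :: real assume "e > 0"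
    then have "f b \<le> f a + e / (b - a + 1) * (b - a)" using \<open>a \<le> b\<close> by (intro *) simp
    also have "e / (b - a + 1) * (b - a) \<le> e" using \<open>a \<le> b\<close> \<open>e > 0\<close> by (simp add: field_simps)
    finally show "f b \<le> f a + e" by simp
  qed
qed

text \<open>
  Generators are defined by difference quotients; this gives access to the product and chain rules.
\<close>
lemma has_vector_derivative_at_right_iff:
  fixes f :: "real \<Rightarrow> 'a::real_normed_vector"
  shows "(f has_vector_derivative y) (at_right t) \<longleftrightarrow>
         ((\<lambda>h. (f (t + h) - f t) /\<^sub>R h) \<longlongrightarrow> y) (at_right 0)"
proof -
  have "(f has_vector_derivative y) (at_right t) \<longleftrightarrow>
        ((\<lambda>s. norm ((f s - f t) - (s - t) *\<^sub>R y) / norm (s - t)) \<longlongrightarrow> 0) (at_right t)"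
    by (simp add: has_vector_derivative_def has_derivative_iff_norm bounded_linear_scaleR_left)
  also have "\<dots> \<longleftrightarrow> ((\<lambda>h. norm ((f (t + h) - f t) - h *\<^sub>R y) / norm h) \<longlongrightarrow> 0) (at_right 0)"
    by (subst filterlim_at_right_to_0) (simp add: add.commute)
  also have "\<dots> \<longleftrightarrow> ((\<lambda>h. norm ((f (t + h) - f t) /\<^sub>R h - y)) \<longlongrightarrow> 0) (at_right 0)"
  proof (rule tendsto_cong)
    show "\<forall>\<^sub>F h in at_right 0. norm ((f (t + h) - f t) - h *\<^sub>R y) / norm h = norm ((f (t + h) - f t) /\<^sub>R h - y)"
      using eventually_at_right_less[of "0::real"]
    proof eventually_elim
      case (elim h)
      have "(f (t + h) - f t) /\<^sub>R h - y = ((f (t + h) - f t) - h *\<^sub>R y) /\<^sub>R h"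
        using elim by (simp add: scaleR_diff_right)
      then show ?case using elim by (simp add: divide_inverse mult.commute)
    qed
  qed
  also have "\<dots> \<longleftrightarrow> ((\<lambda>h. (f (t + h) - f t) /\<^sub>R h) \<longlongrightarrow> y) (at_right 0)"
    by (simp add: tendsto_norm_zero_iff Lim_null[symmetric])
  finally show ?thesis .
qed

text \<open>
  Orbits of a semigroup are differentiated from the right only, which spares a separate discussion of the
  left derivative.
\<close>
lemma constant_if_right_derivative_zero:
  fixes f :: "real \<Rightarrow> 'a::real_normed_vector"
  assumes "a \<le> b" and cont: "continuous_on {a..b} f"
    and deriv: "\<And>s. a \<le> s \<Longrightarrow> s < b \<Longrightarrow> (f has_vector_derivative 0) (at_right s)"
  shows "f b = f a"
proof -
  have "norm (f b - f a) \<le> norm (f a - f a)"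
  proof (rule nonincreasing_if_upper_Dini_nonpos[OF \<open>a \<le> b\<close>, where f = "\<lambda>s. norm (f s - f a)"])
    show "continuous_on {a..b} (\<lambda>s. norm (f s - f a))" by (intro continuous_intros cont)
    fix s e :: real assume s: "a \<le> s" "s < b" and e: "e > 0"
    have "\<forall>\<^sub>F h in at_right 0. dist ((f (s + h) - f s) /\<^sub>R h) 0 < e"
      using deriv[OF s] e unfolding has_vector_derivative_at_right_iff by (rule tendstoD)
    then show "\<forall>\<^sub>F h in at_right 0. norm (f (s + h) - f a) \<le> norm (f s - f a) + e * h"
      using eventually_at_right_less[of "0::real"]
    proof eventually_elim
      case (elim h)
      then have "norm ((f (s + h) - f s) /\<^sub>R h) < e" by (simp only: dist_norm diff_zero)
      then have "norm (f (s + h) - f s) / h < e" using elim(2) by (simp only: norm_scaleR) (simp add: field_simps)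
      then have "norm (f (s + h) - f s) \<le> e * h" using elim(2) by (simp add: pos_divide_less_eq)
      then show ?case using norm_triangle_ineq[of "f (s + h) - f s" "f s - f a"] by simp
    qed
  qed
  then show ?thesis by simp
qed

section \<open>Strongly continuous semigroups and their generators\<close>

lemma C0_semigroupD:
  assumes "C0_semigroup JX H T"
  shows "\<And>t x. t \<ge> 0 \<Longrightarrow> x \<in> H \<Longrightarrow> T t x \<in> H"
    and "\<And>t x y. t \<ge> 0 \<Longrightarrow> x \<in> H \<Longrightarrow> y \<in> H \<Longrightarrow> T t (x + y) = T t x + T t y"
    and "\<And>t c x. t \<ge> 0 \<Longrightarrow> x \<in> H \<Longrightarrow> T t (c *\<^sub>R x) = c *\<^sub>R T t x"
    and "\<And>t. t \<ge> 0 \<Longrightarrow> \<exists>M. \<forall>x\<in>H. norm (T t x) \<le> M * norm x"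
    and "\<And>x. x \<in> H \<Longrightarrow> T 0 x = x"
    and "\<And>s t x. s \<ge> 0 \<Longrightarrow> t \<ge> 0 \<Longrightarrow> x \<in> H \<Longrightarrow> T (s + t) x = T s (T t x)"
    and "\<And>x. x \<in> H \<Longrightarrow> ((\<lambda>t. T t x) \<longlongrightarrow> x) (at_right 0)"
  using assms unfolding C0_semigroup_def bounded_ops_def by (auto simp: image_subset_iff)

lemma C0_semigroup_J:
  assumes "C0_semigroup (Some J) H T" "t \<ge> 0" "x \<in> H"
  shows "T t (J x) = J (T t x)"
  using assms unfolding C0_semigroup_def bounded_ops_def by auto

lemma C0_semigroup_diff:
  assumes "C0_semigroup JX H T" "subspace H" "t \<ge> 0" "x \<in> H" "y \<in> H"
  shows "T t (x - y) = T t x - T t y"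
proof -
  have "T t (x + (-1) *\<^sub>R y) = T t x + (-1) *\<^sub>R T t y"
    using C0_semigroupD(2)[OF assms(1,3), of x "(-1) *\<^sub>R y"] C0_semigroupD(3)[OF assms(1,3,5), of "-1"]
      subspace_scale[OF assms(2), of y "-1"] assms by simp
  then show ?thesis by simp
qed

lemma C0_semigroup_bounded_linear:
  assumes "C0_semigroup JX UNIV T" "t \<ge> 0"
  shows "bounded_linear (T t)"
proof -
  obtain M where "\<And>x. norm (T t x) \<le> norm x * M"
    using C0_semigroupD(4)[OF assms] by (auto simp: mult.commute)
  then show ?thesis
    by (intro bounded_linear_intro[of _ M]) (auto intro!: C0_semigroupD[OF assms(1)] assms)
qed

text \<open>
  The carrier \<open>H\<close> is kept variable, so that the property passes to invariant subspaces.
\<close>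
definition locally_bounded_on :: "'x::real_normed_vector set \<Rightarrow> (real \<Rightarrow> 'x \<Rightarrow> 'x) \<Rightarrow> bool" where
  "locally_bounded_on H T \<longleftrightarrow> (\<forall>\<tau>. \<exists>K. \<forall>t\<in>{0..\<tau>}. \<forall>x\<in>H. norm (T t x) \<le> K * norm x)"

lemma locally_bounded_onE:
  assumes "locally_bounded_on H T"
  obtains K where "K \<ge> 0" "\<And>t x. 0 \<le> t \<Longrightarrow> t \<le> \<tau> \<Longrightarrow> x \<in> H \<Longrightarrow> norm (T t x) \<le> K * norm x"
proof -
  obtain K where K: "\<forall>t\<in>{0..\<tau>}. \<forall>x\<in>H. norm (T t x) \<le> K * norm x"
    using assms unfolding locally_bounded_on_def by blast
  have "norm (T t x) \<le> max K 0 * norm x" if "0 \<le> t" "t \<le> \<tau>" "x \<in> H" for t x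
  proof -
    have "norm (T t x) \<le> K * norm x" using K that by auto
    also have "\<dots> \<le> max K 0 * norm x" by (intro mult_right_mono) auto
    finally show ?thesis .
  qed
  then show ?thesis using that[of "max K 0"] by simp
qed

lemma locally_bounded_on_if_near_0:
  assumes sg: "C0_semigroup JX H T" and "\<delta> > 0"
    and near: "\<And>t x. 0 \<le> t \<Longrightarrow> t \<le> \<delta> \<Longrightarrow> x \<in> H \<Longrightarrow> norm (T t x) \<le> K * norm x"
  shows "locally_bounded_on H T"
proof -
  define L where "L = max K 1"
  have L: "L \<ge> 1" "L \<ge> K" by (auto simp: L_def)
  have *: "norm (T t x) \<le> L ^ Suc n * norm x" if "0 \<le> t" "t \<le> real (Suc n) * \<delta>" "x \<in> H" for n t x
    using that
  proof (induction n arbitrary: t)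
    case 0
    then have "norm (T t x) \<le> K * norm x" by (intro near) auto
    also have "\<dots> \<le> L * norm x" using L by (intro mult_right_mono) auto
    finally show ?case by simp
  next
    case (Suc n)
    show ?case
    proof (cases "t \<le> \<delta>")
      case True
      then have "norm (T t x) \<le> K * norm x" using Suc by (intro near) auto
      also have "\<dots> \<le> L ^ Suc (Suc n) * norm x"
        by (intro mult_right_mono order_trans[OF L(2) self_le_power[OF L(1)]]) auto
      finally show ?thesis .
    next
      case False
      then have "norm (T (t - \<delta>) x) \<le> L ^ Suc n * norm x"
        using Suc by (intro Suc.IH) (auto simp: algebra_simps)
      moreover have "T t x = T \<delta> (T (t - \<delta>) x)"
        using C0_semigroupD(6)[OF sg, of \<delta> "t - \<delta>" x] False \<open>\<delta> > 0\<close> Suc by simp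
      moreover have "norm (T \<delta> (T (t - \<delta>) x)) \<le> K * norm (T (t - \<delta>) x)"
        using False \<open>\<delta> > 0\<close> Suc.prems by (intro near C0_semigroupD(1)[OF sg]) auto
      moreover have "K * norm (T (t - \<delta>) x) \<le> L * norm (T (t - \<delta>) x)"
        using L by (intro mult_right_mono) auto
      moreover have "L * norm (T (t - \<delta>) x) \<le> L * (L ^ Suc n * norm x)"
        using L calculation(1) by (intro mult_left_mono) auto
      ultimately have "norm (T t x) \<le> L * (L ^ Suc n * norm x)" by (metis order_trans)
      then show ?thesis by (simp add: algebra_simps)
    qed
  qed
  show ?thesis
    unfolding locally_bounded_on_def
  proof
    fix \<tau>
    obtain n where n: "\<tau> / \<delta> < real n" using reals_Archimedean2 by blast
    then have "\<tau> \<le> real (Suc n) * \<delta>" using \<open>\<delta> > 0\<close> by (simp add: field_simps)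
    then show "\<exists>K. \<forall>t\<in>{0..\<tau>}. \<forall>x\<in>H. norm (T t x) \<le> K * norm x"
      using *[of _ n] by (intro exI[of _ "L ^ Suc n"]) auto
  qed
qed

lemma orbit_continuous:
  assumes sg: "C0_semigroup JX H T" and H: "subspace H" and lb: "locally_bounded_on H T" and x: "x \<in> H"
  shows "continuous_on {0..} (\<lambda>t. T t x)"
proof (rule continuous_onI)
  fix t e :: real assume t: "t \<in> {0..}" and e: "e > 0"
  obtain K where K: "K \<ge> 0" "\<And>s x. 0 \<le> s \<Longrightarrow> s \<le> t + 1 \<Longrightarrow> x \<in> H \<Longrightarrow> norm (T s x) \<le> K * norm x"
    using locally_bounded_onE[OF lb] by metis
  have "\<forall>\<^sub>F h in at_right 0. dist (T h x) x < e / (K + 1)"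
    using C0_semigroupD(7)[OF sg x] e K by (intro tendstoD) auto
  then obtain d where d: "d > 0" "\<And>h. 0 < h \<Longrightarrow> h < d \<Longrightarrow> dist (T h x) x < e / (K + 1)"
    by (auto simp: eventually_at_right_field)
  have key: "norm (T (r + h) x - T r x) \<le> e" if "0 \<le> r" "r \<le> t + 1" "0 \<le> h" "h < d" for r h
  proof -
    have "norm (T h x - x) \<le> e / (K + 1)"
    proof (cases "h = 0")
      case False
      then show ?thesis using d(2)[of h] that by (auto simp: dist_norm less_imp_le)
    qed (use e K C0_semigroupD(5)[OF sg x] in auto)
    moreover have "T (r + h) x - T r x = T r (T h x - x)"
      using C0_semigroup_diff[OF sg H that(1) _ x, of "T h x"] C0_semigroupD(1,6)[OF sg] that x by simp
    moreover have "norm (T r (T h x - x)) \<le> K * norm (T h x - x)"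
      using that x by (intro K(2) subspace_diff[OF H] C0_semigroupD(1)[OF sg]) auto
    ultimately have "norm (T (r + h) x - T r x) \<le> K * (e / (K + 1))"
      using mult_left_mono[OF _ K(1), of "norm (T h x - x)" "e / (K + 1)"] by simp
    also have "\<dots> \<le> e" using K(1) e by (simp add: field_simps)
    finally show ?thesis .
  qed
  show "\<exists>d>0. \<forall>s\<in>{0..}. dist s t < d \<longrightarrow> dist (T s x) (T t x) \<le> e"
  proof (intro exI[of _ "min d 1"] conjI ballI impI)
    fix s :: real assume s: "s \<in> {0..}" "dist s t < min d 1"
    show "dist (T s x) (T t x) \<le> e"
    proof (cases "s \<ge> t")
      case True
      then show ?thesis using key[of t "s - t"] s t by (simp add: dist_norm)
    next
      case False
      then show ?thesis using key[of s "t - s"] s t by (simp add: dist_norm norm_minus_commute)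
    qed
  qed (use d in auto)
qed

lemma generates_D:
  assumes "generates JX H D A T"
  shows "C0_semigroup JX H T" and "D \<subseteq> H"
    and "\<And>x. x \<in> D \<Longrightarrow> ((\<lambda>h. (T h x - x) /\<^sub>R h) \<longlongrightarrow> A x) (at_right 0)"
    and "\<And>x y. x \<in> H \<Longrightarrow> ((\<lambda>h. (T h x - x) /\<^sub>R h) \<longlongrightarrow> y) (at_right 0) \<Longrightarrow> x \<in> D \<and> A x = y"
proof -
  show "C0_semigroup JX H T" and "D \<subseteq> H" and
    1: "\<And>x. x \<in> D \<Longrightarrow> ((\<lambda>h. (T h x - x) /\<^sub>R h) \<longlongrightarrow> A x) (at_right 0)"
    using assms by (auto simp: generates_def)
  fix x y assume x: "x \<in> H" "((\<lambda>h. (T h x - x) /\<^sub>R h) \<longlongrightarrow> y) (at_right 0)"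
  then have "x \<in> D" using assms by (auto simp: generates_def)
  with 1[OF this] x(2) show "x \<in> D \<and> A x = y"
    using tendsto_unique trivial_limit_at_right_real by blast
qed

lemma generator_add:
  assumes gen: "generates JX H D A T" and H: "subspace H" and x: "x \<in> D" and y: "y \<in> D"
  shows "x + y \<in> D \<and> A (x + y) = A x + A y"
proof (rule generates_D(4)[OF gen])
  note sg = generates_D(1)[OF gen]
  have xy: "x \<in> H" "y \<in> H" using x y generates_D(2)[OF gen] by auto
  then show "x + y \<in> H" using H subspace_add by blast
  have "((\<lambda>h. (T h x - x) /\<^sub>R h + (T h y - y) /\<^sub>R h) \<longlongrightarrow> A x + A y) (at_right 0)"
    by (intro tendsto_add generates_D(3)[OF gen] x y)
  then show "((\<lambda>h. (T h (x + y) - (x + y)) /\<^sub>R h) \<longlongrightarrow> A x + A y) (at_right 0)"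
  proof (rule Lim_transform_eventually)
    show "\<forall>\<^sub>F h in at_right 0. (T h x - x) /\<^sub>R h + (T h y - y) /\<^sub>R h = (T h (x + y) - (x + y)) /\<^sub>R h"
      using eventually_at_right_less[of "0::real"]
      by eventually_elim (simp add: C0_semigroupD(2)[OF sg] xy algebra_simps)
  qed
qed

lemma generator_scale:
  assumes gen: "generates JX H D A T" and H: "subspace H" and x: "x \<in> D"
  shows "c *\<^sub>R x \<in> D \<and> A (c *\<^sub>R x) = c *\<^sub>R A x"
proof (rule generates_D(4)[OF gen])
  note sg = generates_D(1)[OF gen]
  have xy: "x \<in> H" using x generates_D(2)[OF gen] by auto
  then show "c *\<^sub>R x \<in> H" using H subspace_scale by blast
  have "((\<lambda>h. c *\<^sub>R ((T h x - x) /\<^sub>R h)) \<longlongrightarrow> c *\<^sub>R A x) (at_right 0)"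
    by (intro tendsto_intros generates_D(3)[OF gen] x)
  then show "((\<lambda>h. (T h (c *\<^sub>R x) - c *\<^sub>R x) /\<^sub>R h) \<longlongrightarrow> c *\<^sub>R A x) (at_right 0)"
  proof (rule Lim_transform_eventually)
    show "\<forall>\<^sub>F h in at_right 0. c *\<^sub>R ((T h x - x) /\<^sub>R h) = (T h (c *\<^sub>R x) - c *\<^sub>R x) /\<^sub>R h"
      using eventually_at_right_less[of "0::real"]
      by eventually_elim (simp add: C0_semigroupD(3)[OF sg] xy algebra_simps)
  qed
qed

lemma generator_commutes:
  assumes gen: "generates JX UNIV D A T" and P: "bounded_linear P"
    and comm: "\<And>t x. t \<ge> 0 \<Longrightarrow> T t (P x) = P (T t x)" and x: "x \<in> D"
  shows "P x \<in> D \<and> A (P x) = P (A x)"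
proof (rule generates_D(4)[OF gen])
  interpret P: bounded_linear P by (rule P)
  have "((\<lambda>h. P ((T h x - x) /\<^sub>R h)) \<longlongrightarrow> P (A x)) (at_right 0)"
    by (intro P.tendsto generates_D(3)[OF gen] x)
  then show "((\<lambda>h. (T h (P x) - P x) /\<^sub>R h) \<longlongrightarrow> P (A x)) (at_right 0)"
  proof (rule Lim_transform_eventually)
    show "\<forall>\<^sub>F h in at_right 0. P ((T h x - x) /\<^sub>R h) = (T h (P x) - P x) /\<^sub>R h"
      using eventually_at_right_less[of "0::real"]
      by eventually_elim (simp add: comm P.scaleR P.diff)
  qed
qed simp

lemma semigroup_continuous:
  assumes sg: "C0_semigroup JX H T" and H: "subspace H" and t: "t \<ge> 0"
    and z: "(z \<longlongrightarrow> x) F" "x \<in> H" "\<forall>\<^sub>F h in F. z h \<in> H"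
  shows "((\<lambda>h. T t (z h)) \<longlongrightarrow> T t x) F"
proof -
  obtain M where M: "\<forall>x\<in>H. norm (T t x) \<le> M * norm x" using C0_semigroupD(4)[OF sg t] by blast
  have "((\<lambda>h. T t (z h) - T t x) \<longlongrightarrow> 0) F"
  proof (rule Lim_null_comparison)
    show "\<forall>\<^sub>F h in F. norm (T t (z h) - T t x) \<le> M * norm (z h - x)"
      using z(3)
    proof eventually_elim
      case (elim h)
      then show ?case
        using M z(2) C0_semigroup_diff[OF sg H t, of "z h" x] subspace_diff[OF H, of "z h" x] by metis
    qed
    have "((\<lambda>h. M * norm (z h - x)) \<longlongrightarrow> M * norm (x - x)) F" by (intro tendsto_intros z(1))
    then show "((\<lambda>h. M * norm (z h - x)) \<longlongrightarrow> 0) F" by simp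
  qed
  then show ?thesis by (simp add: Lim_null[symmetric])
qed

lemma generator_domain_invariant:
  assumes gen: "generates JX H D A T" and H: "subspace H" "closed H" and x: "x \<in> D" and t: "t \<ge> 0"
  shows "T t x \<in> D \<and> A (T t x) = T t (A x)"
proof (rule generates_D(4)[OF gen])
  note sg = generates_D(1)[OF gen]
  have xH: "x \<in> H" using x generates_D(2)[OF gen] by auto
  then show "T t x \<in> H" using C0_semigroupD(1)[OF sg t] by blast
  have inH: "\<forall>\<^sub>F h in at_right 0. (T h x - x) /\<^sub>R h \<in> H"
    using eventually_at_right_less[of "0::real"]
    by eventually_elim (intro subspace_scale[OF H(1)] subspace_diff[OF H(1)] C0_semigroupD(1)[OF sg] xH, auto)
  have "A x \<in> H"
    by (rule Lim_in_closed_set[OF H(2) inH _ generates_D(3)[OF gen x]]) simp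
  then have "((\<lambda>h. T t ((T h x - x) /\<^sub>R h)) \<longlongrightarrow> T t (A x)) (at_right 0)"
    by (intro semigroup_continuous[OF sg H(1) t] generates_D(3)[OF gen x] inH)
  then show "((\<lambda>h. (T h (T t x) - T t x) /\<^sub>R h) \<longlongrightarrow> T t (A x)) (at_right 0)"
  proof (rule Lim_transform_eventually)
    show "\<forall>\<^sub>F h in at_right 0. T t ((T h x - x) /\<^sub>R h) = (T h (T t x) - T t x) /\<^sub>R h"
      using eventually_at_right_less[of "0::real"]
    proof eventually_elim
      case (elim h)
      have Th: "T h x \<in> H" using elim xH C0_semigroupD(1)[OF sg] by simp
      have "T h (T t x) = T t (T h x)"
        using C0_semigroupD(6)[OF sg _ t xH, of h] C0_semigroupD(6)[OF sg t _ xH, of h] elim by (simp add: add.commute)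
      then show ?case
        using C0_semigroupD(3)[OF sg t subspace_diff[OF H(1) Th xH]] C0_semigroup_diff[OF sg H(1) t Th xH] by simp
    qed
  qed
qed

lemma orbit_right_derivative:
  assumes gen: "generates JX H D A T" and H: "subspace H" "closed H" and x: "x \<in> D" and t: "t \<ge> 0"
  shows "((\<lambda>t. T t x) has_vector_derivative A (T t x)) (at_right t)"
proof -
  note sg = generates_D(1)[OF gen]
  have xH: "x \<in> H" using x generates_D(2)[OF gen] by auto
  have "T t x \<in> D" using generator_domain_invariant[OF gen H x t] by blast
  from generates_D(3)[OF gen this] have "((\<lambda>h. (T (t + h) x - T t x) /\<^sub>R h) \<longlongrightarrow> A (T t x)) (at_right 0)"
  proof (rule Lim_transform_eventually)
    show "\<forall>\<^sub>F h in at_right 0. (T h (T t x) - T t x) /\<^sub>R h = (T (t + h) x - T t x) /\<^sub>R h"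
      using eventually_at_right_less[of "0::real"]
      by eventually_elim (use C0_semigroupD(6)[OF sg _ t xH] in \<open>simp add: add.commute[of t]\<close>)
  qed
  then show ?thesis unfolding has_vector_derivative_at_right_iff .
qed

text \<open>
  The domain is dense because it contains the means of an orbit over \<open>[0, h]\<close>: applying \<open>T r\<close> shifts the interval of
  integration, so that only its two end pieces contribute to the difference quotient.
\<close>
lemma semigroup_averages_in_domain:
  fixes T :: "real \<Rightarrow> 'x::banach \<Rightarrow> 'x"
  assumes gen: "generates JX UNIV D A T" and lb: "locally_bounded_on UNIV T"
  obtains z :: "real \<Rightarrow> 'x" where "\<And>h. h > 0 \<Longrightarrow> z h \<in> D" "(z \<longlongrightarrow> x) (at_right 0)"
proof -
  note sg = generates_D(1)[OF gen]
  have cont: "continuous_on {0..} (\<lambda>t. T t x)" by (rule orbit_continuous[OF sg subspace_UNIV lb]) simp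
  define I where "I t = integral {0..t} (\<lambda>s. T s x)" for t
  have I0: "I 0 = 0" by (simp add: I_def)
  have int: "(\<lambda>s. T s x) integrable_on {a..b}" if "0 \<le> a" for a b
    by (intro integrable_continuous_real continuous_on_subset[OF cont]) (use that in auto)
  have deriv: "((\<lambda>r. (I (t + r) - I t) /\<^sub>R r) \<longlongrightarrow> T t x) (at_right 0)" if "t \<ge> 0" for t
  proof -
    have "(I has_vector_derivative T t x) (at t within {0..t+1})"
      unfolding I_def using that
      by (intro integral_has_vector_derivative continuous_on_subset[OF cont]) auto
    then have "(I has_vector_derivative T t x) (at t within {t..t+1})"
      by (rule has_vector_derivative_within_subset) (use that in auto)
    then show ?thesis
      by (simp add: at_within_Icc_at_right has_vector_derivative_at_right_iff)
  qed
  have shift: "T r (I h) = I (r + h) - I r" if "r \<ge> 0" "h \<ge> 0" for r h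
  proof -
    interpret Tr: bounded_linear "T r" by (rule C0_semigroup_bounded_linear[OF sg that(1)])
    have "T r (I h) = integral {0..h} (\<lambda>s. T r (T s x))"
      unfolding I_def using integral_linear[OF int Tr.bounded_linear_axioms] by (simp add: o_def)
    also have "\<dots> = integral {0..h} (\<lambda>s. T (s + r) x)"
      by (rule integral_cong) (use C0_semigroupD(6)[OF sg that(1)] in \<open>simp add: add.commute[of _ r]\<close>)
    also have "\<dots> = integral {r..r + h} (\<lambda>s. T s x)"
    proof -
      have "((\<lambda>s. T s x) has_integral integral {r..r+h} (\<lambda>s. T s x)) {r..r+h}"
        using int[of r] that by (simp add: integrable_integral)
      then have "((\<lambda>s. T (s + r) x) has_integral integral {r..r+h} (\<lambda>s. T s x)) {0..h}"
        using has_integral_shift_Icc_real[of "\<lambda>s. T s x" r _ 0 h] by (simp add: o_def add.commute)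
      then show ?thesis by (rule integral_unique)
    qed
    also have "\<dots> = I (r + h) - I r"
      unfolding I_def using Henstock_Kurzweil_Integration.integral_combine[of 0 r "r + h" "\<lambda>s. T s x"] int that by (simp add: algebra_simps)
    finally show ?thesis .
  qed
  have ID: "I h \<in> D" if "h \<ge> 0" for h
  proof -
    have "((\<lambda>r. (I (h + r) - I h) /\<^sub>R r - (I (0 + r) - I 0) /\<^sub>R r) \<longlongrightarrow> T h x - T 0 x) (at_right 0)"
      by (intro tendsto_diff deriv) (use that in auto)
    then have "((\<lambda>r. (T r (I h) - I h) /\<^sub>R r) \<longlongrightarrow> T h x - T 0 x) (at_right 0)"
    proof (rule Lim_transform_eventually)
      show "\<forall>\<^sub>F r in at_right 0. (I (h + r) - I h) /\<^sub>R r - (I (0 + r) - I 0) /\<^sub>R r = (T r (I h) - I h) /\<^sub>R r"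
        using eventually_at_right_less[of "0::real"]
        by eventually_elim (use that in \<open>simp add: shift I0 algebra_simps\<close>)
    qed
    then show ?thesis using generates_D(4)[OF gen] by blast
  qed
  show ?thesis
  proof (rule that[of "\<lambda>h. I h /\<^sub>R h"])
    show "I h /\<^sub>R h \<in> D" if "h > 0" for h
      using generator_scale[OF gen subspace_UNIV ID] that by simp
    show "((\<lambda>h. I h /\<^sub>R h) \<longlongrightarrow> x) (at_right 0)"
      using deriv[of 0] I0 C0_semigroupD(5)[OF sg] by simp
  qed
qed

lemma generator_domain_subspace:
  assumes gen: "generates JX H D A T" and H: "subspace H"
  shows "subspace D"
proof (rule subspaceI)
  note sg = generates_D(1)[OF gen]
  have H0: "0 \<in> H" by (rule subspace_0[OF H])
  have "((\<lambda>h. (T h 0 - 0) /\<^sub>R h) \<longlongrightarrow> 0) (at_right 0)"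
  proof (rule tendsto_eventually)
    show "\<forall>\<^sub>F h in at_right 0. (T h 0 - 0) /\<^sub>R h = 0"
      using eventually_at_right_less[of "0::real"]
    proof eventually_elim
      case (elim h)
      then have "T h 0 = 0" using C0_semigroupD(3)[OF sg _ H0, of h 0] by simp
      then show ?case by simp
    qed
  qed
  then show "0 \<in> D" using generates_D(4)[OF gen H0] by blast
qed (use generator_add[OF gen H] generator_scale[OF gen H] in auto)

text \<open>
  Since \<open>\<pi>\<close> preserves the dense domain, \<open>D \<inter> U\<close> is dense in \<open>U\<close>; being a subspace of a finite-dimensional space, it is
  also closed.
\<close>
lemma finite_dim_invariant_subset_domain:
  fixes T :: "real \<Rightarrow> 'z::banach \<Rightarrow> 'z"
  assumes gen: "generates JX UNIV D A T" and lb: "locally_bounded_on UNIV T" and U: "U = span B" "finite B"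
    and \<pi>: "bounded_linear \<pi>" "\<And>x. \<pi> x \<in> U" "\<And>u. u \<in> U \<Longrightarrow> \<pi> u = u"
    and comm: "\<And>t x. t \<ge> 0 \<Longrightarrow> T t (\<pi> x) = \<pi> (T t x)"
  shows "U \<subseteq> D"
proof
  fix u assume u: "u \<in> U"
  obtain z :: "real \<Rightarrow> 'z" where z: "\<And>h. h > 0 \<Longrightarrow> z h \<in> D" "(z \<longlongrightarrow> u) (at_right 0)"
    using semigroup_averages_in_domain[OF gen lb] by blast
  have cl: "closed (U \<inter> D)"
    by (rule closed_subspace_of_finite_span[OF _ _ U(2)]) (use generator_domain_subspace[OF gen subspace_UNIV] U in \<open>auto intro: subspace_inter\<close>)
  have ev: "\<forall>\<^sub>F h in at_right 0. \<pi> (z h) \<in> U \<inter> D"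
    using eventually_at_right_less[of "0::real"]
    by eventually_elim (use \<pi>(2) z(1) generator_commutes[OF gen \<pi>(1) comm] in auto)
  have lim: "((\<lambda>h. \<pi> (z h)) \<longlongrightarrow> \<pi> u) (at_right 0)"
    by (rule bounded_linear.tendsto[OF \<pi>(1) z(2)])
  have "\<pi> u \<in> U \<inter> D" by (rule Lim_in_closed_set[OF cl ev _ lim]) simp
  then show "u \<in> D" using \<pi>(3)[OF u] by simp
qed

section \<open>Power series and exponentials of bounded operators\<close>

text \<open>
  The bilinear map \<open>B\<close> is multiplication by scalars. With real scalars the lemma differentiates the exponential of an
  operator, with complex ones it provides local primitives of the resolvent.
\<close>
lemma power_series_primitive:
  fixes B :: "'k::real_normed_field \<Rightarrow> 'z::banach \<Rightarrow> 'w::banach" and b :: "nat \<Rightarrow> 'z"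
  assumes "bounded_bilinear B" and b: "\<And>n. norm (b n) \<le> c * q ^ n" and q: "q \<ge> 0" "\<rho> \<ge> 0" "\<rho> * q < 1"
  obtains \<Phi> where "\<And>h \<zeta>. norm \<zeta> < \<rho> \<Longrightarrow> summable (\<lambda>n. B (h * \<zeta> ^ n) (b n))"
    "\<And>\<zeta>. norm \<zeta> < \<rho> \<Longrightarrow> (\<lambda>n. B (\<zeta> ^ Suc n / of_nat (Suc n)) (b n)) sums \<Phi> \<zeta>"
    "\<And>\<zeta>. norm \<zeta> < \<rho> \<Longrightarrow> (\<Phi> has_derivative (\<lambda>h. \<Sum>n. B (h * \<zeta> ^ n) (b n))) (at \<zeta>)"
proof (cases "\<rho> = 0")
  case False
  then have "\<rho> > 0" using q by simp
  interpret B: bounded_bilinear B by fact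
  obtain k where k: "k > 0" "\<And>x y. norm (B x y) \<le> norm x * norm y * k"
    using B.pos_bounded by blast
  have c: "c \<ge> 0" using b[of 0] norm_ge_zero[of "b 0"] by (simp del: norm_ge_zero)
  define \<theta> where "\<theta> = \<rho> * q"
  have \<theta>: "0 \<le> \<theta>" "\<theta> < 1" using q by (auto simp: \<theta>_def)
  have bound: "norm (B (h * \<zeta> ^ n) (b n)) \<le> (k * c * norm h) * \<theta> ^ n" if "norm \<zeta> < \<rho>" for h \<zeta> n
  proof -
    have "norm (B (h * \<zeta> ^ n) (b n)) \<le> (norm h * norm \<zeta> ^ n) * norm (b n) * k"
      using k(2)[of "h * \<zeta> ^ n" "b n"] by (simp add: norm_mult norm_power)
    also have "\<dots> \<le> (norm h * \<rho> ^ n) * (c * q ^ n) * k"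
      using that k(1) q b[of n] by (intro mult_right_mono mult_mono mult_left_mono power_mono) auto
    finally show ?thesis by (simp add: \<theta>_def power_mult_distrib mult_ac)
  qed
  have summ: "summable (\<lambda>n. B (h * \<zeta> ^ n) (b n))" if "norm \<zeta> < \<rho>" for h \<zeta>
    by (rule summable_comparison_test'[OF summable_mult[OF summable_geometric], where N = 0])
       (use bound[OF that] \<theta> in auto)
  have tail: "norm ((\<Sum>i<n. B (h * \<zeta> ^ i) (b i)) - (\<Sum>n. B (h * \<zeta> ^ n) (b n))) \<le> (k * c * norm h) * (\<theta> ^ n / (1 - \<theta>))"
    if "norm \<zeta> < \<rho>" for h \<zeta> n
  proof -
    have "(\<Sum>i<n. B (h * \<zeta> ^ i) (b i)) - (\<Sum>n. B (h * \<zeta> ^ n) (b n)) = - (\<Sum>i. B (h * \<zeta> ^ (i + n)) (b (i + n)))"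
      using suminf_split_initial_segment[OF summ[OF that], of h n] by simp
    also have "norm \<dots> \<le> (\<Sum>i. (k * c * norm h) * \<theta> ^ n * \<theta> ^ i)"
      unfolding norm_minus_cancel
    proof (rule norm_suminf_le)
      show "norm (B (h * \<zeta> ^ (i + n)) (b (i + n))) \<le> (k * c * norm h) * \<theta> ^ n * \<theta> ^ i" for i
        using bound[OF that, of h "i + n"] by (simp add: power_add mult_ac)
      show "summable (\<lambda>i. (k * c * norm h) * \<theta> ^ n * \<theta> ^ i)"
        using \<theta> by (intro summable_mult summable_geometric) simp
    qed
    also have "\<dots> = (k * c * norm h) * (\<theta> ^ n / (1 - \<theta>))"
      using \<theta> by (simp add: suminf_mult summable_geometric suminf_geometric)
    finally show ?thesis .
  qed
  have "\<exists>\<Phi>. \<forall>\<zeta>\<in>ball 0 \<rho>. (\<lambda>n. B (\<zeta> ^ Suc n / of_nat (Suc n)) (b n)) sums \<Phi> \<zeta> \<and>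
      (\<Phi> has_derivative (\<lambda>h. \<Sum>n. B (h * \<zeta> ^ n) (b n))) (at \<zeta> within ball 0 \<rho>)"
  proof (rule has_derivative_series[where f' = "\<lambda>n \<zeta> h. B (h * \<zeta> ^ n) (b n)" and x = 0 and l = 0])
    show "((\<lambda>\<zeta>. B (\<zeta> ^ Suc n / of_nat (Suc n)) (b n)) has_derivative (\<lambda>h. B (h * \<zeta> ^ n) (b n))) (at \<zeta> within ball 0 \<rho>)" for n \<zeta>
    proof (rule bounded_linear.has_derivative[OF B.bounded_linear_left])
      have "((\<lambda>\<zeta>. \<zeta> ^ Suc n) has_field_derivative of_nat (Suc n) * \<zeta> ^ n) (at \<zeta> within ball 0 \<rho>)"
        by (rule derivative_eq_intros refl | simp)+
      then have "((\<lambda>\<zeta>. \<zeta> ^ Suc n / of_nat (Suc n)) has_field_derivative of_nat (Suc n) * \<zeta> ^ n / of_nat (Suc n)) (at \<zeta> within ball 0 \<rho>)"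
        by (rule DERIV_cdivide)
      moreover have "of_nat (Suc n) * \<zeta> ^ n / of_nat (Suc n) = \<zeta> ^ n"
        by (rule nonzero_mult_div_cancel_left) (rule of_nat_neq_0)
      ultimately show "((\<lambda>\<zeta>. \<zeta> ^ Suc n / of_nat (Suc n)) has_derivative (\<lambda>h. h * \<zeta> ^ n)) (at \<zeta> within ball 0 \<rho>)"
        by (simp add: has_field_derivative_def mult.commute[of _ "\<zeta> ^ n"] del: power_Suc)
    qed
    show "\<forall>\<^sub>F n in sequentially. \<forall>\<zeta>\<in>ball 0 \<rho>. \<forall>h. norm ((\<Sum>i<n. B (h * \<zeta> ^ i) (b i)) - (\<Sum>n. B (h * \<zeta> ^ n) (b n))) \<le> e * norm h"
      if "e > 0" for e
    proof -
      have "(\<lambda>n. k * c * (\<theta> ^ n / (1 - \<theta>))) \<longlonglongrightarrow> k * c * (0 / (1 - \<theta>))"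
        using \<theta> by (intro tendsto_intros LIMSEQ_power_zero) auto
      then have "\<forall>\<^sub>F n in sequentially. k * c * (\<theta> ^ n / (1 - \<theta>)) < e"
        by (rule order_tendstoD) (use that in simp)
      then show ?thesis
      proof eventually_elim
        case (elim n)
        have e: "(k * c * norm h) * (\<theta> ^ n / (1 - \<theta>)) \<le> e * norm h" for h :: 'k
          using mult_right_mono[OF less_imp_le[OF elim], of "norm h"] by (simp add: mult_ac)
        show ?case
          by (intro ballI allI order_trans[OF tail e]) simp
      qed
    qed
    show "(\<lambda>n. B (0 ^ Suc n / of_nat (Suc n)) (b n)) sums 0" by (simp add: B.zero_left)
  qed (use \<open>\<rho> > 0\<close> in auto)
  then obtain \<Phi> where \<Phi>: "\<And>\<zeta>. \<zeta> \<in> ball 0 \<rho> \<Longrightarrow> (\<lambda>n. B (\<zeta> ^ Suc n / of_nat (Suc n)) (b n)) sums \<Phi> \<zeta> \<and>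
      (\<Phi> has_derivative (\<lambda>h. \<Sum>n. B (h * \<zeta> ^ n) (b n))) (at \<zeta> within ball 0 \<rho>)"
    by blast
  show ?thesis
  proof (rule that[OF summ])
    show "(\<lambda>n. B (\<zeta> ^ Suc n / of_nat (Suc n)) (b n)) sums \<Phi> \<zeta>"
      and "(\<Phi> has_derivative (\<lambda>h. \<Sum>n. B (h * \<zeta> ^ n) (b n))) (at \<zeta>)" if "norm \<zeta> < \<rho>" for \<zeta>
      using \<Phi>[of \<zeta>] that at_within_open[of \<zeta> "ball 0 \<rho>"] by auto
  qed
qed (use that in auto)

text \<open>
  The operators on the zero space have an identity of norm 0, so the operators on a general space do not form
  a normed algebra with unit, and powers and exponentials are set up directly.
\<close>
primrec blinfun_power :: "('x::real_normed_vector \<Rightarrow>\<^sub>L 'x) \<Rightarrow> nat \<Rightarrow> 'x \<Rightarrow>\<^sub>L 'x" where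
  "blinfun_power K 0 = id_blinfun"
| "blinfun_power K (Suc n) = K o\<^sub>L blinfun_power K n"

definition exp_blinfun :: "('x::banach \<Rightarrow>\<^sub>L 'x) \<Rightarrow> real \<Rightarrow> 'x \<Rightarrow>\<^sub>L 'x" where
  "exp_blinfun K t = (\<Sum>n. (t ^ n / fact n) *\<^sub>R blinfun_power K n)"

lemma norm_blinfun_power: "norm (blinfun_power K n) \<le> norm K ^ n"
proof (induction n)
  case 0
  then show ?case by (simp add: norm_blinfun_id_le)
next
  case (Suc n)
  have "norm (blinfun_power K (Suc n)) \<le> norm K * norm (blinfun_power K n)"
    by (simp add: norm_blinfun_compose)
  also have "\<dots> \<le> norm K * norm K ^ n" by (intro mult_left_mono Suc) auto
  finally show ?case by simp
qed

lemma blinfun_compose_assoc: "(f o\<^sub>L g) o\<^sub>L h = f o\<^sub>L (g o\<^sub>L h)"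
  by (rule blinfun_eqI) simp

lemma blinfun_compose_id [simp]: "id_blinfun o\<^sub>L f = f" "f o\<^sub>L id_blinfun = f"
  by (auto intro!: blinfun_eqI)

lemma blinfun_power_commute: "blinfun_power K n o\<^sub>L K = K o\<^sub>L blinfun_power K n"
  by (induction n) (simp_all add: blinfun_compose_assoc)

lemma exp_blinfun_sums: "(\<lambda>n. (t ^ n / fact n) *\<^sub>R blinfun_power K n) sums exp_blinfun K t"
proof -
  have "summable (\<lambda>n. (t ^ n / fact n) *\<^sub>R blinfun_power K n)"
  proof (rule summable_comparison_test'[where N = 0])
    show "summable (\<lambda>n. (\<bar>t\<bar> * norm K) ^ n /\<^sub>R fact n)" by (rule summable_exp_generic)
    fix n
    have "norm ((t ^ n / fact n) *\<^sub>R blinfun_power K n) \<le> \<bar>t\<bar> ^ n / fact n * norm K ^ n"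
      by (simp add: power_abs mult_left_mono norm_blinfun_power divide_right_mono)
    then show "norm ((t ^ n / fact n) *\<^sub>R blinfun_power K n) \<le> (\<bar>t\<bar> * norm K) ^ n /\<^sub>R fact n"
      by (simp add: power_mult_distrib divide_inverse mult_ac)
  qed
  then show ?thesis unfolding exp_blinfun_def by (rule summable_sums)
qed

lemma exp_blinfun_0 [simp]: "exp_blinfun K 0 = id_blinfun"
proof -
  have "(\<lambda>n. if n = 0 then id_blinfun else 0) sums (id_blinfun :: 'a \<Rightarrow>\<^sub>L 'a)"
    by (rule sums_single)
  moreover have "(0 ^ n / fact n) *\<^sub>R blinfun_power K n = (if n = 0 then id_blinfun else 0)" for n
    by (cases n) auto
  ultimately show ?thesis using sums_unique2[OF exp_blinfun_sums[of 0 K]] by simp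
qed

lemma exp_blinfun_commute: "exp_blinfun K t o\<^sub>L K = K o\<^sub>L exp_blinfun K t"
proof -
  have "(\<lambda>n. ((t ^ n / fact n) *\<^sub>R blinfun_power K n) o\<^sub>L K) sums (exp_blinfun K t o\<^sub>L K)"
    by (rule bounded_linear.sums[OF bounded_bilinear.bounded_linear_left[OF bounded_bilinear_blinfun_compose] exp_blinfun_sums])
  moreover have "(\<lambda>n. K o\<^sub>L ((t ^ n / fact n) *\<^sub>R blinfun_power K n)) sums (K o\<^sub>L exp_blinfun K t)"
    by (rule bounded_linear.sums[OF bounded_bilinear.bounded_linear_right[OF bounded_bilinear_blinfun_compose] exp_blinfun_sums])
  moreover have "((t ^ n / fact n) *\<^sub>R blinfun_power K n) o\<^sub>L K = K o\<^sub>L ((t ^ n / fact n) *\<^sub>R blinfun_power K n)" for n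
    using arg_cong[OF blinfun_power_commute, of "\<lambda>f. (t ^ n / fact n) *\<^sub>R f" K n]
    by (auto intro!: blinfun_eqI simp: blinfun.scaleR_left blinfun.scaleR_right dest: fun_cong[OF arg_cong, of _ _ blinfun_apply])
  ultimately show ?thesis using sums_unique2 by fastforce
qed

lemma exp_blinfun_has_vector_derivative:
  "(exp_blinfun K has_vector_derivative (K o\<^sub>L exp_blinfun K t)) (at t within S)"
proof -
  define \<rho> where "\<rho> = \<bar>t\<bar> + 1"
  define b where "b n = (1 / fact n) *\<^sub>R blinfun_power K (Suc n)" for n
  define q where "q = 1 / (2 * \<rho>)"
  have \<rho>: "\<rho> > 0" by (simp add: \<rho>_def)
  obtain \<Phi> where \<Phi>: "\<And>\<zeta>. norm \<zeta> < \<rho> \<Longrightarrow> (\<lambda>n. (\<zeta> ^ Suc n / of_nat (Suc n)) *\<^sub>R b n) sums \<Phi> \<zeta>"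
    "\<And>\<zeta>. norm \<zeta> < \<rho> \<Longrightarrow> (\<Phi> has_derivative (\<lambda>h. \<Sum>n. (h * \<zeta> ^ n) *\<^sub>R b n)) (at \<zeta>)"
  proof (rule power_series_primitive[of "(*\<^sub>R)" b "norm K * exp (norm K / q)" q \<rho>])
    show "bounded_bilinear ((*\<^sub>R) :: real \<Rightarrow> ('a \<Rightarrow>\<^sub>L 'a) \<Rightarrow> _)" by (rule bounded_bilinear_scaleR)
    show "norm (b n) \<le> norm K * exp (norm K / q) * q ^ n" for n
    proof -
      have q: "q > 0" using \<rho> by (simp add: q_def)
      have "(norm K / q) ^ n / fact n \<le> exp (norm K / q)"
        using sum_le_suminf[OF summable_exp_generic, of "{n}" "norm K / q"] q by (simp add: exp_def divide_inverse mult.commute)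
      then have "norm K ^ n / fact n \<le> exp (norm K / q) * q ^ n" using q by (simp add: power_divide field_simps)
      then have "norm K * (norm K ^ n / fact n) \<le> norm K * (exp (norm K / q) * q ^ n)" by (intro mult_left_mono) auto
      moreover have "norm (b n) \<le> norm K * (norm K ^ n / fact n)"
        using norm_blinfun_power[of K "Suc n"] by (simp add: b_def divide_right_mono del: blinfun_power.simps)
      ultimately show ?thesis by simp
    qed
  qed (use \<rho> in \<open>auto simp: q_def\<close>)
  have term_eq: "(\<zeta> ^ Suc n / of_nat (Suc n)) *\<^sub>R b n = (\<zeta> ^ Suc n / fact (Suc n)) *\<^sub>R blinfun_power K (Suc n)" for \<zeta> n
    by (simp add: b_def del: blinfun_power.simps power_Suc)
  have eq: "exp_blinfun K \<zeta> = \<Phi> \<zeta> + id_blinfun" if "norm \<zeta> < \<rho>" for \<zeta>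
  proof -
    have "(\<lambda>n. (\<zeta> ^ Suc n / fact (Suc n)) *\<^sub>R blinfun_power K (Suc n)) sums \<Phi> \<zeta>"
      using \<Phi>(1)[OF that] by (simp only: term_eq)
    then have "(\<lambda>n. (\<zeta> ^ n / fact n) *\<^sub>R blinfun_power K n) sums (\<Phi> \<zeta> + (\<zeta> ^ 0 / fact 0) *\<^sub>R blinfun_power K 0)"
      by (rule sums_Suc)
    then show ?thesis using sums_unique2[OF exp_blinfun_sums] by simp
  qed
  have sum: "(\<Sum>n. (h * t ^ n) *\<^sub>R b n) = h *\<^sub>R (K o\<^sub>L exp_blinfun K t)" for h
  proof -
    have "(\<lambda>n. K o\<^sub>L ((t ^ n / fact n) *\<^sub>R blinfun_power K n)) sums (K o\<^sub>L exp_blinfun K t)"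
      by (rule bounded_linear.sums[OF bounded_bilinear.bounded_linear_right[OF bounded_bilinear_blinfun_compose] exp_blinfun_sums])
    then have "(\<lambda>n. h *\<^sub>R (K o\<^sub>L ((t ^ n / fact n) *\<^sub>R blinfun_power K n))) sums (h *\<^sub>R (K o\<^sub>L exp_blinfun K t))"
      by (rule sums_scaleR_right)
    moreover have "h *\<^sub>R (K o\<^sub>L ((t ^ n / fact n) *\<^sub>R blinfun_power K n)) = (h * t ^ n) *\<^sub>R b n" for n
      by (auto simp: b_def blinfun.scaleR_left blinfun.scaleR_right intro!: blinfun_eqI)
    ultimately show ?thesis by (simp add: sums_unique[symmetric])
  qed
  have t: "norm t < \<rho>" by (simp add: \<rho>_def)
  have "((\<lambda>\<zeta>. \<Phi> \<zeta> + id_blinfun) has_vector_derivative (K o\<^sub>L exp_blinfun K t)) (at t)"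
    unfolding has_vector_derivative_def
    using has_derivative_add_const[OF \<Phi>(2)[OF t], of id_blinfun] by (simp add: sum)
  then have "(exp_blinfun K has_vector_derivative (K o\<^sub>L exp_blinfun K t)) (at t)"
    by (rule has_vector_derivative_transform_within_open[of _ _ _ "ball 0 \<rho>"]) (use t eq in auto)
  then show ?thesis by (rule has_vector_derivative_at_within)
qed

lemma exp_blinfun_apply_has_vector_derivative [derivative_intros]:
  "((\<lambda>t. exp_blinfun K t x) has_vector_derivative K (exp_blinfun K t x)) (at t within S)"
  using bounded_linear.has_vector_derivative[OF bounded_bilinear.bounded_linear_left[OF bounded_bilinear_blinfun_apply]
      exp_blinfun_has_vector_derivative[of K t S], of x] by simp

lemma continuous_on_exp_blinfun: "continuous_on S (exp_blinfun K)"
  by (rule continuous_on_vector_derivative) (rule exp_blinfun_has_vector_derivative)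

lemma exp_blinfun_uminus_has_vector_derivative:
  "((\<lambda>s. exp_blinfun K (- s)) has_vector_derivative - (K o\<^sub>L exp_blinfun K (- s))) (at s within S)"
proof -
  have "(uminus has_vector_derivative (-1)) (at s within S)" by (auto intro!: derivative_eq_intros)
  from vector_diff_chain_within[OF this exp_blinfun_has_vector_derivative]
  show ?thesis by (simp add: o_def)
qed

text \<open>
  The derivative of \<open>exp (- s K) exp ((s + t) K)\<close> with respect to \<open>s\<close> vanishes.
\<close>
lemma exp_blinfun_add: "exp_blinfun K (s + t) = exp_blinfun K s o\<^sub>L exp_blinfun K t"
proof -
  let ?E = "exp_blinfun K"
  have const: "?E (- s) o\<^sub>L ?E (s + t) = ?E t" for s t
  proof -
    have plus: "((\<lambda>s. ?E (s + t)) has_vector_derivative (K o\<^sub>L ?E (s + t))) (at s)" for s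
    proof -
      have "((\<lambda>s. s + t) has_vector_derivative 1) (at s)" by (auto intro!: derivative_eq_intros)
      from vector_diff_chain_at[OF this exp_blinfun_has_vector_derivative[of K "s + t" UNIV]]
      show ?thesis by (simp add: o_def)
    qed
    have "((\<lambda>s. ?E (- s) o\<^sub>L ?E (s + t)) has_vector_derivative
        ((?E (- s) o\<^sub>L (K o\<^sub>L ?E (s + t))) + ((- (K o\<^sub>L ?E (- s))) o\<^sub>L ?E (s + t)))) (at s within UNIV)" for s
      using bounded_bilinear.has_vector_derivative[OF bounded_bilinear_blinfun_compose exp_blinfun_uminus_has_vector_derivative plus[of s]] by (simp only:)
    moreover have "(?E (- s) o\<^sub>L (K o\<^sub>L ?E (s + t))) + ((- (K o\<^sub>L ?E (- s))) o\<^sub>L ?E (s + t)) = 0" for s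
      by (simp add: blinfun_compose_assoc[symmetric] exp_blinfun_commute
          bounded_bilinear.minus_left[OF bounded_bilinear_blinfun_compose])
    ultimately have "((\<lambda>s. ?E (- s) o\<^sub>L ?E (s + t)) has_derivative (\<lambda>h. 0)) (at s within UNIV)" for s
      by (simp add: has_vector_derivative_def)
    then obtain c where "\<And>s. ?E (- s) o\<^sub>L ?E (s + t) = c"
      using has_derivative_zero_constant[OF convex_UNIV, of "\<lambda>s. ?E (- s) o\<^sub>L ?E (s + t)"] by auto
    from this[of s] this[of 0] show ?thesis by simp
  qed
  have inv: "?E s o\<^sub>L ?E (- s) = id_blinfun" using const[of "- s" 0] by simp
  have "?E s o\<^sub>L ?E t = ?E s o\<^sub>L (?E (- s) o\<^sub>L ?E (s + t))" by (simp add: const)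
  also have "\<dots> = (?E s o\<^sub>L ?E (- s)) o\<^sub>L ?E (s + t)" by (simp add: blinfun_compose_assoc)
  also have "\<dots> = ?E (s + t)" by (simp add: inv)
  finally show ?thesis by simp
qed

lemma exp_blinfun_commutes:
  fixes M :: "'x::banach \<Rightarrow>\<^sub>L 'x"
  assumes P: "bounded_linear P" and comm: "\<And>x. M (P x) = P (M x)"
  shows "exp_blinfun M t (P x) = P (exp_blinfun M t x)"
proof -
  interpret P: bounded_linear P by (rule P)
  have pw: "blinfun_power M n (P x) = P (blinfun_power M n x)" for n by (induction n) (simp_all add: comm)
  have s: "(\<lambda>n. ((t ^ n / fact n) *\<^sub>R blinfun_power M n) z) sums exp_blinfun M t z" for z
    by (rule bounded_linear.sums[OF bounded_bilinear.bounded_linear_left[OF bounded_bilinear_blinfun_apply] exp_blinfun_sums])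
  have "(\<lambda>n. P (((t ^ n / fact n) *\<^sub>R blinfun_power M n) x)) sums P (exp_blinfun M t x)"
    by (rule P.sums[OF s])
  then have "(\<lambda>n. ((t ^ n / fact n) *\<^sub>R blinfun_power M n) (P x)) sums P (exp_blinfun M t x)"
    by (simp add: blinfun.scaleR_left P.scaleR pw)
  then show ?thesis using s sums_unique2 by blast
qed

lemma exp_blinfun_invariant:
  fixes K :: "'x::banach \<Rightarrow>\<^sub>L 'x"
  assumes U: "subspace U" "closed U" and K: "\<And>x. x \<in> U \<Longrightarrow> K x \<in> U" and x: "x \<in> U"
  shows "exp_blinfun K t x \<in> U"
proof -
  have pw: "blinfun_power K n x \<in> U" for n by (induction n) (use x K in auto)
  have "(\<lambda>n. ((t ^ n / fact n) *\<^sub>R blinfun_power K n) x) sums exp_blinfun K t x"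
    by (rule bounded_linear.sums[OF bounded_bilinear.bounded_linear_left[OF bounded_bilinear_blinfun_apply] exp_blinfun_sums])
  then have "(\<lambda>n. \<Sum>i<n. ((t ^ i / fact i) *\<^sub>R blinfun_power K i) x) \<longlonglongrightarrow> exp_blinfun K t x"
    by (simp add: sums_def)
  then show ?thesis
  proof (rule closed_sequentially[OF U(2), rotated])
    show "(\<Sum>i<n. ((t ^ i / fact i) *\<^sub>R blinfun_power K i) x) \<in> U" for n
      by (intro subspace_sum U) (simp add: blinfun.scaleR_left subspace_scale U pw)
  qed
qed

section \<open>Separating functionals\<close>

definition sublinear :: "('a::real_vector \<Rightarrow> real) \<Rightarrow> bool" where
  "sublinear p \<longleftrightarrow> (\<forall>x y. p (x + y) \<le> p x + p y) \<and> (\<forall>c x. c > 0 \<longrightarrow> p (c *\<^sub>R x) = c * p x)"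

lemma sublinear_0: "sublinear p \<Longrightarrow> p 0 = 0"
proof -
  assume "sublinear p"
  then have "p (2 *\<^sub>R 0) = 2 * p 0" unfolding sublinear_def by (metis zero_less_numeral)
  then show ?thesis by simp
qed

lemma sublinear_minus: "sublinear p \<Longrightarrow> - p (- x) \<le> p x"
proof -
  assume p: "sublinear p"
  then have "p (x + - x) \<le> p x + p (- x)" unfolding sublinear_def by blast
  then show ?thesis using sublinear_0[OF p] by simp
qed

lemma sublinearI:
  assumes "\<And>x y. p (x + y) \<le> p x + p y" "\<And>c x. c > 0 \<Longrightarrow> p (c *\<^sub>R x) \<le> c * p x"
  shows "sublinear p"
  unfolding sublinear_def
proof (intro conjI allI impI antisym)
  fix c :: real and x assume c: "c > 0"
  have "p ((1/c) *\<^sub>R (c *\<^sub>R x)) \<le> (1/c) * p (c *\<^sub>R x)" using c by (intro assms(2)) simp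
  then show "c * p x \<le> p (c *\<^sub>R x)" using c by (simp add: field_simps)
qed (use assms in auto)

text \<open>
  For fixed \<open>y\<close> the function \<open>x \<mapsto> inf\<^sub>t (p (x + t y) - t p y)\<close>, \<open>t \<ge> 0\<close>, is sublinear and below \<open>p\<close>, so it is
  \<open>p\<close> itself. Taking \<open>t = 1\<close> shows that \<open>p\<close> is superadditive as well.
\<close>
lemma minimal_sublinear_is_linear:
  assumes p: "sublinear p" and min: "\<And>r. sublinear r \<Longrightarrow> r \<le> p \<Longrightarrow> r = p"
  shows "linear p"
proof -
  have sub: "p (x + y) \<le> p x + p y" and hom: "c > 0 \<Longrightarrow> p (c *\<^sub>R x) = c * p x" for x y c
    using p by (auto simp: sublinear_def)
  have super: "p x + p y \<le> p (x + y)" for x y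
  proof -
    define r where "r z = (INF t\<in>{0..}. p (z + t *\<^sub>R y) - t * p y)" for z
    have lower: "- p (- z) \<le> p (z + t *\<^sub>R y) - t * p y" if "t \<ge> 0" for z t
    proof -
      have "t * p y = p (t *\<^sub>R y)" using hom[of t y] that sublinear_0[OF p] by (cases "t = 0") auto
      also have "\<dots> \<le> p (z + t *\<^sub>R y) + p (- z)" using sub[of "z + t *\<^sub>R y" "- z"] by simp
      finally show ?thesis by simp
    qed
    have bdd: "bdd_below ((\<lambda>t. p (z + t *\<^sub>R y) - t * p y) ` {0..})" for z
      using lower[of _ z] by (intro bdd_belowI2) auto
    have r_le: "r z \<le> p (z + t *\<^sub>R y) - t * p y" if "t \<ge> 0" for z t
      unfolding r_def using that by (intro cINF_lower bdd) auto
    have "sublinear r"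
    proof (rule sublinearI)
      fix u v :: 'a
      have "r (u + v) - (p (v + t *\<^sub>R y) - t * p y) \<le> r u" if t: "t \<ge> 0" for t
        unfolding r_def[of u]
      proof (rule cINF_greatest)
        fix s :: real assume s: "s \<in> {0..}"
        have "r (u + v) \<le> p ((u + v) + (s + t) *\<^sub>R y) - (s + t) * p y" using s t by (intro r_le) auto
        also have "p ((u + v) + (s + t) *\<^sub>R y) \<le> p (u + s *\<^sub>R y) + p (v + t *\<^sub>R y)"
          using sub[of "u + s *\<^sub>R y" "v + t *\<^sub>R y"] by (simp add: algebra_simps)
        finally show "r (u + v) - (p (v + t *\<^sub>R y) - t * p y) \<le> p (u + s *\<^sub>R y) - s * p y"
          by (simp add: algebra_simps)
      qed simp
      then have "r (u + v) - r u \<le> p (v + t *\<^sub>R y) - t * p y" if "t \<ge> 0" for t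
        using that by (simp add: algebra_simps)
      then have "r (u + v) - r u \<le> r v"
        unfolding r_def[of v] by (intro cINF_greatest) auto
      then show "r (u + v) \<le> r u + r v" by simp
    next
      fix c :: real and z assume c: "c > 0"
      have "r (c *\<^sub>R z) / c \<le> r z"
        unfolding r_def[of z]
      proof (rule cINF_greatest)
        fix t :: real assume t: "t \<in> {0..}"
        have "r (c *\<^sub>R z) \<le> p (c *\<^sub>R z + (c * t) *\<^sub>R y) - (c * t) * p y" using t c by (intro r_le) auto
        also have "\<dots> = c * (p (z + t *\<^sub>R y) - t * p y)"
          using hom[OF c, of "z + t *\<^sub>R y"] by (simp add: algebra_simps)
        finally show "r (c *\<^sub>R z) / c \<le> p (z + t *\<^sub>R y) - t * p y" using c by (simp add: field_simps)
      qed simp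
      then show "r (c *\<^sub>R z) \<le> c * r z" using c by (simp add: field_simps)
    qed
    moreover have "r \<le> p" using r_le[of 0] by (auto simp: le_fun_def)
    ultimately have "r = p" by (rule min)
    then show ?thesis using r_le[of 1 x] by simp
  qed
  have add: "p (x + y) = p x + p y" for x y using sub super by (intro antisym)
  have neg: "p (- x) = - p x" for x using add[of x "- x"] sublinear_0[OF p] by simp
  have "p (c *\<^sub>R x) = c * p x" for c x
  proof (cases c "0::real" rule: linorder_cases)
    case less
    then show ?thesis using hom[of "- c" x] neg[of "c *\<^sub>R x"] by simp
  qed (use hom sublinear_0[OF p] in auto)
  with add show ?thesis by (simp add: linear_iff)
qed

text \<open>
  By Zorn's lemma, as the pointwise infimum of a chain of sublinear functions is sublinear. It is finite because
  each member \<open>p\<close> of the chain satisfies \<open>- q (- x) \<le> p x\<close>.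
\<close>
lemma minimal_sublinear_below:
  assumes q: "sublinear q"
  obtains p where "sublinear p" "p \<le> q" "\<And>r. sublinear r \<Longrightarrow> r \<le> p \<Longrightarrow> r = p"
proof -
  define S where "S = {p. sublinear p \<and> p \<le> q}"
  have "\<exists>m\<in>S. \<forall>a\<in>S. a \<le> m \<longrightarrow> a = m"
  proof (rule predicate_Zorn[of S "\<lambda>a b. b \<le> a"])
    show "partial_order_on S (relation_of (\<lambda>a b. b \<le> a) S)"
      by (auto simp: partial_order_on_def preorder_on_def refl_on_def trans_def antisym_def relation_of_def)
    fix C assume "C \<in> Chains (relation_of (\<lambda>a b. b \<le> a) S)"
    then have chain: "\<And>a b. a \<in> C \<Longrightarrow> b \<in> C \<Longrightarrow> a \<in> S \<and> (a \<le> b \<or> b \<le> a)"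
      by (auto simp: Chains_def relation_of_def)
    show "\<exists>u\<in>S. \<forall>a\<in>C. u \<le> a"
    proof (cases "C = {}")
      case True
      then show ?thesis using q by (auto simp: S_def)
    next
      case False
      define m where "m x = (INF p\<in>C. p x)" for x
      have bdd: "bdd_below ((\<lambda>p. p x) ` C)" for x
      proof (rule bdd_belowI2)
        fix p assume "p \<in> C"
        then have "sublinear p" "p (- x) \<le> q (- x)" using chain[of p p] by (auto simp: S_def le_fun_def)
        then show "- q (- x) \<le> p x" using sublinear_minus[of p x] by linarith
      qed
      have m_le: "m x \<le> p x" if "p \<in> C" for p x
        unfolding m_def using that by (intro cINF_lower bdd) auto
      have "sublinear m"
      proof (rule sublinearI)
        fix u v :: 'a
        have *: "m (u + v) \<le> p1 u + p2 v" if p12: "p1 \<in> C" "p2 \<in> C" for p1 p2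
        proof -
          obtain p where p: "p \<in> C" "p \<le> p1" "p \<le> p2" using chain[OF p12] p12 by blast
          then have "p (u + v) \<le> p u + p v" using chain[of p p] by (auto simp: S_def sublinear_def)
          moreover have "p u \<le> p1 u" "p v \<le> p2 v" using p by (auto simp: le_fun_def)
          ultimately show ?thesis using m_le[OF p(1), of "u + v"] by linarith
        qed
        have "m (u + v) - p2 v \<le> m u" if "p2 \<in> C" for p2
          unfolding m_def[of u] using *[OF _ that] False by (intro cINF_greatest) (auto simp: algebra_simps)
        then have "m (u + v) - m u \<le> m v"
          unfolding m_def[of v] using False by (intro cINF_greatest) (auto simp: algebra_simps)
        then show "m (u + v) \<le> m u + m v" by simp
      next
        fix c :: real and x assume c: "c > 0"
        have "m (c *\<^sub>R x) / c \<le> m x"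
          unfolding m_def[of x]
        proof (rule cINF_greatest)
          fix p assume p: "p \<in> C"
          have "m (c *\<^sub>R x) \<le> c * p x"
            using m_le[OF p, of "c *\<^sub>R x"] chain[OF p p] c by (auto simp: S_def sublinear_def)
          then show "m (c *\<^sub>R x) / c \<le> p x" using c by (simp add: field_simps)
        qed (use False in auto)
        then show "m (c *\<^sub>R x) \<le> c * m x" using c by (simp add: field_simps)
      qed
      moreover have "m \<le> q"
      proof -
        obtain p where p: "p \<in> C" using False by blast
        then have "p \<le> q" using chain[of p p] by (auto simp: S_def)
        moreover have "m \<le> p" using m_le[OF p] by (auto simp: le_fun_def)
        ultimately show ?thesis by simp
      qed
      ultimately have "m \<in> S" by (simp add: S_def)
      moreover have "\<forall>a\<in>C. m \<le> a" using m_le by (auto simp: le_fun_def)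
      ultimately show ?thesis by blast
    qed
  qed
  then obtain p where p: "p \<in> S" "\<And>r. r \<in> S \<Longrightarrow> r \<le> p \<Longrightarrow> r = p" by blast
  show ?thesis
  proof (rule that)
    show "sublinear p" "p \<le> q" using p by (auto simp: S_def)
    show "r = p" if "sublinear r" "r \<le> p" for r
      using p that by (metis (no_types, lifting) S_def mem_Collect_eq order_trans)
  qed
qed

text \<open>
  The function \<open>q\<close> is sublinear, below the norm, and at \<open>- y0\<close> at most \<open>- norm y0\<close>. A minimal sublinear function below
  \<open>q\<close> is linear, bounded by the norm, and cannot vanish at \<open>y0\<close>.
\<close>
lemma separating_functional:
  fixes y0 :: "'a::real_normed_vector"
  assumes "y0 \<noteq> 0"
  obtains h where "bounded_linear h" "h y0 \<noteq> (0::real)"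
proof -
  define q where "q y = (INF c. norm (y - c *\<^sub>R y0) + c * norm y0)" for y :: 'a
  have lower: "- norm y \<le> norm (y - c *\<^sub>R y0) + c * norm y0" for y c
  proof -
    have "- c * norm y0 \<le> norm (c *\<^sub>R y0)" using mult_right_mono[OF abs_ge_minus_self[of c], of "norm y0"] by simp
    also have "\<dots> \<le> norm (y - c *\<^sub>R y0) + norm y" by (metis norm_minus_commute norm_triangle_sub add.commute)
    finally show ?thesis by simp
  qed
  have bdd: "bdd_below (range (\<lambda>c. norm (y - c *\<^sub>R y0) + c * norm y0))" for y
    using lower[of y] by (intro bdd_belowI2) auto
  have q_le: "q y \<le> norm (y - c *\<^sub>R y0) + c * norm y0" for y c
    unfolding q_def by (intro cINF_lower bdd) auto
  have "sublinear q"
  proof (rule sublinearI)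
    fix u v :: 'a
    have "q (u + v) - (norm (v - d *\<^sub>R y0) + d * norm y0) \<le> q u" for d
      unfolding q_def[of u]
    proof (rule cINF_greatest)
      fix c :: real
      have "q (u + v) \<le> norm ((u + v) - (c + d) *\<^sub>R y0) + (c + d) * norm y0" by (rule q_le)
      also have "norm ((u + v) - (c + d) *\<^sub>R y0) \<le> norm (u - c *\<^sub>R y0) + norm (v - d *\<^sub>R y0)"
        using norm_triangle_ineq[of "u - c *\<^sub>R y0" "v - d *\<^sub>R y0"] by (simp add: algebra_simps)
      finally show "q (u + v) - (norm (v - d *\<^sub>R y0) + d * norm y0) \<le> norm (u - c *\<^sub>R y0) + c * norm y0"
        by (simp add: algebra_simps)
    qed simp
    then have "q (u + v) - q u \<le> norm (v - d *\<^sub>R y0) + d * norm y0" for d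
      by (simp add: algebra_simps)
    then have "q (u + v) - q u \<le> q v"
      unfolding q_def[of v] by (intro cINF_greatest) auto
    then show "q (u + v) \<le> q u + q v" by simp
  next
    fix c :: real and z assume c: "c > 0"
    have "q (c *\<^sub>R z) / c \<le> q z"
      unfolding q_def[of z]
    proof (rule cINF_greatest)
      fix d :: real
      have "q (c *\<^sub>R z) \<le> norm (c *\<^sub>R z - (c * d) *\<^sub>R y0) + (c * d) * norm y0" by (rule q_le)
      also have "c *\<^sub>R z - (c * d) *\<^sub>R y0 = c *\<^sub>R (z - d *\<^sub>R y0)" by (simp add: algebra_simps)
      also have "norm (c *\<^sub>R (z - d *\<^sub>R y0)) = c * norm (z - d *\<^sub>R y0)" using c by simp
      finally show "q (c *\<^sub>R z) / c \<le> norm (z - d *\<^sub>R y0) + d * norm y0" using c by (simp add: field_simps)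
    qed simp
    then show "q (c *\<^sub>R z) \<le> c * q z" using c by (simp add: field_simps)
  qed
  then obtain p where p: "sublinear p" "p \<le> q" "\<And>r. sublinear r \<Longrightarrow> r \<le> p \<Longrightarrow> r = p"
    using minimal_sublinear_below by blast
  have lin: "linear p" by (rule minimal_sublinear_is_linear[OF p(1,3)])
  have le: "p y \<le> norm y" for y using p(2) q_le[of y 0] by (auto simp: le_fun_def intro: order_trans)
  have "norm (p y) \<le> norm y * 1" for y
    using le[of y] le[of "- y"] linear_neg[OF lin, of y] by simp
  then have "bounded_linear p" by (intro bounded_linear_intro[of p 1] linear_add[OF lin] linear_cmul[OF lin]) auto
  moreover have "p y0 \<noteq> 0"
  proof -
    have "p (- y0) \<le> q (- y0)" using p(2) by (simp add: le_fun_def)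
    also have "\<dots> \<le> - norm y0" using q_le[of "- y0" "-1"] by simp
    finally show ?thesis using assms linear_neg[OF lin, of y0] by auto
  qed
  ultimately show ?thesis using that by blast
qed

section \<open>Complex scalars and eigenvectors\<close>

text \<open>
  The product norm on a complexification is not homogeneous for complex scalars, which is why \<open>J\<close> is
  assumed to be bounded rather than isometric in the sense of \<open>complex_structure\<close>.
\<close>
locale imaginary_unit =
  fixes J :: "'z::banach \<Rightarrow> 'z"
  assumes bl: "bounded_linear J" and JJ: "J (J x) = - x"
begin

lemma J_simps: "J (x + y) = J x + J y" "J (c *\<^sub>R x) = c *\<^sub>R J x" "J 0 = 0"
  using bounded_linear.linear[OF bl] by (simp_all add: linear_add linear_cmul linear_0)

lemma bounded_bilinear_cscale: "bounded_bilinear (cscale J)"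
proof
  obtain k where k: "k > 0" "\<And>x. norm (J x) \<le> norm x * k"
    using bounded_linear.pos_bounded[OF bl] by blast
  show "\<exists>K. \<forall>a b. norm (cscale J a b) \<le> norm a * norm b * K"
  proof (intro exI allI)
    fix a :: complex and b :: 'z
    have "norm (cscale J a b) \<le> \<bar>Re a\<bar> * norm b + \<bar>Im a\<bar> * norm (J b)"
      unfolding cscale_def by (rule norm_triangle_le) simp
    also have "\<dots> \<le> cmod a * norm b + cmod a * (norm b * k)"
      by (intro add_mono mult_mono abs_Re_le_cmod abs_Im_le_cmod k(2)) auto
    finally show "norm (cscale J a b) \<le> norm a * norm b * (1 + k)" by (simp add: algebra_simps)
  qed
qed (auto simp: cscale_def J_simps algebra_simps)

sublocale cs: bounded_bilinear "cscale J" by (rule bounded_bilinear_cscale)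

lemma cscale_cscale: "cscale J a (cscale J b x) = cscale J (a * b) x"
  by (simp add: cscale_def J_simps JJ algebra_simps)

lemma cscale_1 [simp]: "cscale J 1 x = x"
  by (simp add: cscale_def)

lemma cscale_of_real: "cscale J (of_real r) x = r *\<^sub>R x"
  by (simp add: cscale_def)

lemma cscale_i: "cscale J \<i> x = J x"
  by (simp add: cscale_def)

lemma cscale_eq_0: "cscale J a x = 0 \<Longrightarrow> a \<noteq> 0 \<Longrightarrow> x = 0"
  using cscale_cscale[of "1 / a" a x] cs.zero_right by simp

lemma commutes_cscale:
  assumes "linear P" "\<And>x. P (J x) = J (P x)"
  shows "P (cscale J c x) = cscale J c (P x)"
  using assms by (simp add: cscale_def linear_add linear_cmul)

lemma subspace_cscale:
  assumes "subspace V" "\<And>x. x \<in> V \<Longrightarrow> J x \<in> V" "x \<in> V"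
  shows "cscale J c x \<in> V"
  unfolding cscale_def using assms by (intro subspace_add subspace_scale) auto

end

text \<open>
  A nonzero complex polynomial \<open>p\<close> of least degree with \<open>p(A) v = 0\<close> has a root \<open>\<mu>\<close>. If \<open>p = (X - \<mu>) q\<close>, then
  \<open>q(A) v\<close> is an eigenvector, nonzero by minimality.
\<close>
lemma (in imaginary_unit) eigenvector_exists:
  assumes N: "subspace N" "\<And>x. x \<in> N \<Longrightarrow> J x \<in> N" "N \<subseteq> span B" "finite B" "v \<in> N" "v \<noteq> 0"
    and A: "\<And>x. x \<in> N \<Longrightarrow> A x \<in> N" "\<And>x y. x \<in> N \<Longrightarrow> y \<in> N \<Longrightarrow> A (x + y) = A x + A y"
      "\<And>c x. x \<in> N \<Longrightarrow> A (cscale J c x) = cscale J c (A x)"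
  obtains w \<mu> where "w \<in> N" "w \<noteq> 0" "A w = cscale J \<mu> w"
proof -
  have iter: "(A ^^ i) v \<in> N" for i by (induction i) (use N A in auto)
  \<comment> \<open>\<open>ev p\<close> is \<open>p(A) v\<close>\<close>
  define ev where "ev p = (\<Sum>i\<le>degree p. cscale J (coeff p i) ((A ^^ i) v))" for p
  have ev_eq: "ev p = (\<Sum>i\<le>n. cscale J (coeff p i) ((A ^^ i) v))" if "degree p \<le> n" for p n
    unfolding ev_def
    by (rule sum.mono_neutral_left) (use that in \<open>auto simp: coeff_eq_0 cs.zero_left\<close>)
  have evN: "ev p \<in> N" for p
    unfolding ev_def using N(1,2) iter by (intro subspace_sum subspace_cscale) auto
  have A0: "A 0 = 0" using A(3)[of 0 0] subspace_0[OF N(1)] by (simp add: cs.zero_left)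
  have A_sum: "A (\<Sum>i\<in>I. f i) = (\<Sum>i\<in>I. A (f i))" if "\<And>i. f i \<in> N" for f and I :: "nat set"
  proof (induction I rule: infinite_finite_induct)
    case (insert i I)
    have "sum f I \<in> N" by (rule subspace_sum[OF N(1)]) (rule that)
    then show ?case using insert A(2)[OF that, of "sum f I" i] by simp
  qed (auto simp: A0)
  have ev_factor: "ev ([:- \<mu>, 1:] * q) = A (ev q) - cscale J \<mu> (ev q)" for \<mu> q
  proof -
    define n where "n = degree q"
    have pq: "[:- \<mu>, 1:] * q = smult (- \<mu>) q + pCons 0 q" by simp
    have "degree ([:- \<mu>, 1:] * q) \<le> Suc n"
      unfolding n_def using degree_mult_le[of "[:- \<mu>, 1:]" q] by simp
    then have "ev ([:- \<mu>, 1:] * q) = (\<Sum>i\<le>Suc n. cscale J (coeff (smult (- \<mu>) q) i + coeff (pCons 0 q) i) ((A ^^ i) v))"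
      by (subst ev_eq) (auto simp: pq)
    also have "\<dots> = (\<Sum>i\<le>Suc n. cscale J (coeff (smult (- \<mu>) q) i) ((A ^^ i) v)) + (\<Sum>i\<le>Suc n. cscale J (coeff (pCons 0 q) i) ((A ^^ i) v))"
      by (simp only: cs.add_left sum.distrib)
    also have "(\<Sum>i\<le>Suc n. cscale J (coeff (smult (- \<mu>) q) i) ((A ^^ i) v)) = - cscale J \<mu> (ev q)"
    proof -
      have "(\<Sum>i\<le>Suc n. cscale J (coeff (smult (- \<mu>) q) i) ((A ^^ i) v)) = cscale J (- \<mu>) (\<Sum>i\<le>Suc n. cscale J (coeff q i) ((A ^^ i) v))"
        by (simp only: cs.sum_right cscale_cscale coeff_smult)
      also have "(\<Sum>i\<le>Suc n. cscale J (coeff q i) ((A ^^ i) v)) = ev q"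
        by (rule ev_eq[symmetric]) (simp add: n_def)
      finally show ?thesis by (simp add: cs.minus_left)
    qed
    also have "(\<Sum>i\<le>Suc n. cscale J (coeff (pCons 0 q) i) ((A ^^ i) v)) = (\<Sum>i\<le>n. cscale J (coeff q i) ((A ^^ Suc i) v))"
      by (subst sum.atMost_Suc_shift) (simp add: cs.zero_left)
    also have "\<dots> = (\<Sum>i\<le>n. A (cscale J (coeff q i) ((A ^^ i) v)))"
      using A(3) iter by simp
    also have "\<dots> = A (ev q)"
      unfolding ev_def n_def using N(1,2) iter by (intro A_sum[symmetric] subspace_cscale) auto
    finally show ?thesis by simp
  qed
  obtain c where c: "\<exists>i\<le>card B. c i \<noteq> 0" "(\<Sum>i\<le>card B. c i *\<^sub>R (A ^^ i) v) = 0"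
    using nontrivial_relation_in_span[OF N(4), of "\<lambda>i. (A ^^ i) v"] iter N(3) by blast
  define p0 where "p0 = (\<Sum>i\<le>card B. monom (complex_of_real (c i)) i)"
  have co: "coeff p0 i = (if i \<le> card B then of_real (c i) else 0)" for i
    unfolding p0_def by (simp add: coeff_sum)
  have "degree p0 \<le> card B" by (rule degree_le) (simp add: co)
  then have "ev p0 = (\<Sum>i\<le>card B. c i *\<^sub>R (A ^^ i) v)"
    by (subst ev_eq) (auto simp: co cscale_of_real)
  then have "ev p0 = 0" "p0 \<noteq> 0" using c co by (auto simp: poly_eq_iff)
  then obtain p where p: "p \<noteq> 0" "ev p = 0" and min: "\<And>q. q \<noteq> 0 \<Longrightarrow> ev q = 0 \<Longrightarrow> degree p \<le> degree q"
    using ex_has_least_nat[of "\<lambda>p. p \<noteq> 0 \<and> ev p = 0" p0 degree] by blast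
  have "degree p \<noteq> 0"
  proof
    assume "degree p = 0"
    then obtain a where a: "p = [:a:]" using degree_eq_zeroE by blast
    then have "cscale J a v = 0" "a \<noteq> 0" using p by (auto simp: ev_def)
    then show False using cscale_eq_0 N by blast
  qed
  obtain \<mu> where "poly p \<mu> = 0"
  proof (rule fundamental_theorem_of_algebra[of "coeff p" "degree p"])
    show "coeff p 0 = 0 \<or> (\<exists>i\<in>{1..degree p}. coeff p i \<noteq> 0)"
      using \<open>degree p \<noteq> 0\<close> p(1) by (intro disjI2 bexI[of _ "degree p"]) auto
  qed (auto simp: poly_altdef)
  then obtain q where q: "p = [:- \<mu>, 1:] * q" by (auto simp: poly_eq_0_iff_dvd elim: dvdE)
  with p have q0: "q \<noteq> 0" by auto
  have "degree p = Suc (degree q)"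
    unfolding q using q0 by (subst degree_mult_eq) auto
  then have "ev q \<noteq> 0" using min[of q] q0 by auto
  moreover have "A (ev q) = cscale J \<mu> (ev q)" using ev_factor[of \<mu> q] q p by simp
  ultimately show ?thesis using that evN by blast
qed

section \<open>Riesz projections\<close>

locale complex_semigroup = imaginary_unit J for J :: "'z::banach \<Rightarrow> 'z" +
  fixes D :: "'z set" and A :: "'z \<Rightarrow> 'z" and T :: "real \<Rightarrow> 'z \<Rightarrow> 'z"
  assumes gen: "generates (Some J) UNIV D A T"
begin

lemmas sg = generates_D(1)[OF gen]

lemma D_add: "x \<in> D \<Longrightarrow> y \<in> D \<Longrightarrow> x + y \<in> D" "x \<in> D \<Longrightarrow> y \<in> D \<Longrightarrow> A (x + y) = A x + A y"
  using generator_add[OF gen subspace_UNIV] by auto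

lemma T_cscale: "t \<ge> 0 \<Longrightarrow> T t (cscale J c x) = cscale J c (T t x)"
  using bounded_linear.linear[OF C0_semigroup_bounded_linear[OF sg]] C0_semigroup_J[OF sg]
  by (intro commutes_cscale) auto

lemma generator_cscale: "x \<in> D \<Longrightarrow> cscale J c x \<in> D \<and> A (cscale J c x) = cscale J c (A x)"
  by (rule generator_commutes[OF gen cs.bounded_linear_right]) (simp_all add: T_cscale)

lemma D_cscale: "x \<in> D \<Longrightarrow> cscale J c x \<in> D" "x \<in> D \<Longrightarrow> A (cscale J c x) = cscale J c (A x)"
  using generator_cscale by blast+

lemma is_resolvent_resolvent:
  assumes "\<zeta> \<notin> spectrum J D A"
  shows "is_resolvent J D A \<zeta> (resolvent J D A \<zeta>)"
proof -
  obtain R where R: "is_resolvent J D A \<zeta> R" using assms by (auto simp: spectrum_def)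
  have "R' = R" if "is_resolvent J D A \<zeta> R'" for R'
  proof
    fix z
    have "R' z \<in> D" "cscale J \<zeta> (R' z) - A (R' z) = z" using that by (auto simp: is_resolvent_def)
    then show "R' z = R z" using R unfolding is_resolvent_def by metis
  qed
  with R show ?thesis unfolding resolvent_def by (rule theI)
qed

lemma resolventD:
  assumes "\<zeta> \<notin> spectrum J D A"
  shows "bounded_linear (resolvent J D A \<zeta>)" "resolvent J D A \<zeta> z \<in> D"
    "cscale J \<zeta> (resolvent J D A \<zeta> z) - A (resolvent J D A \<zeta> z) = z"
    "w \<in> D \<Longrightarrow> cscale J \<zeta> w - A w = z \<Longrightarrow> resolvent J D A \<zeta> z = w"
  using is_resolvent_resolvent[OF assms] by (auto simp: is_resolvent_def)

lemma resolvent_commutes: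
  assumes \<zeta>: "\<zeta> \<notin> spectrum J D A" and P: "bounded_linear P" "\<And>x. P (J x) = J (P x)"
    "\<And>t x. t \<ge> 0 \<Longrightarrow> T t (P x) = P (T t x)"
  shows "P (resolvent J D A \<zeta> z) = resolvent J D A \<zeta> (P z)"
proof (rule resolventD(4)[OF \<zeta>, symmetric])
  let ?w = "resolvent J D A \<zeta> z"
  note c = generator_commutes[OF gen P(1,3) resolventD(2)[OF \<zeta>], of z]
  show "P ?w \<in> D" using c by blast
  have "cscale J \<zeta> (P ?w) - A (P ?w) = P (cscale J \<zeta> ?w - A ?w)"
    using c commutes_cscale[OF bounded_linear.linear[OF P(1)] P(2)] bounded_linear.linear[OF P(1)] by (simp add: linear_diff)
  then show "cscale J \<zeta> (P ?w) - A (P ?w) = P z" using resolventD(3)[OF \<zeta>] by simp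
qed

lemma resolvent_cscale:
  assumes "\<zeta> \<notin> spectrum J D A"
  shows "resolvent J D A \<zeta> (cscale J c z) = cscale J c (resolvent J D A \<zeta> z)"
proof (rule resolvent_commutes[OF assms, symmetric])
  show "cscale J c (J x) = J (cscale J c x)" for x
    using cscale_cscale[of c \<i> x] cscale_cscale[of \<i> c x] by (simp add: cscale_i mult.commute)
qed (auto intro: cs.bounded_linear_right T_cscale)

text \<open>
  Paths are merely piecewise continuously differentiable, and their derivative may be unbounded near the
  exceptional points. Continuity of the resolvent thus does not suffice to integrate the Riesz integrand, but a
  primitive does. It is obtained from the Neumann series by termwise integration.
\<close>
lemma resolvent_local_primitive:
  assumes \<zeta>0: "\<zeta>0 \<notin> spectrum J D A"
  obtains \<rho> \<Psi> where "\<rho> > 0"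
    "\<And>\<zeta>. \<zeta> \<in> ball \<zeta>0 \<rho> \<Longrightarrow> \<zeta> \<notin> spectrum J D A \<Longrightarrow> (\<Psi> has_derivative (\<lambda>h. cscale J h (resolvent J D A \<zeta> z))) (at \<zeta>)"
proof -
  define R0 where "R0 = resolvent J D A \<zeta>0"
  interpret R0: bounded_linear R0 unfolding R0_def by (rule resolventD(1)[OF \<zeta>0])
  obtain K where K: "K > 0" "\<And>z. norm (R0 z) \<le> norm z * K" using R0.pos_bounded by blast
  obtain k where k: "k > 0" "\<And>c x. norm (cscale J c x) \<le> norm c * norm x * k" using cs.pos_bounded by blast
  define m where "m = max k 1"
  have m: "m \<ge> 1" "\<And>c x. norm (cscale J c x) \<le> norm c * norm x * m"
  proof -
    fix c x
    have "norm (cscale J c x) \<le> norm c * norm x * k" by (rule k(2))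
    also have "\<dots> \<le> norm c * norm x * m" by (intro mult_left_mono) (auto simp: m_def)
    finally show "norm (cscale J c x) \<le> norm c * norm x * m" .
  qed (auto simp: m_def)
  define \<rho> where "\<rho> = 1 / (2 * K * m)"
  have \<rho>: "\<rho> > 0" "\<rho> * (K * m) = 1/2" using K m(1) by (auto simp: \<rho>_def)
  define b where "b n = (R0 ^^ Suc n) z" for n
  have b: "norm (b n) \<le> (K * norm z) * K ^ n" for n
  proof (induction n)
    case 0
    then show ?case using K(2)[of z] by (simp add: b_def mult.commute)
  next
    case (Suc n)
    have "norm (b (Suc n)) \<le> norm (b n) * K" unfolding b_def using K(2) by simp
    also have "\<dots> \<le> ((K * norm z) * K ^ n) * K" using Suc K(1) by (intro mult_right_mono) auto
    finally show ?case by (simp add: mult_ac)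
  qed
  have \<rho>K: "\<rho> * K < 1"
  proof -
    have "\<rho> * K * 1 \<le> \<rho> * K * m" using \<rho>(1) K(1) m(1) by (intro mult_left_mono) auto
    then show ?thesis using \<rho>(2) by (simp add: mult_ac)
  qed
  obtain \<Phi> where summ: "\<And>h \<eta>. norm \<eta> < \<rho> \<Longrightarrow> summable (\<lambda>n. cscale J (h * \<eta> ^ n) (b n))"
    and "\<And>\<eta>. norm \<eta> < \<rho> \<Longrightarrow> (\<lambda>n. cscale J (\<eta> ^ Suc n / of_nat (Suc n)) (b n)) sums \<Phi> \<eta>"
    and \<Phi>: "\<And>\<eta>. norm \<eta> < \<rho> \<Longrightarrow> (\<Phi> has_derivative (\<lambda>h. \<Sum>n. cscale J (h * \<eta> ^ n) (b n))) (at \<eta>)"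
    by (rule power_series_primitive[OF bounded_bilinear_cscale b less_imp_le[OF K(1)] less_imp_le[OF \<rho>(1)] \<rho>K], rule that)
  \<comment> \<open>the resolvent and the sum of the series are both fixed points of \<open>s \<mapsto> \<eta> R0 s + R0 z\<close>, a contraction by the choice of \<open>\<rho>\<close>\<close>
  have neumann: "(\<Sum>n. cscale J (\<eta> ^ n) (b n)) = resolvent J D A \<zeta> z"
    if \<eta>: "norm \<eta> < \<rho>" "\<eta> = \<zeta>0 - \<zeta>" and \<zeta>: "\<zeta> \<notin> spectrum J D A" for \<eta> \<zeta>
  proof -
    define s where "s = (\<Sum>n. cscale J (\<eta> ^ n) (b n))"
    define w where "w = resolvent J D A \<zeta> z"
    have summ1: "summable (\<lambda>n. cscale J (\<eta> ^ n) (b n))" using summ[OF \<eta>(1), of 1] by simp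
    have bl: "bounded_linear (\<lambda>x. cscale J \<eta> (R0 x))"
      by (rule bounded_linear_compose[OF cs.bounded_linear_right R0.bounded_linear_axioms])
    have "s = (\<Sum>n. cscale J (\<eta> ^ Suc n) (b (Suc n))) + b 0"
      unfolding s_def using suminf_split_head[OF summ1] by simp
    also have "(\<Sum>n. cscale J (\<eta> ^ Suc n) (b (Suc n))) = (\<Sum>n. cscale J \<eta> (R0 (cscale J (\<eta> ^ n) (b n))))"
    proof (rule suminf_cong)
      fix n
      have "R0 (cscale J (\<eta> ^ n) (b n)) = cscale J (\<eta> ^ n) (b (Suc n))"
        using resolvent_cscale[OF \<zeta>0] by (simp add: R0_def b_def)
      then show "cscale J (\<eta> ^ Suc n) (b (Suc n)) = cscale J \<eta> (R0 (cscale J (\<eta> ^ n) (b n)))"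
        by (simp add: cscale_cscale)
    qed
    also have "\<dots> = cscale J \<eta> (R0 s)"
      unfolding s_def by (rule bounded_linear.suminf[OF bl summ1, symmetric])
    finally have s: "s = cscale J \<eta> (R0 s) + R0 z" by (simp add: b_def)
    have "cscale J \<zeta>0 w - A w = z + cscale J \<eta> w"
      using resolventD(3)[OF \<zeta>, of z] by (simp add: w_def \<eta>(2) cs.diff_left algebra_simps)
    then have "R0 (z + cscale J \<eta> w) = w"
      unfolding R0_def using resolventD(2)[OF \<zeta>] by (intro resolventD(4)[OF \<zeta>0]) (auto simp: w_def)
    then have w: "w = cscale J \<eta> (R0 w) + R0 z"
      using resolvent_cscale[OF \<zeta>0] by (simp add: R0.add R0_def[symmetric] add.commute)
    have d: "s - w = cscale J \<eta> (R0 (s - w))"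
      using s w by (simp add: R0.diff cs.diff_right) (metis add_diff_cancel_right)
    have "norm (s - w) \<le> norm \<eta> * norm (R0 (s - w)) * m"
      using m(2)[of \<eta> "R0 (s - w)"] d by simp
    also have "\<dots> \<le> \<rho> * (norm (s - w) * K) * m"
      using \<eta>(1) K m(1) \<rho>(1) by (intro mult_right_mono mult_mono) auto
    also have "\<dots> = norm (s - w) / 2" using \<rho>(2) by (simp add: mult_ac)
    finally have "s = w" by simp
    then show ?thesis by (simp add: s_def w_def)
  qed
  show ?thesis
  proof (rule that[OF \<rho>(1)])
    fix \<zeta> assume \<zeta>: "\<zeta> \<in> ball \<zeta>0 \<rho>" "\<zeta> \<notin> spectrum J D A"
    define \<eta> where "\<eta> = \<zeta>0 - \<zeta>"
    have \<eta>: "norm \<eta> < \<rho>" using \<zeta>(1) by (simp add: \<eta>_def dist_norm)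
    have "((\<lambda>\<zeta>. \<Phi> (\<zeta>0 - \<zeta>)) has_derivative (\<lambda>h. \<Sum>n. cscale J ((- h) * \<eta> ^ n) (b n))) (at \<zeta>)"
    proof -
      have "((\<lambda>\<zeta>. \<zeta>0 - \<zeta>) has_derivative (\<lambda>h. - h)) (at \<zeta>)" by (auto intro!: derivative_eq_intros)
      from has_derivative_compose[OF this \<Phi>[OF \<eta>, unfolded \<eta>_def]] show ?thesis
        unfolding \<eta>_def .
    qed
    then have "((\<lambda>\<zeta>. - \<Phi> (\<zeta>0 - \<zeta>)) has_derivative (\<lambda>h. - (\<Sum>n. cscale J ((- h) * \<eta> ^ n) (b n)))) (at \<zeta>)"
      by (rule has_derivative_minus)
    moreover have "- (\<Sum>n. cscale J ((- h) * \<eta> ^ n) (b n)) = cscale J h (resolvent J D A \<zeta> z)" for h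
    proof -
      have "(\<Sum>n. cscale J ((- h) * \<eta> ^ n) (b n)) = (\<Sum>n. cscale J (- h) (cscale J (\<eta> ^ n) (b n)))"
        by (simp add: cscale_cscale)
      also have "\<dots> = cscale J (- h) (\<Sum>n. cscale J (\<eta> ^ n) (b n))"
        by (rule bounded_linear.suminf[OF cs.bounded_linear_right, symmetric]) (use summ[OF \<eta>, of 1] in simp)
      finally show ?thesis using neumann[OF \<eta> \<eta>_def \<zeta>(2)] by (simp add: cs.minus_left)
    qed
    ultimately show "((\<lambda>\<zeta>. - \<Phi> (\<zeta>0 - \<zeta>)) has_derivative (\<lambda>h. cscale J h (resolvent J D A \<zeta> z))) (at \<zeta>)"
      by simp
  qed
qed

abbreviation riesz_integrand :: "(real \<Rightarrow> complex) \<Rightarrow> 'z \<Rightarrow> real \<Rightarrow> 'z" where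
  "riesz_integrand g z t \<equiv> cscale J (vector_derivative g (at t within {0..1})) (resolvent J D A (g t) z)"

text \<open>
  Locally the integral is evaluated by the fundamental theorem of calculus, which tolerates finitely many
  points without derivative as long as the primitive is continuous.
\<close>
lemma riesz_integrand_integrable:
  assumes g: "valid_path g" and img: "path_image g \<inter> spectrum J D A = {}"
  shows "riesz_integrand g z integrable_on {0..1}"
proof -
  obtain S D' where S: "finite S" and cont: "continuous_on {0..1} g"
    and D': "\<And>t. t \<in> {0..1} - S \<Longrightarrow> (g has_vector_derivative D' t) (at t)"
    using g unfolding valid_path_def piecewise_C1_differentiable_on_def C1_differentiable_on_def by blast
  have res: "g t \<notin> spectrum J D A" if "t \<in> {0..1}" for t
    using that img unfolding path_image_def by blast
  have "riesz_integrand g z integrable_on cbox 0 1"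
  proof (rule integrable_on_little_subintervals, rule ballI)
    fix t0 :: real assume t0: "t0 \<in> cbox 0 1"
    obtain \<rho> \<Psi> where \<rho>: "\<rho> > 0" and \<Psi>: "\<And>\<zeta>. \<zeta> \<in> ball (g t0) \<rho> \<Longrightarrow> \<zeta> \<notin> spectrum J D A \<Longrightarrow>
        (\<Psi> has_derivative (\<lambda>h. cscale J h (resolvent J D A \<zeta> z))) (at \<zeta>)"
      using resolvent_local_primitive[OF res, of t0 z] t0 by auto
    obtain d where d: "d > 0" "\<And>t. t \<in> {0..1} \<Longrightarrow> dist t t0 < d \<Longrightarrow> dist (g t) (g t0) < \<rho>"
      using cont t0 \<rho> unfolding continuous_on_iff by (metis cbox_interval)
    show "\<exists>d>0. \<forall>u v. t0 \<in> cbox u v \<and> cbox u v \<subseteq> ball t0 d \<and> cbox u v \<subseteq> cbox 0 1 \<longrightarrow>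
        riesz_integrand g z integrable_on cbox u v"
    proof (intro exI[of _ d] conjI allI impI d(1))
      fix u v assume uv: "t0 \<in> cbox u v \<and> cbox u v \<subseteq> ball t0 d \<and> cbox u v \<subseteq> cbox 0 1"
      have in01: "t \<in> {0..1}" if "t \<in> {u..v}" for t using uv that by auto
      have deriv\<Psi>: "(\<Psi> has_derivative (\<lambda>h. cscale J h (resolvent J D A (g t) z))) (at (g t))" if "t \<in> {u..v}" for t
      proof (rule \<Psi>)
        have "t \<in> ball t0 d" using uv that by auto
        then show "g t \<in> ball (g t0) \<rho>" using d(2)[OF in01[OF that]] by (simp add: dist_commute)
        show "g t \<notin> spectrum J D A" using res in01[OF that] by blast
      qed
      have "(riesz_integrand g z has_integral ((\<Psi> \<circ> g) v - (\<Psi> \<circ> g) u)) {u..v}"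
      proof (rule fundamental_theorem_of_calculus_interior_strong[OF S])
        show "u \<le> v" using uv by auto
        show "continuous_on {u..v} (\<Psi> \<circ> g)"
        proof (rule continuous_on_compose)
          show "continuous_on {u..v} g" using cont in01 by (meson continuous_on_subset subsetI)
          show "continuous_on (g ` {u..v}) \<Psi>"
            by (intro continuous_at_imp_continuous_on ballI) (auto dest: has_derivative_continuous[OF deriv\<Psi>])
        qed
        fix t assume t: "t \<in> {u<..<v} - S"
        then have t': "t \<in> {u..v}" "t \<in> {0..1} - S" using in01 by auto
        have "(g has_derivative (\<lambda>h. h *\<^sub>R D' t)) (at t)"
          using D'[OF t'(2)] by (simp add: has_vector_derivative_def)
        from diff_chain_at[OF this deriv\<Psi>[OF t'(1)]]
        have "(\<Psi> \<circ> g has_vector_derivative cscale J (D' t) (resolvent J D A (g t) z)) (at t)"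
          by (simp add: has_vector_derivative_def o_def cs.scaleR_left)
        moreover have "vector_derivative g (at t within {0..1}) = D' t"
          using D'[OF t'(2)] t'(2) by (intro vector_derivative_at_within_ivl) auto
        ultimately show "(\<Psi> \<circ> g has_vector_derivative riesz_integrand g z t) (at t)" by simp
      qed
      then show "riesz_integrand g z integrable_on cbox u v" by (auto simp: has_integral_integrable)
    qed
  qed
  then show ?thesis by simp
qed

definition admissible :: "(real \<Rightarrow> complex) list \<Rightarrow> bool" where
  "admissible \<Gamma> \<longleftrightarrow> (\<forall>g\<in>set \<Gamma>. valid_path g \<and> path_image g \<inter> spectrum J D A = {})"

lemma riesz_commutes:
  assumes \<Gamma>: "admissible \<Gamma>" and P: "bounded_linear P" "\<And>x. P (J x) = J (P x)"
    "\<And>t x. t \<ge> 0 \<Longrightarrow> T t (P x) = P (T t x)"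
  shows "P (riesz_projection J D A \<Gamma> z) = riesz_projection J D A \<Gamma> (P z)"
proof -
  note lin = bounded_linear.linear[OF P(1)]
  have *: "P (integral {0..1} (riesz_integrand g z)) = integral {0..1} (riesz_integrand g (P z))" if "g \<in> set \<Gamma>" for g
  proof -
    have g: "valid_path g" "path_image g \<inter> spectrum J D A = {}" using that \<Gamma> by (auto simp: admissible_def)
    have "P (integral {0..1} (riesz_integrand g z)) = integral {0..1} (P \<circ> riesz_integrand g z)"
      by (rule integral_linear[OF riesz_integrand_integrable[OF g] P(1), symmetric])
    also have "\<dots> = integral {0..1} (riesz_integrand g (P z))"
    proof (rule integral_cong)
      fix t :: real assume "t \<in> {0..1}"
      then have "g t \<notin> spectrum J D A" using g(2) unfolding path_image_def by blast
      then show "(P \<circ> riesz_integrand g z) t = riesz_integrand g (P z) t"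
        using resolvent_commutes[OF _ P] commutes_cscale[OF lin P(2)] by simp
    qed
    finally show ?thesis .
  qed
  have "P (\<Sum>g\<leftarrow>\<Gamma>'. integral {0..1} (riesz_integrand g z)) = (\<Sum>g\<leftarrow>\<Gamma>'. integral {0..1} (riesz_integrand g (P z)))"
    if "set \<Gamma>' \<subseteq> set \<Gamma>" for \<Gamma>'
    using that * by (induction \<Gamma>') (auto simp: linear_add[OF lin] linear_0[OF lin])
  then show ?thesis unfolding riesz_projection_def by (simp add: commutes_cscale[OF lin P(2)])
qed

lemma riesz_linear:
  assumes \<Gamma>: "admissible \<Gamma>"
  shows "linear (riesz_projection J D A \<Gamma>)"
proof (rule linearI)
  fix x y :: 'z and c :: real
  have res: "g t \<notin> spectrum J D A" if "g \<in> set \<Gamma>" "t \<in> {0..1}" for g t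
    using that \<Gamma> unfolding admissible_def path_image_def by blast
  have "integral {0..1} (riesz_integrand g (x + y)) = integral {0..1} (riesz_integrand g x) + integral {0..1} (riesz_integrand g y)"
    if "g \<in> set \<Gamma>" for g
  proof -
    have g: "valid_path g" "path_image g \<inter> spectrum J D A = {}" using that \<Gamma> by (auto simp: admissible_def)
    have "integral {0..1} (riesz_integrand g (x + y)) = integral {0..1} (\<lambda>t. riesz_integrand g x t + riesz_integrand g y t)"
      by (rule integral_cong) (use bounded_linear.linear[OF resolventD(1)[OF res[OF that]]] in \<open>simp add: linear_add cs.add_right\<close>)
    then show ?thesis using Henstock_Kurzweil_Integration.integral_add[OF riesz_integrand_integrable[OF g] riesz_integrand_integrable[OF g]] by simp
  qed
  then have "(\<Sum>g\<leftarrow>\<Gamma>'. integral {0..1} (riesz_integrand g (x + y))) = (\<Sum>g\<leftarrow>\<Gamma>'. integral {0..1} (riesz_integrand g x)) + (\<Sum>g\<leftarrow>\<Gamma>'. integral {0..1} (riesz_integrand g y))"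
    if "set \<Gamma>' \<subseteq> set \<Gamma>" for \<Gamma>' using that by (induction \<Gamma>') auto
  then show "riesz_projection J D A \<Gamma> (x + y) = riesz_projection J D A \<Gamma> x + riesz_projection J D A \<Gamma> y"
    by (simp add: riesz_projection_def cs.add_right)
  show "riesz_projection J D A \<Gamma> (c *\<^sub>R x) = c *\<^sub>R riesz_projection J D A \<Gamma> x"
    using riesz_commutes[OF \<Gamma>, of "\<lambda>x. c *\<^sub>R x" x] C0_semigroupD(3)[OF sg]
    by (simp add: bounded_linear_scaleR_right J_simps)
qed

lemma eigenvalue_in_spectrum:
  assumes "w \<in> D" "w \<noteq> 0" "A w = cscale J \<mu> w"
  shows "\<mu> \<in> spectrum J D A"
proof (rule ccontr)
  assume "\<mu> \<notin> spectrum J D A"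
  from resolventD(4)[OF this assms(1), of 0] bounded_linear.linear[OF resolventD(1)[OF this]]
  show False using assms by (simp add: linear_0)
qed

text \<open>
  On an eigenvector the resolvent at \<open>\<zeta>\<close> is multiplication by \<open>1 / (\<zeta> - \<mu>)\<close>, and the integral of this function is a winding
  number.
\<close>
lemma riesz_eigenvector:
  assumes \<Gamma>: "admissible \<Gamma>" and w: "w \<in> D" "w \<noteq> 0" "A w = cscale J \<mu> w"
  shows "riesz_projection J D A \<Gamma> w = cscale J (\<Sum>g\<leftarrow>\<Gamma>. winding_number g \<mu>) w"
proof -
  note \<mu> = eigenvalue_in_spectrum[OF w]
  have *: "integral {0..1} (riesz_integrand g w) = cscale J (2 * of_real pi * \<i> * winding_number g \<mu>) w"
    if "g \<in> set \<Gamma>" for g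
  proof -
    have g: "valid_path g" "path_image g \<inter> spectrum J D A = {}" using that \<Gamma> by (auto simp: admissible_def)
    then have "((\<lambda>\<zeta>. 1 / (\<zeta> - \<mu>)) has_contour_integral 2 * of_real pi * \<i> * winding_number g \<mu>) g"
      using \<mu> has_contour_integral_winding_number[of g \<mu>] by (auto simp: mult_ac)
    then have "((\<lambda>t. 1 / (g t - \<mu>) * vector_derivative g (at t within {0..1})) has_integral 2 * of_real pi * \<i> * winding_number g \<mu>) {0..1}"
      by (simp add: has_contour_integral_def)
    then have "((\<lambda>c. cscale J c w) \<circ> (\<lambda>t. 1 / (g t - \<mu>) * vector_derivative g (at t within {0..1})) has_integral
        cscale J (2 * of_real pi * \<i> * winding_number g \<mu>) w) {0..1}"
      by (rule has_integral_linear[OF _ cs.bounded_linear_left])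
    then have "(riesz_integrand g w has_integral cscale J (2 * of_real pi * \<i> * winding_number g \<mu>) w) {0..1}"
    proof (rule has_integral_eq[rotated])
      fix t :: real assume t: "t \<in> {0..1}"
      then have gt: "g t \<notin> spectrum J D A" using g(2) unfolding path_image_def by blast
      then have "g t - \<mu> \<noteq> 0" using \<mu> by auto
      have "resolvent J D A (g t) w = cscale J (1 / (g t - \<mu>)) w"
      proof (rule resolventD(4)[OF gt])
        show "cscale J (1 / (g t - \<mu>)) w \<in> D" by (rule D_cscale(1)[OF w(1)])
        have "cscale J (g t) (cscale J (1 / (g t - \<mu>)) w) - A (cscale J (1 / (g t - \<mu>)) w)
            = cscale J (g t * (1 / (g t - \<mu>)) - 1 / (g t - \<mu>) * \<mu>) w"
          by (simp only: D_cscale(2)[OF w(1)] w(3) cscale_cscale cs.diff_left)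
        also have "g t * (1 / (g t - \<mu>)) - 1 / (g t - \<mu>) * \<mu> = 1"
          using \<open>g t - \<mu> \<noteq> 0\<close> by (simp add: divide_simps)
        finally show "cscale J (g t) (cscale J (1 / (g t - \<mu>)) w) - A (cscale J (1 / (g t - \<mu>)) w) = w"
          by simp
      qed
      then show "((\<lambda>c. cscale J c w) \<circ> (\<lambda>t. 1 / (g t - \<mu>) * vector_derivative g (at t within {0..1}))) t = riesz_integrand g w t"
        by (simp add: cscale_cscale mult.commute)
    qed
    then show ?thesis by (rule integral_unique)
  qed
  have "(\<Sum>g\<leftarrow>\<Gamma>'. integral {0..1} (riesz_integrand g w)) = cscale J (2 * of_real pi * \<i> * (\<Sum>g\<leftarrow>\<Gamma>'. winding_number g \<mu>)) w"
    if "set \<Gamma>' \<subseteq> set \<Gamma>" for \<Gamma>'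
    using that * by (induction \<Gamma>') (auto simp: cs.zero_left cs.add_left[symmetric] algebra_simps)
  then show ?thesis unfolding riesz_projection_def by (simp add: cscale_cscale)
qed

text \<open>
  The states of \<open>U\<close> whose orbits decay form an invariant subspace \<open>N\<close>. If it is nonzero, it contains an
  eigenvector \<open>w\<close>, and the decay forces the real part of the eigenvalue to be negative. Hence the Riesz projection \<open>P\<close>
  annihilates \<open>w\<close>. On the other hand \<open>P\<close> has range \<open>U\<close> and commutes with the projection \<open>\<pi>\<close> onto \<open>U\<close>, so it maps
  \<open>U\<close> onto \<open>U\<close>, and a linear surjection of a finite-dimensional space is injective.
\<close>
lemma no_stable_orbit_in_unstable_subspace:
  assumes lb: "locally_bounded_on UNIV T" and U: "U = span B" "finite B"
    and \<pi>: "bounded_linear \<pi>" "\<And>x. \<pi> x \<in> U" "\<And>u. u \<in> U \<Longrightarrow> \<pi> u = u"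
    and comm: "\<And>x. \<pi> (J x) = J (\<pi> x)" "\<And>t x. t \<ge> 0 \<Longrightarrow> T t (\<pi> x) = \<pi> (T t x)"
    and spec: "complex_spectral_subspace J D A {\<zeta>. Re \<zeta> \<ge> 0} U"
    and x: "x \<in> U" and \<omega>: "\<omega> > 0" and decay: "\<And>t. t \<ge> 0 \<Longrightarrow> norm (T t x) \<le> M * exp (- \<omega> * t)"
  shows "x = 0"
proof (rule ccontr)
  assume "x \<noteq> 0"
  have UD: "U \<subseteq> D" by (rule finite_dim_invariant_subset_domain[OF gen lb U \<pi> comm(2)])
  have sU: "subspace U" using U by simp
  have U_J: "J y \<in> U" if "y \<in> U" for y using \<pi>(2)[of "J y"] comm(1)[of y] \<pi>(3)[OF that] by simp
  have U_A: "A y \<in> U" if "y \<in> U" for y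
    using generator_commutes[OF gen \<pi>(1) comm(2), of y] \<pi>(2)[of "A y"] \<pi>(3)[OF that] that UD by auto
  have U_T: "T t y \<in> U" if "y \<in> U" "t \<ge> 0" for y t
    using comm(2)[OF that(2), of y] \<pi>(2)[of "T t y"] \<pi>(3)[OF that(1)] by simp
  obtain K where K: "K \<ge> 0" "\<And>y. y \<in> U \<Longrightarrow> norm (A y) \<le> K * norm y"
  proof (rule uniformly_bounded_on_span[OF U(2), of "{A}"])
    show "f (y + z) = f y + f z" if "f \<in> {A}" "y \<in> span B" "z \<in> span B" for f y z
    proof -
      have "y \<in> D" "z \<in> D" using that UD U by auto
      from D_add(2)[OF this] show ?thesis using that(1) by simp
    qed
    show "f (c *\<^sub>R y) = c *\<^sub>R f y" if "f \<in> {A}" "y \<in> span B" for f c y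
    proof -
      have "y \<in> D" using that UD U by auto
      from generator_scale[OF gen subspace_UNIV this, of c] show ?thesis using that(1) by simp
    qed
  qed (use U that in auto)
  obtain kJ where kJ: "kJ > 0" "\<And>z. norm (J z) \<le> norm z * kJ" using bounded_linear.pos_bounded[OF bl] by blast
  define N where "N = {y \<in> U. \<exists>M. \<forall>t\<ge>0. norm (T t y) \<le> M * exp (- \<omega> * t)}"
  have NI: "y \<in> N" if "y \<in> U" "\<And>t. t \<ge> 0 \<Longrightarrow> norm (T t y) \<le> M * exp (- \<omega> * t)" for y M
    using that by (auto simp: N_def)
  have N_sub: "subspace N"
  proof (rule subspaceI)
    show "0 \<in> N"
      by (rule NI[of _ 0]) (use subspace_0[OF sU] linear_0[OF bounded_linear.linear[OF C0_semigroup_bounded_linear[OF sg]]] in auto)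
    fix y z and c :: real assume "y \<in> N"
    then obtain M1 where y: "y \<in> U" "\<And>t. t \<ge> 0 \<Longrightarrow> norm (T t y) \<le> M1 * exp (- \<omega> * t)"
      by (auto simp: N_def)
    show "c *\<^sub>R y \<in> N"
    proof (rule NI)
      show "c *\<^sub>R y \<in> U" using y(1) sU subspace_scale by blast
      show "norm (T t (c *\<^sub>R y)) \<le> (\<bar>c\<bar> * M1) * exp (- \<omega> * t)" if "t \<ge> 0" for t
        using C0_semigroupD(3)[OF sg that, of y c] mult_left_mono[OF y(2)[OF that] abs_ge_zero[of c]] by simp
    qed
    assume "z \<in> N"
    then obtain M2 where z: "z \<in> U" "\<And>t. t \<ge> 0 \<Longrightarrow> norm (T t z) \<le> M2 * exp (- \<omega> * t)"
      by (auto simp: N_def)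
    show "y + z \<in> N"
    proof (rule NI)
      show "y + z \<in> U" using y(1) z(1) sU subspace_add by blast
      show "norm (T t (y + z)) \<le> (M1 + M2) * exp (- \<omega> * t)" if "t \<ge> 0" for t
      proof -
        have "norm (T t (y + z)) \<le> norm (T t y) + norm (T t z)"
          using C0_semigroupD(2)[OF sg that, of y z] norm_triangle_ineq by simp
        then show ?thesis using y(2)[OF that] z(2)[OF that] by (simp add: algebra_simps)
      qed
    qed
  qed
  have N_J: "J y \<in> N" if yN: "y \<in> N" for y
  proof -
    obtain M1 where y: "y \<in> U" "\<And>t. t \<ge> 0 \<Longrightarrow> norm (T t y) \<le> M1 * exp (- \<omega> * t)"
      using yN by (auto simp: N_def)
    show ?thesis
    proof (rule NI)
      show "J y \<in> U" using U_J y by blast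
      show "norm (T t (J y)) \<le> (M1 * kJ) * exp (- \<omega> * t)" if "t \<ge> 0" for t
      proof -
        have "norm (T t (J y)) \<le> norm (T t y) * kJ" using C0_semigroup_J[OF sg that, of y] kJ(2) by simp
        also have "\<dots> \<le> (M1 * exp (- \<omega> * t)) * kJ" using y(2)[OF that] kJ(1) by (intro mult_right_mono) auto
        finally show ?thesis by (simp add: mult_ac)
      qed
    qed
  qed
  have N_A: "A y \<in> N" if yN: "y \<in> N" for y
  proof -
    obtain M1 where y: "y \<in> U" "\<And>t. t \<ge> 0 \<Longrightarrow> norm (T t y) \<le> M1 * exp (- \<omega> * t)"
      using yN by (auto simp: N_def)
    show ?thesis
    proof (rule NI)
      show "A y \<in> U" using U_A y by blast
      show "norm (T t (A y)) \<le> (K * M1) * exp (- \<omega> * t)" if "t \<ge> 0" for t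
      proof -
        have "T t (A y) = A (T t y)"
          using generator_domain_invariant[OF gen subspace_UNIV closed_UNIV _ that, of y] UD y(1) by auto
        then have "norm (T t (A y)) \<le> K * norm (T t y)" using K(2) U_T[OF y(1) that] by simp
        also have "\<dots> \<le> K * (M1 * exp (- \<omega> * t))" using y(2)[OF that] K(1) by (intro mult_left_mono) auto
        finally show ?thesis by (simp add: mult_ac)
      qed
    qed
  qed
  have ND: "N \<subseteq> D" "N \<subseteq> U" using UD by (auto simp: N_def)
  have xN: "x \<in> N" by (rule NI[OF x decay])
  have N_add: "A (y + z) = A y + A z" if "y \<in> N" "z \<in> N" for y z
    by (rule D_add(2)) (use that ND in auto)
  obtain w \<mu> where w: "w \<in> N" "w \<noteq> 0" "A w = cscale J \<mu> w"
    by (rule eigenvector_exists[OF N_sub N_J, of B x A])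
      (use ND U xN \<open>x \<noteq> 0\<close> N_A N_add D_cscale in auto)
  obtain Mw where Mw: "\<And>t. t \<ge> 0 \<Longrightarrow> norm (T t w) \<le> Mw * exp (- \<omega> * t)" using w(1) by (auto simp: N_def)
  have wD: "w \<in> D" using w(1) ND by blast
  \<comment> \<open>this function is constant, that is \<open>T t w = exp (\<mu> t) w\<close>\<close>
  define f where "f t = cscale J (exp (- \<mu> * of_real t)) (T t w)" for t
  have f_const: "f t = w" if "t \<ge> 0" for t
  proof -
    have "f t = f 0"
    proof (rule constant_if_right_derivative_zero[OF that])
      show "continuous_on {0..t} f"
        unfolding f_def
        by (intro cs.continuous_on continuous_intros continuous_on_subset[OF orbit_continuous[OF sg subspace_UNIV lb]]) auto
      fix s :: real assume "0 \<le> s" "s < t"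
      have AT: "A (T s w) = cscale J \<mu> (T s w)"
        using generator_domain_invariant[OF gen subspace_UNIV closed_UNIV wD \<open>0 \<le> s\<close>] w(3) T_cscale[OF \<open>0 \<le> s\<close>] by simp
      have e: "((\<lambda>t. exp (- \<mu> * of_real t)) has_vector_derivative - \<mu> * exp (- \<mu> * of_real s)) (at_right s)"
        by (rule has_vector_derivative_real_field) (auto intro!: derivative_eq_intros)
      have "(f has_vector_derivative
          (cscale J (exp (- \<mu> * of_real s)) (A (T s w)) + cscale J (- \<mu> * exp (- \<mu> * of_real s)) (T s w))) (at_right s)"
        unfolding f_def
        by (rule cs.has_vector_derivative[OF e orbit_right_derivative[OF gen subspace_UNIV closed_UNIV wD \<open>0 \<le> s\<close>]])
      then show "(f has_vector_derivative 0) (at_right s)"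
        by (simp add: AT cscale_cscale cs.minus_left mult.commute)
    qed
    then show ?thesis by (simp add: f_def C0_semigroupD(5)[OF sg])
  qed
  have Re: "Re \<mu> < 0"
  proof (rule ccontr)
    assume "\<not> Re \<mu> < 0"
    obtain k where k: "k > 0" "\<And>c x. norm (cscale J c x) \<le> norm c * norm x * k" using cs.pos_bounded by blast
    have "norm w \<le> (Mw * k) * exp (- \<omega> * t)" if t: "t \<ge> 0" for t
    proof -
      have "norm w \<le> cmod (exp (- \<mu> * of_real t)) * norm (T t w) * k"
        using k(2)[of "exp (- \<mu> * of_real t)" "T t w"] f_const[OF t] by (simp add: f_def)
      also have "cmod (exp (- \<mu> * of_real t)) \<le> 1"
        using \<open>\<not> Re \<mu> < 0\<close> t by simp
      then have "cmod (exp (- \<mu> * of_real t)) * norm (T t w) * k \<le> 1 * (Mw * exp (- \<omega> * t)) * k"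
        using Mw[OF t] k(1) by (intro mult_right_mono mult_mono) auto
      finally show ?thesis by (simp add: mult_ac)
    qed
    moreover have "((\<lambda>t. (Mw * k) * exp (- \<omega> * t)) \<longlongrightarrow> (Mw * k) * 0) at_top"
      by (intro tendsto_intros exp_decay_tendsto_0 \<omega>)
    ultimately have "norm w \<le> Mw * k * 0"
      by (intro tendsto_lowerbound[of _ _ at_top]) (auto simp: eventually_at_top_linorder intro!: exI[of _ 0])
    then show False using w(2) by simp
  qed
  obtain \<Gamma> where \<Gamma>: "\<forall>g\<in>set \<Gamma>. valid_path g \<and> pathfinish g = pathstart g \<and> path_image g \<inter> spectrum J D A = {}"
    and wind: "\<forall>\<zeta> \<in> spectrum J D A - {\<zeta>. Re \<zeta> \<ge> 0}. (\<Sum>g\<leftarrow>\<Gamma>. winding_number g \<zeta>) = 0"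
    and rng: "U = range (riesz_projection J D A \<Gamma>)"
    using spec unfolding complex_spectral_subspace_def by blast
  have adm: "admissible \<Gamma>" using \<Gamma> by (simp add: admissible_def)
  let ?P = "riesz_projection J D A \<Gamma>"
  have "?P ` U = U"
  proof
    show "?P ` U \<subseteq> U" using rng by blast
    have "?P z = ?P (\<pi> z)" for z
      using riesz_commutes[OF adm \<pi>(1) comm, of z] \<pi>(3)[of "?P z"] rng by auto
    then show "U \<subseteq> ?P ` U" using rng \<pi>(2) by blast
  qed
  then have "inj_on ?P U"
    unfolding U(1) by (intro linear_surj_imp_inj_on_span riesz_linear[OF adm] U(2))
  moreover have "?P w = 0"
    using riesz_eigenvector[OF adm wD w(2,3)] wind eigenvalue_in_spectrum[OF wD w(2,3)] Re by (simp add: cs.zero_left)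
  moreover have "?P 0 = 0" by (rule linear_0[OF riesz_linear[OF adm]])
  ultimately show False using w(1,2) ND(2) subspace_0[OF sU] by (metis inj_onD subsetD)
qed

end

section \<open>Stabilizing output injections in finite dimension\<close>

text \<open>
  The representing vector minimizes \<open>W l l / 2 - f l\<close> over \<open>U\<close>. A minimum exists because balls of \<open>U\<close> are compact and
  coercivity makes the function nonnegative outside the ball of radius \<open>2 k / c\<close>.
\<close>
lemma representation_in_coercive_form:
  fixes W :: "'x::real_normed_vector \<Rightarrow> 'x \<Rightarrow> real"
  assumes W: "bounded_bilinear W" and sym: "\<And>x y. W x y = W y x"
    and U: "U = span B" "finite B" and c: "c > 0" "\<And>x. x \<in> U \<Longrightarrow> c * (norm x)\<^sup>2 \<le> W x x"
    and f: "bounded_linear f"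
  obtains l where "l \<in> U" "\<And>x. x \<in> U \<Longrightarrow> W x l = f x"
proof -
  interpret W: bounded_bilinear W by (rule W)
  interpret f: bounded_linear f by (rule f)
  have sU: "subspace U" using U by simp
  obtain k where k: "k > 0" "\<And>x. norm (f x) \<le> norm x * k" using f.pos_bounded by blast
  define g where "g l = W l l / 2 - f l" for l
  define r where "r = 2 * k / c"
  have "compact (U \<inter> cball 0 r)" unfolding U(1) by (rule compact_span_Int_cball[OF U(2)])
  moreover have "0 \<in> U \<inter> cball 0 r" using subspace_0[OF sU] k c by (simp add: r_def)
  moreover have "continuous_on (U \<inter> cball 0 r) g"
    unfolding g_def by (intro continuous_intros W.continuous_on f.continuous_on) auto
  ultimately obtain l where l: "l \<in> U \<inter> cball 0 r" "\<And>y. y \<in> U \<inter> cball 0 r \<Longrightarrow> g l \<le> g y"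
    using continuous_attains_inf[of "U \<inter> cball 0 r" g] by (metis empty_iff)
  have min: "g l \<le> g y" if y: "y \<in> U" for y
  proof (cases "norm y \<le> r")
    case True
    then show ?thesis using l(2) y by auto
  next
    case False
    have "g l \<le> g 0" using l(2) \<open>0 \<in> U \<inter> cball 0 r\<close> by blast
    also have "g 0 = 0" by (simp add: g_def W.zero_left f.zero)
    also have "0 \<le> norm y * (c * norm y / 2 - k)"
      using False c(1) by (intro mult_nonneg_nonneg) (auto simp: r_def field_simps)
    also have "\<dots> = c * (norm y)\<^sup>2 / 2 - norm y * k" by (simp add: power2_eq_square algebra_simps)
    also have "\<dots> \<le> g y" using c(2)[OF y] k(2)[of y] by (simp add: g_def)
    finally show ?thesis .
  qed
  have "W x l = f x" if x: "x \<in> U" for x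
  proof -
    define a where "a = W x l - f x"
    define b where "b = W x x / 2"
    have b: "b \<ge> 0" using order_trans[OF _ c(2)[OF x], of 0] c(1) by (simp add: b_def)
    have quad: "0 \<le> t * a + t\<^sup>2 * b" for t
    proof -
      have "g (l + t *\<^sub>R x) = g l + (t * a + t\<^sup>2 * b)"
        using sym[of l x] by (simp add: g_def a_def b_def W.add_left W.add_right W.scaleR_left W.scaleR_right
            f.add f.scaleR power2_eq_square field_simps)
      moreover have "g l \<le> g (l + t *\<^sub>R x)"
        using l(1) x sU by (intro min subspace_add subspace_scale) auto
      ultimately show ?thesis by simp
    qed
    define u where "u = a / (b + 1)"
    have a: "a = u * (b + 1)" using b by (simp add: u_def)
    have "0 \<le> (- u) * a + (- u)\<^sup>2 * b" by (rule quad)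
    also have "\<dots> = - u\<^sup>2" by (simp add: a power2_eq_square algebra_simps)
    finally have "a = 0" by (simp add: a)
    then show ?thesis by (simp add: a_def)
  qed
  then show ?thesis using that l(1) by blast
qed

lemma exp_blinfun_minus_has_vector_derivative:
  "((\<lambda>t. exp_blinfun M (- t) x) has_vector_derivative - exp_blinfun M (- t) (M x)) (at t within S)"
proof -
  have "((\<lambda>t. exp_blinfun M (- t) x) has_vector_derivative - M (exp_blinfun M (- t) x)) (at t within S)"
    using bounded_linear.has_vector_derivative[OF bounded_bilinear.bounded_linear_left[OF bounded_bilinear_blinfun_apply]
      exp_blinfun_uminus_has_vector_derivative[of M t S], of x] by (simp add: blinfun.minus_left)
  moreover have "M (exp_blinfun M (- t) x) = exp_blinfun M (- t) (M x)"
    using arg_cong[OF exp_blinfun_commute[of M "- t"], of "\<lambda>f. blinfun_apply f x"] by simp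
  ultimately show ?thesis by simp
qed

text \<open>
  If the output vanishes backward in time on \<open>[0, 1]\<close>, then so do all its derivatives at 0, and the output
  is the sum of its Taylor series.
\<close>
lemma observable_on_unit_interval:
  fixes C :: "'x::banach \<Rightarrow> 'y::real_normed_vector"
  assumes C: "bounded_linear C" and zero: "\<And>t. t \<in> {0..1} \<Longrightarrow> C (exp_blinfun M (- t) x) = 0"
  shows "C (exp_blinfun M t x) = 0"
proof -
  interpret C: bounded_linear C by (rule C)
  have step: "C (exp_blinfun M (- t) (blinfun_power M n x)) = 0" if "t \<in> {0..1}" for t n
    using that
  proof (induction n arbitrary: t)
    case 0
    then show ?case using zero by simp
  next
    case (Suc n)
    let ?z = "blinfun_power M n x"
    have "((\<lambda>t. C (exp_blinfun M (- t) ?z)) has_vector_derivative C (- exp_blinfun M (- t) (M ?z))) (at t within {0..1})"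
      by (rule C.has_vector_derivative[OF exp_blinfun_minus_has_vector_derivative])
    then have "((\<lambda>t. 0) has_vector_derivative C (- exp_blinfun M (- t) (M ?z))) (at t within {0..1})"
      by (rule has_vector_derivative_transform[rotated 2]) (use Suc in auto)
    moreover have "((\<lambda>t. 0) has_vector_derivative 0) (at t within {0..1::real})" by simp
    ultimately have "C (- exp_blinfun M (- t) (M ?z)) = 0"
      using Suc.prems by (intro vector_derivative_unique_within_closed_interval[of 0 1 t]) auto
    then show ?case by (simp add: C.neg)
  qed
  have "(\<lambda>n. ((t ^ n / fact n) *\<^sub>R blinfun_power M n) x) sums exp_blinfun M t x"
    by (rule bounded_linear.sums[OF bounded_bilinear.bounded_linear_left[OF bounded_bilinear_blinfun_apply] exp_blinfun_sums])
  then have "(\<lambda>n. C (((t ^ n / fact n) *\<^sub>R blinfun_power M n) x)) sums C (exp_blinfun M t x)"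
    by (rule C.sums)
  moreover have "C (((t ^ n / fact n) *\<^sub>R blinfun_power M n) x) = 0" for n
    using step[of 0 n] by (simp add: blinfun.scaleR_left C.scaleR)
  ultimately show ?thesis using sums_unique2[OF _ sums_zero] by simp
qed

text \<open>
  The output space carries no inner product. Its role is taken by a finite sum of squares of functionals: each state of
  the unit sphere of \<open>U\<close> is detected by some functional at some time in \<open>[0, 1]\<close>, neighbouring states are detected by the
  same one, and the sphere is compact.
\<close>
lemma finitely_many_separating_functionals:
  fixes C :: "'x::banach \<Rightarrow> 'y::real_normed_vector"
  assumes C: "bounded_linear C" and U: "U = span B" "finite B"
    and obs: "\<And>x. x \<in> U \<Longrightarrow> (\<And>t. t \<ge> 0 \<Longrightarrow> C (exp_blinfun M t x) = 0) \<Longrightarrow> x = 0"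
  obtains F :: "('y \<Rightarrow> real) set" where "finite F" "\<And>h. h \<in> F \<Longrightarrow> bounded_linear h"
    "\<And>x. x \<in> U \<Longrightarrow> x \<noteq> 0 \<Longrightarrow> \<exists>t\<in>{0..1}. \<exists>h\<in>F. h (C (exp_blinfun M (- t) x)) \<noteq> 0"
proof -
  interpret C: bounded_linear C by (rule C)
  have sU: "subspace U" using U by simp
  have "\<exists>t\<in>{0..1}. \<exists>h. bounded_linear h \<and> h (C (exp_blinfun M (- t) x)) \<noteq> (0::real)" if x: "x \<in> U" "x \<noteq> 0" for x
  proof -
    have "\<exists>t\<in>{0..1}. C (exp_blinfun M (- t) x) \<noteq> 0"
      using obs[OF x(1)] observable_on_unit_interval[OF C, of M x] x(2) by blast
    then show ?thesis using separating_functional by metis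
  qed
  then obtain t h where th: "\<And>x. x \<in> U \<Longrightarrow> x \<noteq> 0 \<Longrightarrow> t x \<in> {0..1} \<and> bounded_linear (h x) \<and> h x (C (exp_blinfun M (- t x) x)) \<noteq> (0::real)"
    by metis
  define S where "S = U \<inter> sphere 0 1"
  have S: "x \<in> U" "x \<noteq> 0" if "x \<in> S" for x using that by (auto simp: S_def)
  have thS: "t x \<in> {0..1}" "bounded_linear (h x)" if "x \<in> S" for x
    using th[OF S[OF that]] by auto
  have "compact S" unfolding S_def U(1) by (rule compact_span_Int_sphere[OF U(2)])
  moreover have "open {z. h x (C (exp_blinfun M (- t x) z)) \<noteq> 0}" if "x \<in> S" for x
  proof (rule open_Collect_neq)
    have "bounded_linear (\<lambda>z. h x (C (exp_blinfun M (- t x) z)))"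
      by (intro bounded_linear_compose[OF thS(2)[OF that]] bounded_linear_compose[OF C] blinfun.bounded_linear_right)
    then show "continuous_on UNIV (\<lambda>z. h x (C (exp_blinfun M (- t x) z)))"
      by (rule linear_continuous_on)
  qed simp
  moreover have "S \<subseteq> (\<Union>x\<in>S. {z. h x (C (exp_blinfun M (- t x) z)) \<noteq> 0})"
    using th[OF S] by blast
  ultimately obtain S' where S': "S' \<subseteq> S" "finite S'" "S \<subseteq> (\<Union>x\<in>S'. {z. h x (C (exp_blinfun M (- t x) z)) \<noteq> 0})"
    by (rule compactE_image)
  show ?thesis
  proof (rule that)
    show "finite (h ` S')" using S' by simp
    show "bounded_linear g" if "g \<in> h ` S'" for g using thS(2) S'(1) that by auto
    fix x assume x: "x \<in> U" "x \<noteq> 0"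
    then have "(1 / norm x) *\<^sub>R x \<in> S" using sU subspace_scale by (auto simp: S_def)
    then obtain z where z: "z \<in> S'" "h z (C (exp_blinfun M (- t z) ((1 / norm x) *\<^sub>R x))) \<noteq> 0"
      using S'(3) by blast
    have zS: "z \<in> S" using z(1) S'(1) by blast
    interpret h: bounded_linear "h z" by (rule thS(2)[OF zS])
    have "h z (C (exp_blinfun M (- t z) x)) \<noteq> 0"
      using z(2) by (simp add: blinfun.scaleR_right C.scaleR h.scaleR)
    with thS(1)[OF zS] show "\<exists>t\<in>{0..1}. \<exists>h\<in>h ` S'. h (C (exp_blinfun M (- t) x)) \<noteq> 0" using z(1) by blast
  qed
qed


lemma bounded_bilinear_sum_of_products:
  fixes F :: "('y::real_normed_vector \<Rightarrow> real) set"
  assumes "finite F" "\<And>h. h \<in> F \<Longrightarrow> bounded_linear h"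
  shows "bounded_bilinear (\<lambda>y z. \<Sum>h\<in>F. h y * h z)"
proof
  have "\<exists>k. \<forall>y z. norm (\<Sum>h\<in>F. h y * h z) \<le> norm y * norm z * k"
    using assms
  proof (induction F rule: finite_induct)
    case (insert h F)
    then obtain k where k: "\<And>y z. norm (\<Sum>h\<in>F. h y * h z) \<le> norm y * norm z * k" by auto
    obtain m where m: "m > 0" "\<And>y. norm (h y) \<le> norm y * m"
      using bounded_linear.pos_bounded insert.prems by blast
    have "norm (\<Sum>h\<in>insert h F. h y * h z) \<le> norm y * norm z * (m * m + k)" for y z
    proof -
      have "norm (\<Sum>h\<in>insert h F. h y * h z) \<le> norm (h y) * norm (h z) + norm (\<Sum>h\<in>F. h y * h z)"
        using insert(1,2) norm_triangle_ineq[of "h y * h z"] by (simp add: abs_mult)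
      also have "\<dots> \<le> (norm y * m) * (norm z * m) + norm y * norm z * k"
        using m by (intro add_mono mult_mono m(2) k) auto
      finally show ?thesis by (simp add: algebra_simps)
    qed
    then show ?case by blast
  qed (auto intro: exI[of _ 0])
  then show "\<exists>K. \<forall>a b. norm (\<Sum>h\<in>F. h a * h b) \<le> norm a * norm b * K" .
  note lin = bounded_linear.linear[OF assms(2)]
  fix a a' b b' :: 'y and r :: real
  show "(\<Sum>h\<in>F. h (a + a') * h b) = (\<Sum>h\<in>F. h a * h b) + (\<Sum>h\<in>F. h a' * h b)"
    by (simp add: linear_add[OF lin] algebra_simps sum.distrib)
  show "(\<Sum>h\<in>F. h a * h (b + b')) = (\<Sum>h\<in>F. h a * h b) + (\<Sum>h\<in>F. h a * h b')"
    by (simp add: linear_add[OF lin] algebra_simps sum.distrib)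
  show "(\<Sum>h\<in>F. h (r *\<^sub>R a) * h b) = r *\<^sub>R (\<Sum>h\<in>F. h a * h b)"
    by (simp add: linear_cmul[OF lin] mult_ac sum_distrib_left)
  show "(\<Sum>h\<in>F. h a * h (r *\<^sub>R b)) = r *\<^sub>R (\<Sum>h\<in>F. h a * h b)"
    by (simp add: linear_cmul[OF lin] mult_ac sum_distrib_left)
qed

text \<open>
  The observability Gramian runs backward in time and is discounted, because then its derivative along the flow of
  \<open>M\<close> contains the term \<open>- 2 W\<close>, whatever the spectrum of \<open>M\<close>.
\<close>
definition gramian :: "('y \<Rightarrow> 'y \<Rightarrow> real) \<Rightarrow> ('x \<Rightarrow> 'y) \<Rightarrow> ('x::banach \<Rightarrow>\<^sub>L 'x) \<Rightarrow> 'x \<Rightarrow> 'x \<Rightarrow> real" where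
  "gramian q C M x z =
     integral {0..1} (\<lambda>s. exp (- (2 * s)) * q (C (exp_blinfun M (- s) x)) (C (exp_blinfun M (- s) z)))"

locale output_form = q: bounded_bilinear q + C: bounded_linear C
  for q :: "'y::real_normed_vector \<Rightarrow> 'y \<Rightarrow> real" and C :: "'x::banach \<Rightarrow> 'y" +
  fixes M :: "'x \<Rightarrow>\<^sub>L 'x"
  assumes q_sym: "q y z = q z y" and q_nonneg: "q y y \<ge> 0"
begin

abbreviation W :: "'x \<Rightarrow> 'x \<Rightarrow> real" where "W \<equiv> gramian q C M"

lemma integrand_continuous:
  "continuous_on {0..1} (\<lambda>s. exp (- (2 * s)) * q (C (exp_blinfun M (- s) x)) (C (exp_blinfun M (- s) z)))"
proof -
  have E: "continuous_on {0..1} (\<lambda>s. exp_blinfun M (- s) x)" for x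
    by (rule continuous_on_vector_derivative) (rule exp_blinfun_minus_has_vector_derivative)
  have "continuous_on {0..1} (\<lambda>s::real. exp (- (2 * s)))" by (intro continuous_intros)
  then show ?thesis
    by (rule continuous_on_mult[OF _ q.continuous_on[OF C.continuous_on[OF E] C.continuous_on[OF E]]])
qed

lemma integrand_integrable:
  "(\<lambda>s. exp (- (2 * s)) * q (C (exp_blinfun M (- s) x)) (C (exp_blinfun M (- s) z))) integrable_on {0..1}"
  by (rule integrable_continuous_real[OF integrand_continuous])

lemma bounded_bilinear_gramian: "bounded_bilinear W"
proof
  fix a a' b b' :: 'x and r :: real
  show "W (a + a') b = W a b + W a' b" "W a (b + b') = W a b + W a b'"
    unfolding gramian_def
    by (simp_all add: blinfun.add_right C.add q.add_left q.add_right distrib_left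
        Henstock_Kurzweil_Integration.integral_add[OF integrand_integrable integrand_integrable])
  show "W (r *\<^sub>R a) b = r *\<^sub>R W a b" "W a (r *\<^sub>R b) = r *\<^sub>R W a b"
    unfolding gramian_def
    by (simp_all add: blinfun.scaleR_right C.scaleR q.scaleR_left q.scaleR_right mult.left_commute)
  obtain kC where kC: "kC > 0" "\<And>x. norm (C x) \<le> norm x * kC" using C.pos_bounded by blast
  obtain kq where kq: "kq > 0" "\<And>x y. norm (q x y) \<le> norm x * norm y * kq" using q.pos_bounded by blast
  have "compact ((\<lambda>s. exp_blinfun M (- s)) ` {0..1})"
    by (intro compact_continuous_image continuous_on_compose2[OF continuous_on_exp_blinfun[of UNIV]] continuous_intros) auto
  then obtain N where N: "N > 0" "\<And>s. s \<in> {0..1} \<Longrightarrow> norm (exp_blinfun M (- s)) \<le> N"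
    using compact_imp_bounded bounded_pos by (metis imageI)
  have CE: "norm (C (exp_blinfun M (- s) x)) \<le> N * norm x * kC" if "s \<in> {0..1}" for s x
  proof -
    have "norm (C (exp_blinfun M (- s) x)) \<le> norm (exp_blinfun M (- s) x) * kC" by (rule kC(2))
    also have "\<dots> \<le> (N * norm x) * kC"
      using norm_blinfun[of "exp_blinfun M (- s)" x] mult_right_mono[OF N(2)[OF that] norm_ge_zero[of x]] kC(1)
      by (intro mult_right_mono) auto
    finally show ?thesis .
  qed
  have "norm (W a b) \<le> norm a * norm b * (N * N * kC * kC * kq)" for a b
  proof -
    have "norm (W a b) \<le> (norm a * norm b * (N * N * kC * kC * kq)) * (1 - 0)"
      unfolding gramian_def
    proof (rule integral_bound)
      fix s :: real assume s: "s \<in> {0..1}"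
      have "norm (exp (- (2 * s)) * q (C (exp_blinfun M (- s) a)) (C (exp_blinfun M (- s) b)))
          \<le> 1 * (norm (C (exp_blinfun M (- s) a)) * norm (C (exp_blinfun M (- s) b)) * kq)"
        unfolding norm_mult using s kq by (intro mult_mono kq(2)) auto
      also have "\<dots> \<le> 1 * ((N * norm a * kC) * (N * norm b * kC) * kq)"
        using kq(1) kC(1) N(1) by (intro mult_left_mono mult_right_mono mult_mono CE s) auto
      finally show "norm (exp (- (2 * s)) * q (C (exp_blinfun M (- s) a)) (C (exp_blinfun M (- s) b)))
          \<le> norm a * norm b * (N * N * kC * kC * kq)" by (simp add: mult_ac)
    qed (use integrand_continuous in auto)
    then show ?thesis by simp
  qed
  then show "\<exists>K. \<forall>a b. norm (W a b) \<le> norm a * norm b * K" by blast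
qed

sublocale W: bounded_bilinear W by (rule bounded_bilinear_gramian)

lemma gramian_sym: "W x z = W z x"
  unfolding gramian_def by (simp add: q_sym[of "C (exp_blinfun M (- _) x)"])

lemma gramian_nonneg: "W x x \<ge> 0"
  unfolding gramian_def
  by (rule Henstock_Kurzweil_Integration.integral_nonneg[OF integrand_integrable]) (simp add: q_nonneg)

lemma gramian_eq_0_imp:
  assumes "W x x = 0" "t \<in> {0..1}"
  shows "q (C (exp_blinfun M (- t) x)) (C (exp_blinfun M (- t) x)) = 0"
proof -
  have "exp (- (2 * t)) * q (C (exp_blinfun M (- t) x)) (C (exp_blinfun M (- t) x)) = 0"
    by (rule has_integral_0_cbox_imp_0[of 0 1])
      (use integrand_continuous q_nonneg assms integrable_integral[OF integrand_integrable, of x x] in \<open>auto simp: gramian_def\<close>)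
  then show ?thesis by simp
qed

text \<open>
  This is integration by parts; the boundary term at time 1 has the right sign and is dropped.
\<close>
lemma gramian_generator: "2 * W x (M x) \<le> q (C x) (C x) - 2 * W x x"
proof -
  define c where "c s = C (exp_blinfun M (- s) x)" for s
  define d where "d s = C (exp_blinfun M (- s) (M x))" for s
  define G where "G s = exp (- (2 * s)) * q (c s) (c s)" for s
  have c': "(c has_vector_derivative - d s) (at s within {0..1})" for s
    unfolding c_def d_def using C.has_vector_derivative[OF exp_blinfun_minus_has_vector_derivative] by (simp add: C.neg)
  have q': "((\<lambda>s. q (c s) (c s)) has_vector_derivative (q (c s) (- d s) + q (- d s) (c s))) (at s within {0..1})" for s
    by (rule q.has_vector_derivative[OF c' c'])
  have e': "((\<lambda>s. exp (- (2 * s))) has_vector_derivative (- 2 * exp (- (2 * s)))) (at s within {0..1})" for s :: real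
    by (auto intro!: derivative_eq_intros simp: has_real_derivative_iff_has_vector_derivative[symmetric])
  have G': "(G has_vector_derivative (- 2) * (exp (- (2 * s)) * q (c s) (c s)) + (- 2) * (exp (- (2 * s)) * q (c s) (d s))) (at s within {0..1})" for s
    using bounded_bilinear.has_vector_derivative[OF bounded_bilinear_mult e' q', of s] q_sym[of "d s" "c s"]
    unfolding G_def by (simp add: q.minus_right q.minus_left algebra_simps)
  have "((\<lambda>s. (- 2) * (exp (- (2 * s)) * q (c s) (c s)) + (- 2) * (exp (- (2 * s)) * q (c s) (d s))) has_integral G 1 - G 0) {0..1}"
    by (rule fundamental_theorem_of_calculus) (use G' in auto)
  moreover have "((\<lambda>s. (- 2) * (exp (- (2 * s)) * q (c s) (c s)) + (- 2) * (exp (- (2 * s)) * q (c s) (d s))) has_integral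
      (- 2) * W x x + (- 2) * W x (M x)) {0..1}"
    unfolding c_def d_def gramian_def
    by (intro has_integral_add has_integral_mult_right integrable_integral integrand_integrable)
  ultimately have "G 1 - G 0 = (- 2) * W x x + (- 2) * W x (M x)" by (rule has_integral_unique)
  moreover have "G 0 = q (C x) (C x)" by (simp add: G_def c_def)
  moreover have "G 1 \<ge> 0" by (simp add: G_def q_nonneg)
  ultimately show ?thesis by simp
qed

lemma gramian_coercive:
  assumes U: "U = span B" "finite B"
    and pos: "\<And>x. x \<in> U \<Longrightarrow> x \<noteq> 0 \<Longrightarrow> \<exists>t\<in>{0..1}. q (C (exp_blinfun M (- t) x)) (C (exp_blinfun M (- t) x)) \<noteq> 0"
  obtains c where "c > 0" "\<And>x. x \<in> U \<Longrightarrow> c * (norm x)\<^sup>2 \<le> W x x"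
proof -
  have sU: "subspace U" using U by simp
  define S where "S = U \<inter> sphere 0 1"
  have normalized: "(1 / norm x) *\<^sub>R x \<in> S" if "x \<in> U" "x \<noteq> 0" for x
    using that sU subspace_scale by (auto simp: S_def)
  show ?thesis
  proof (cases "S = {}")
    case True
    then have U0: "x = 0" if "x \<in> U" for x using normalized that by blast
    show ?thesis
    proof (rule that[of 1])
      show "1 * (norm x)\<^sup>2 \<le> W x x" if "x \<in> U" for x
        using U0[OF that] by (simp add: W.zero_left)
    qed simp
  next
    case False
    have "compact S" unfolding S_def U(1) by (rule compact_span_Int_sphere[OF U(2)])
    moreover have "continuous_on S (\<lambda>x. W x x)" by (intro W.continuous_on continuous_intros)
    ultimately obtain w where w: "w \<in> S" "\<And>x. x \<in> S \<Longrightarrow> W w w \<le> W x x"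
      using continuous_attains_inf[of S "\<lambda>x. W x x"] False by metis
    have "w \<in> U" "w \<noteq> 0" using w(1) by (auto simp: S_def)
    then have "W w w \<noteq> 0" using pos gramian_eq_0_imp by blast
    then have c: "W w w > 0" using gramian_nonneg[of w] by simp
    have "W w w * (norm x)\<^sup>2 \<le> W x x" if x: "x \<in> U" for x
    proof (cases "x = 0")
      case False
      have "W w w \<le> W ((1 / norm x) *\<^sub>R x) ((1 / norm x) *\<^sub>R x)" by (rule w(2)[OF normalized[OF x False]])
      also have "\<dots> = W x x / (norm x)\<^sup>2" by (simp add: W.scaleR_left W.scaleR_right power2_eq_square)
      finally show ?thesis using False by (simp add: field_simps)
    qed (simp add: W.zero_left)
    then show ?thesis using that c by blast
  qed
qed

text \<open>
  Along the flow of \<open>K = M + L C\<close> the derivative of \<open>W x x\<close> is at most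
  \<open>q (C x) (C x) - 2 W x x - 2 q (C x) (C x) \<le> - 2 W x x\<close>.
\<close>
lemma injection_decay:
  fixes K :: "'x \<Rightarrow>\<^sub>L 'x"
  assumes U: "subspace U" "closed U" and c: "c > 0" "\<And>x. x \<in> U \<Longrightarrow> c * (norm x)\<^sup>2 \<le> W x x"
    and K: "\<And>x. x \<in> U \<Longrightarrow> K x \<in> U" "\<And>x. x \<in> U \<Longrightarrow> K x = M x + L (C x)"
    and L: "\<And>x y. x \<in> U \<Longrightarrow> W x (L y) = - q (C x) y"
  obtains N where "N > 0" "\<And>x t. x \<in> U \<Longrightarrow> t \<ge> 0 \<Longrightarrow> norm (exp_blinfun K t x) \<le> N * exp (- t) * norm x"
proof -
  obtain k where k: "k > 0" "\<And>x y. norm (W x y) \<le> norm x * norm y * k" using W.pos_bounded by blast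
  have dissip: "2 * W x (K x) \<le> - 2 * W x x" if "x \<in> U" for x
    using gramian_generator[of x] L[OF that, of "C x"] K(2)[OF that] q_nonneg[of "C x"] by (simp add: W.add_right)
  have bound: "norm (exp_blinfun K t x) \<le> sqrt (k / c) * exp (- t) * norm x" if x: "x \<in> U" and t: "t \<ge> 0" for x t
  proof -
    define z where "z s = exp_blinfun K s x" for s
    have z: "z s \<in> U" for s unfolding z_def by (rule exp_blinfun_invariant[OF U K(1) x])
    have z': "(z has_vector_derivative K (z s)) (at s)" for s
      unfolding z_def by (rule exp_blinfun_apply_has_vector_derivative)
    have W': "((\<lambda>s. W (z s) (z s)) has_vector_derivative (W (z s) (K (z s)) + W (K (z s)) (z s))) (at s)" for s
      by (rule W.has_vector_derivative[OF z' z'])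
    have f': "((\<lambda>s. exp (2 * s) * W (z s) (z s)) has_real_derivative
        (2 * exp (2 * s) * W (z s) (z s) + (W (z s) (K (z s)) + W (K (z s)) (z s)) * exp (2 * s))) (at s)" for s
      using W'[of s] unfolding has_real_derivative_iff_has_vector_derivative[symmetric]
      by (auto intro!: derivative_eq_intros)
    have "exp (2 * t) * W (z t) (z t) \<le> exp (2 * 0) * W (z 0) (z 0)"
    proof (rule DERIV_nonpos_imp_nonincreasing[OF t, where f = "\<lambda>s. exp (2 * s) * W (z s) (z s)"])
      fix s :: real
      have "2 * exp (2 * s) * W (z s) (z s) + (W (z s) (K (z s)) + W (K (z s)) (z s)) * exp (2 * s)
          = exp (2 * s) * (2 * W (z s) (K (z s)) + 2 * W (z s) (z s))"
        using gramian_sym[of "K (z s)" "z s"] by (simp add: algebra_simps)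
      also have "\<dots> \<le> 0" using dissip[OF z, of s] by (intro mult_nonneg_nonpos) auto
      finally show "\<exists>y. ((\<lambda>s. exp (2 * s) * W (z s) (z s)) has_real_derivative y) (at s) \<and> y \<le> 0"
        using f'[of s] by blast
    qed
    then have "W (z t) (z t) \<le> exp (- (2 * t)) * W x x"
      by (simp add: z_def exp_minus field_simps)
    also have "\<dots> \<le> exp (- (2 * t)) * (norm x * norm x * k)"
      using k(2)[of x x] by (intro mult_left_mono) auto
    finally have "c * (norm (z t))\<^sup>2 \<le> exp (- (2 * t)) * (norm x * norm x * k)" using c(2)[OF z[of t]] by linarith
    then have "(norm (z t))\<^sup>2 \<le> (k / c) * (exp (- t))\<^sup>2 * (norm x)\<^sup>2"
      using c(1) by (simp add: field_simps power2_eq_square exp_add[symmetric])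
    also have "\<dots> = (sqrt (k / c) * exp (- t) * norm x)\<^sup>2" using k(1) c(1) by (simp add: power_mult_distrib)
    finally have "norm (z t) \<le> sqrt (k / c) * exp (- t) * norm x"
      by (rule power2_le_imp_le) (use k(1) c(1) in auto)
    then show ?thesis by (simp add: z_def)
  qed
  show ?thesis by (rule that[of "sqrt (k / c)"]) (use k c bound in auto)
qed

end


lemma bounded_bilinear_plus:
  assumes "bounded_bilinear f" "bounded_bilinear g"
  shows "bounded_bilinear (\<lambda>x y. f x y + g x y)"
proof -
  interpret f: bounded_bilinear f by fact
  interpret g: bounded_bilinear g by fact
  obtain k m where k: "\<And>x y. norm (f x y) \<le> norm x * norm y * k" "\<And>x y. norm (g x y) \<le> norm x * norm y * m"
    using f.bounded g.bounded by blast
  show ?thesis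
  proof
    show "\<exists>K. \<forall>a b. norm (f a b + g a b) \<le> norm a * norm b * K"
    proof (intro exI allI)
      fix a b
      show "norm (f a b + g a b) \<le> norm a * norm b * (k + m)"
        using norm_triangle_ineq[of "f a b" "g a b"] k[of a b] by (simp add: distrib_left)
    qed
  qed (simp_all add: f.add_left f.add_right g.add_left g.add_right f.scaleR_left f.scaleR_right
        g.scaleR_left g.scaleR_right scaleR_add_right)
qed

lemma complex_structure_simps:
  assumes "complex_structure J"
  shows "bounded_linear J" "J (J x) = - x"
proof -
  have lin: "linear J" and JJ: "J (J x) = - x" and n: "norm (cscale J c x) = cmod c * norm x" for c x
    using assms by (auto simp: complex_structure_def)
  show "J (J x) = - x" by (rule JJ)
  have "norm (J x) \<le> norm x * 1" for x using n[of \<i> x] by (simp add: cscale_def)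
  then show "bounded_linear J" by (intro bounded_linear_intro[of J 1] linear_add[OF lin] linear_cmul[OF lin])
qed

lemma bounded_ops_bounded_linear:
  assumes "f \<in> bounded_ops JX JY UNIV G"
  shows "bounded_linear f"
proof -
  obtain m where "\<forall>x. norm (f x) \<le> m * norm x" using assms by (auto simp: bounded_ops_def)
  then show ?thesis
    using assms by (intro bounded_linear_intro[of f m]) (auto simp: bounded_ops_def mult.commute)
qed

text \<open>
  The gain is determined by \<open>W x (L y) = - q (C x) y\<close> for \<open>x \<in> U\<close>, in other words \<open>L = - W\<^sup>-\<^sup>1 C\<^sup>*\<close>. Linearity,
  boundedness and, for complex scalars, complex linearity of \<open>L\<close> follow from the uniqueness of the representing
  vector.
\<close>
lemma stabilizing_output_injection:
  fixes JX :: "('x::banach \<Rightarrow> 'x) option" and JY :: "('y::banach \<Rightarrow> 'y) option"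
    and M :: "'x \<Rightarrow>\<^sub>L 'x"
  assumes scalars: "same_scalar_field JX JY" and C: "C \<in> bounded_ops JX JY UNIV UNIV"
    and U: "U = span B" "finite B" "closed_subspace JX U"
    and M: "\<And>x. x \<in> U \<Longrightarrow> M x \<in> U" "\<And>I x. JX = Some I \<Longrightarrow> M (I x) = I (M x)"
    and obs: "\<And>x. x \<in> U \<Longrightarrow> (\<And>t. t \<ge> 0 \<Longrightarrow> C (exp_blinfun M t x) = 0) \<Longrightarrow> x = 0"
  obtains L and K :: "'x \<Rightarrow>\<^sub>L 'x" and N where "L \<in> bounded_ops JY JX UNIV U" "bounded_linear L"
    "\<And>x. K x = M x + L (C x)" "N > 0"
    "\<And>x t. x \<in> U \<Longrightarrow> t \<ge> 0 \<Longrightarrow> norm (exp_blinfun K t x) \<le> N * exp (- t) * norm x"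
proof -
  have blC: "bounded_linear C" by (rule bounded_ops_bounded_linear[OF C])
  have sU: "subspace U" and cU: "closed U" using U(3) by (auto simp: closed_subspace_def)
  obtain F :: "('y \<Rightarrow> real) set" where F: "finite F" "\<And>h. h \<in> F \<Longrightarrow> bounded_linear h"
    "\<And>x. x \<in> U \<Longrightarrow> x \<noteq> 0 \<Longrightarrow> \<exists>t\<in>{0..1}. \<exists>h\<in>F. h (C (exp_blinfun M (- t) x)) \<noteq> 0"
  proof (rule finitely_many_separating_functionals[OF blC U(1,2), of M])
    show "x = 0" if "x \<in> U" "\<And>t. t \<ge> 0 \<Longrightarrow> C (exp_blinfun M t x) = 0" for x
      by (rule obs) (use that in auto)
  qed (rule that)
  \<comment> \<open>symmetrizing \<open>q\<close> with the imaginary unit of \<open>Y\<close> makes \<open>q\<close> and \<open>W\<close> invariant under the imaginary units; over the reals it only doubles \<open>q\<close>\<close>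
  define e where "e y = (case JY of None \<Rightarrow> y | Some K \<Rightarrow> K y)" for y
  have ble: "bounded_linear e"
  proof (cases JY)
    case None
    then have "e = (\<lambda>y. y)" by (simp add: e_def fun_eq_iff)
    then show ?thesis by simp
  next
    case (Some K)
    then have "e = K" by (simp add: e_def fun_eq_iff)
    moreover have "complex_structure K" using scalars Some by (auto simp: same_scalar_field_def)
    ultimately show ?thesis using complex_structure_simps(1) by simp
  qed
  define s where "s y z = (\<Sum>h\<in>F. h y * h z)" for y z
  define q where "q y z = s y z + s (e y) (e z)" for y z
  have bbs: "bounded_bilinear s" unfolding s_def by (rule bounded_bilinear_sum_of_products[OF F(1,2)])
  have bbq: "bounded_bilinear q"
    unfolding q_def by (intro bounded_bilinear_plus bbs bounded_bilinear.comp[OF bbs ble ble])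
  have s_nonneg: "s y y \<ge> 0" for y unfolding s_def by (intro sum_nonneg) auto
  interpret output_form q C M
    by (intro output_form.intro bbq blC output_form_axioms.intro)
      (auto simp: q_def s_def mult.commute intro!: add_nonneg_nonneg sum_nonneg)
  have q_definite: "h y = 0" if "q y y = 0" "h \<in> F" for y h
  proof -
    have "s y y = 0" using that s_nonneg[of y] s_nonneg[of "e y"] by (simp add: q_def)
    then show ?thesis using that(2) F(1) by (simp add: s_def sum_nonneg_eq_0_iff)
  qed
  obtain c where c: "c > 0" "\<And>x. x \<in> U \<Longrightarrow> c * (norm x)\<^sup>2 \<le> W x x"
    using gramian_coercive[OF U(1,2)] F(3) q_definite by metis
  have "\<exists>l\<in>U. \<forall>x\<in>U. W x l = - q (C x) y" for y
  proof -
    have f: "bounded_linear (\<lambda>x. - q (C x) y)"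
      by (intro bounded_linear_minus bounded_linear_compose[OF q.bounded_linear_left blC])
    obtain l where "l \<in> U" "\<And>x. x \<in> U \<Longrightarrow> W x l = - q (C x) y"
      by (rule representation_in_coercive_form[OF bounded_bilinear_gramian gramian_sym U(1,2) c f], assumption, rule that)
    then show ?thesis by blast
  qed
  then obtain L where L: "\<And>y. L y \<in> U" "\<And>x y. x \<in> U \<Longrightarrow> W x (L y) = - q (C x) y" by metis
  have unique: "L y = l" if "l \<in> U" "\<And>x. x \<in> U \<Longrightarrow> W x l = - q (C x) y" for l y
  proof -
    have d: "L y - l \<in> U" using L(1) that(1) sU subspace_diff by blast
    have "W (L y - l) (L y - l) = 0" using L(2)[OF d, of y] that(2)[OF d] by (simp add: W.diff_right)
    then have "(norm (L y - l))\<^sup>2 \<le> 0" using c(1) c(2)[OF d] by (simp add: mult_le_0_iff)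
    then show ?thesis by simp
  qed
  have L_add: "L (y + z) = L y + L z" for y z
    by (rule unique) (simp_all add: L subspace_add[OF sU] W.add_right q.add_right)
  have L_scale: "L (r *\<^sub>R y) = r *\<^sub>R L y" for r y
    by (rule unique) (simp_all add: L subspace_scale[OF sU] W.scaleR_right q.scaleR_right)
  obtain kC where kC: "kC > 0" "\<And>x. norm (C x) \<le> norm x * kC" using C.pos_bounded by blast
  obtain kq where kq: "kq > 0" "\<And>x y. norm (q x y) \<le> norm x * norm y * kq" using q.pos_bounded by blast
  have L_bound: "norm (L y) \<le> norm y * (kC * kq / c)" for y
  proof (cases "L y = 0")
    case False
    have "c * (norm (L y))\<^sup>2 \<le> W (L y) (L y)" by (rule c(2)[OF L(1)])
    also have "\<dots> \<le> norm (C (L y)) * norm y * kq" using L(2)[OF L(1), of y y] kq(2)[of "C (L y)" y] by simp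
    also have "\<dots> \<le> (norm (L y) * kC) * norm y * kq" using kC(2) kq(1) by (intro mult_right_mono) auto
    finally have "norm (L y) * (c * norm (L y)) \<le> norm (L y) * (kC * norm y * kq)"
      by (simp add: power2_eq_square mult_ac)
    then have "c * norm (L y) \<le> kC * norm y * kq" using False by simp
    then show ?thesis using c(1) by (simp add: field_simps)
  qed (use kC kq c in auto)
  have blL: "bounded_linear L" by (rule bounded_linear_intro[OF L_add L_scale L_bound])
  have L_J: "L (K y) = I (L y)" if IK: "JX = Some I" "JY = Some K" for I K y
  proof (rule unique)
    have csI: "complex_structure I" and csK: "complex_structure K"
      using scalars IK by (auto simp: same_scalar_field_def)
    have CI: "C (I x) = K (C x)" for x using C IK by (auto simp: bounded_ops_def)
    have UI: "I x \<in> U" if "x \<in> U" for x using U(3) IK that by (auto simp: closed_subspace_def)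
    then show "I (L y) \<in> U" using L(1) by blast
    have q_inv: "q (K y) (K z) = q y z" for y z
      using complex_structure_simps(2)[OF csK] bounded_linear.linear[OF F(2)]
      by (simp add: q_def e_def IK s_def linear_neg)
    have q_skew: "q (K y) z = - q y (K z)" for y z
      using q_inv[of y "K z"] complex_structure_simps(2)[OF csK] by (simp add: q.minus_right)
    have W_inv: "W (I x) (I z) = W x z" for x z
      unfolding gramian_def
      using exp_blinfun_commutes[OF complex_structure_simps(1)[OF csI], of M] M(2)[OF IK(1)] by (simp add: CI q_inv)
    fix x assume x: "x \<in> U"
    have "W x (I (L y)) = - W (I x) (L y)"
      using W_inv[of "I x" "L y"] complex_structure_simps(2)[OF csI] by (simp add: W.minus_left)
    also have "\<dots> = q (K (C x)) y" using L(2)[OF UI[OF x]] by (simp add: CI)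
    finally show "W x (I (L y)) = - q (C x) (K y)" by (simp add: q_skew)
  qed
  define K where "K = M + Blinfun (\<lambda>x. L (C x))"
  have K: "K x = M x + L (C x)" for x
    using bounded_linear_compose[OF blL blC] by (simp add: K_def blinfun.add_left bounded_linear_Blinfun_apply)
  have KU: "K x \<in> U" if "x \<in> U" for x
    unfolding K by (rule subspace_add[OF sU M(1)[OF that] L(1)])
  obtain N where N: "N > 0" "\<And>x t. x \<in> U \<Longrightarrow> t \<ge> 0 \<Longrightarrow> norm (exp_blinfun K t x) \<le> N * exp (- t) * norm x"
    using injection_decay[OF sU cU c KU, of L] K L(2) by metis
  have "L \<in> bounded_ops JY JX UNIV U"
    using L(1) L_add L_scale L_J L_bound by (auto simp: bounded_ops_def mult.commute intro!: exI[of _ "kC * kq / c"])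
  then show ?thesis using that blL K N by blast
qed

section \<open>Block triangular perturbations\<close>

text \<open>
  Since \<open>G\<close> takes values in \<open>U\<close>, the operator \<open>A + G\<close> is block triangular with respect to \<open>X = U \<oplus> ker \<pi>\<close>: it is \<open>K\<close> on \<open>U\<close> and
  \<open>A\<close> on \<open>ker \<pi>\<close>, and \<open>G\<close> couples the second part into the first. The semigroup of \<open>A + G\<close> therefore
  consists of \<open>T\<close> on \<open>ker \<pi>\<close> and the solution \<open>w\<close> of the linear equation \<open>w' = K w + G (T t (x - \<pi> x))\<close> in \<open>U\<close>.
\<close>
locale triangular_perturbation =
  fixes JX :: "('x::banach \<Rightarrow> 'x) option" and D :: "'x set" and A :: "'x \<Rightarrow> 'x"
    and T :: "real \<Rightarrow> 'x \<Rightarrow> 'x" and U :: "'x set" and \<pi> :: "'x \<Rightarrow> 'x"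
    and G :: "'x \<Rightarrow> 'x" and K :: "'x \<Rightarrow>\<^sub>L 'x" and Ms \<omega>s N :: real
  assumes gen: "generates JX UNIV D A T" and lb: "locally_bounded_on UNIV T"
    and J: "\<And>J. JX = Some J \<Longrightarrow> bounded_linear J"
    and U: "subspace U" "closed U" "U \<subseteq> D"
    and \<pi>: "bounded_linear \<pi>" "\<And>x. \<pi> x \<in> U" "\<And>u. u \<in> U \<Longrightarrow> \<pi> u = u"
    and \<pi>_T: "\<And>t x. t \<ge> 0 \<Longrightarrow> T t (\<pi> x) = \<pi> (T t x)"
    and \<pi>_J: "\<And>J x. JX = Some J \<Longrightarrow> \<pi> (J x) = J (\<pi> x)"
    and G: "bounded_linear G" "\<And>x. G x \<in> U" "\<And>J x. JX = Some J \<Longrightarrow> G (J x) = J (G x)"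
    and K: "\<And>x. K x = A (\<pi> x) + G x"
    and stable: "Ms > 0" "\<omega>s > 0" "\<And>x t. t \<ge> 0 \<Longrightarrow> norm (T t (x - \<pi> x)) \<le> Ms * exp (- \<omega>s * t) * norm (x - \<pi> x)"
    and decay: "N > 0" "\<And>x t. x \<in> U \<Longrightarrow> t \<ge> 0 \<Longrightarrow> norm (exp_blinfun K t x) \<le> N * exp (- t) * norm x"
begin

sublocale \<pi>: bounded_linear \<pi> by (rule \<pi>(1))
sublocale G: bounded_linear G by (rule G(1))

lemmas sg = generates_D(1)[OF gen]
lemmas T_lin = bounded_linear.linear[OF C0_semigroup_bounded_linear[OF sg]]

abbreviation E where "E \<equiv> exp_blinfun K"

text \<open>
  In the variation of constants formula for \<open>w\<close> the group \<open>E\<close> is factored out of the integral, so that the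
  integrand does not depend on \<open>t\<close>.
\<close>
definition h :: "'x \<Rightarrow> real \<Rightarrow> 'x" where "h x r = E (- r) (G (T r (x - \<pi> x)))"
definition w :: "real \<Rightarrow> 'x \<Rightarrow> 'x" where "w t x = E t (\<pi> x + integral {0..t} (h x))"
definition S :: "real \<Rightarrow> 'x \<Rightarrow> 'x" where "S t x = w t x + T t (x - \<pi> x)"

lemma K_U: "x \<in> U \<Longrightarrow> K x \<in> U"
proof -
  assume x: "x \<in> U"
  have "A (\<pi> x) = \<pi> (A x)" using generator_commutes[OF gen \<pi>(1) \<pi>_T, of x] x U(3) by auto
  then show "K x \<in> U" using K[of x] \<pi>(2) G(2) U(1) subspace_add by metis
qed

lemma E_U: "x \<in> U \<Longrightarrow> E t x \<in> U"
  by (rule exp_blinfun_invariant[OF U(1,2) K_U])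

lemma h_continuous: "continuous_on {0..} (h x)"
proof -
  have E: "continuous_on {0..} (\<lambda>r::real. E (- r))"
    by (rule continuous_on_compose2[OF continuous_on_exp_blinfun[of UNIV]]) (auto intro!: continuous_intros)
  have g: "continuous_on {0..} (\<lambda>r. G (T r (x - \<pi> x)))"
    by (intro G.continuous_on orbit_continuous[OF sg subspace_UNIV lb]) simp
  show ?thesis unfolding h_def by (rule blinfun.continuous_on[OF E g])
qed

lemma h_integrable: "0 \<le> a \<Longrightarrow> h x integrable_on {a..b}"
  by (rule integrable_continuous_real) (rule continuous_on_subset[OF h_continuous], auto)

lemma h_U: "h x r \<in> U"
  unfolding h_def by (rule E_U[OF G(2)])

lemma integral_h_U: "integral {0..t} (h x) \<in> U"
proof -
  have "\<pi> (integral {0..t} (h x)) = integral {0..t} (\<pi> \<circ> h x)"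
    by (rule integral_linear[OF h_integrable \<pi>(1), symmetric]) simp
  also have "\<pi> \<circ> h x = h x" using \<pi>(3)[OF h_U] by (simp add: o_def fun_eq_iff)
  finally show ?thesis using \<pi>(2)[of "integral {0..t} (h x)"] by simp
qed

lemma w_U: "w t x \<in> U"
  unfolding w_def by (intro E_U subspace_add U \<pi>(2) integral_h_U)

lemma \<pi>_complement: "\<pi> (x - \<pi> x) = 0"
  using \<pi>(3)[OF \<pi>(2)] by (simp add: \<pi>.diff)

lemma S_complement: "t \<ge> 0 \<Longrightarrow> S t x - \<pi> (S t x) = T t (x - \<pi> x)" "t \<ge> 0 \<Longrightarrow> \<pi> (S t x) = w t x"
proof -
  assume t: "t \<ge> 0"
  have "\<pi> (T t (x - \<pi> x)) = 0"
    using \<pi>_T[OF t, of "x - \<pi> x"] \<pi>_complement linear_0[OF T_lin[OF t]] by simp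
  then show "\<pi> (S t x) = w t x" by (simp add: S_def \<pi>.add \<pi>(3)[OF w_U])
  then show "S t x - \<pi> (S t x) = T t (x - \<pi> x)" by (simp add: S_def)
qed

lemma E_add: "E (s + t) x = E s (E t x)"
  by (simp add: exp_blinfun_add)

text \<open>
  The integrand that belongs to the state \<open>S t x\<close> is the one of \<open>x\<close> shifted by \<open>t\<close>, up to the factor \<open>E t\<close>.
\<close>
lemma S_add:
  assumes st: "s \<ge> 0" "t \<ge> 0"
  shows "S (s + t) x = S s (S t x)"
proof -
  have hs: "h (S t x) r = E t (h x (r + t))" if "r \<ge> 0" for r
  proof -
    have "h (S t x) r = E (t + (- (r + t))) (G (T (r + t) (x - \<pi> x)))"
      using C0_semigroupD(6)[OF sg that st(2)] by (simp add: h_def S_complement(1)[OF st(2)])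
    then show ?thesis by (simp only: E_add h_def)
  qed
  have "integral {0..s} (h (S t x)) = integral {0..s} (\<lambda>r. E t (h x (r + t)))"
    by (rule integral_cong) (simp add: hs)
  also have "\<dots> = E t (integral {0..s} (\<lambda>r. h x (r + t)))"
  proof -
    have "(\<lambda>r. h x (r + t)) integrable_on {0..s}"
      by (rule integrable_continuous_real, rule continuous_on_compose2[OF h_continuous])
        (use st in \<open>auto intro!: continuous_intros\<close>)
    from integral_linear[OF this blinfun.bounded_linear_right[of "E t"]] show ?thesis by (simp add: o_def)
  qed
  also have "integral {0..s} (\<lambda>r. h x (r + t)) = integral {t..s + t} (h x)"
    using integral_shift_Icc_real[of 0 s "h x" t] by (simp add: o_def add.commute)
  also have "\<dots> = integral {0..s + t} (h x) - integral {0..t} (h x)"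
    using Henstock_Kurzweil_Integration.integral_combine[of 0 t "s + t" "h x"] h_integrable st by (simp add: algebra_simps)
  finally have I: "integral {0..s} (h (S t x)) = E t (integral {0..s + t} (h x) - integral {0..t} (h x))" .
  have "w s (S t x) = E s (w t x + integral {0..s} (h (S t x)))"
    by (simp add: w_def[of s] S_complement(2)[OF st(2)])
  also have "w t x + integral {0..s} (h (S t x)) = E t (\<pi> x + integral {0..s + t} (h x))"
    unfolding I w_def by (simp add: blinfun.add_right[symmetric] del: blinfun.add_right) 
  finally have "w s (S t x) = w (s + t) x" by (simp add: w_def[of "s + t"] E_add)
  then show ?thesis
    using C0_semigroupD(6)[OF sg st] by (simp add: S_def[of s] S_def[of "s + t"] S_complement(1)[OF st(2)])
qed

lemma h_linear:
  assumes "r \<ge> 0"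
  shows "h (x + y) r = h x r + h y r" "h (c *\<^sub>R x) r = c *\<^sub>R h x r"
proof -
  have "(x + y) - \<pi> (x + y) = (x - \<pi> x) + (y - \<pi> y)" by (simp add: \<pi>.add)
  then show "h (x + y) r = h x r + h y r"
    by (simp only: h_def linear_add[OF T_lin[OF assms]] G.add blinfun.add_right)
  have "c *\<^sub>R x - \<pi> (c *\<^sub>R x) = c *\<^sub>R (x - \<pi> x)" by (simp add: \<pi>.scaleR scaleR_diff_right)
  then show "h (c *\<^sub>R x) r = c *\<^sub>R h x r"
    by (simp only: h_def linear_cmul[OF T_lin[OF assms]] G.scaleR blinfun.scaleR_right)
qed

lemma S_linear:
  assumes "t \<ge> 0"
  shows "S t (x + y) = S t x + S t y" "S t (c *\<^sub>R x) = c *\<^sub>R S t x"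
proof -
  have "integral {0..t} (h (x + y)) = integral {0..t} (\<lambda>r. h x r + h y r)"
    by (rule integral_cong) (simp add: h_linear)
  then have I: "integral {0..t} (h (x + y)) = integral {0..t} (h x) + integral {0..t} (h y)"
    by (simp add: Henstock_Kurzweil_Integration.integral_add h_integrable)
  have d: "(x + y) - \<pi> (x + y) = (x - \<pi> x) + (y - \<pi> y)" by (simp add: \<pi>.add)
  show "S t (x + y) = S t x + S t y"
    unfolding S_def w_def d linear_add[OF T_lin[OF assms]] by (simp add: I \<pi>.add blinfun.add_right)
  have "integral {0..t} (h (c *\<^sub>R x)) = integral {0..t} (\<lambda>r. c *\<^sub>R h x r)"
    by (rule integral_cong) (simp add: h_linear)
  then have I: "integral {0..t} (h (c *\<^sub>R x)) = c *\<^sub>R integral {0..t} (h x)" by simp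
  have d: "c *\<^sub>R x - \<pi> (c *\<^sub>R x) = c *\<^sub>R (x - \<pi> x)" by (simp add: \<pi>.scaleR scaleR_diff_right)
  show "S t (c *\<^sub>R x) = c *\<^sub>R S t x"
    unfolding S_def w_def d linear_cmul[OF T_lin[OF assms]]
    by (simp add: I \<pi>.scaleR blinfun.scaleR_right blinfun.add_right scaleR_add_right)
qed

lemma S_J:
  assumes Jx: "JX = Some J" and t: "t \<ge> 0"
  shows "S t (J x) = J (S t x)"
proof -
  interpret J: bounded_linear J by (rule J[OF Jx])
  note sgJ = sg[unfolded Jx]
  have AJ: "A (J x) = J (A x)" if "x \<in> D" for x
    using generator_commutes[OF gen J[OF Jx], of x] C0_semigroup_J[OF sgJ] that by auto
  have KJ: "K (J x) = J (K x)" for x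
    using AJ[of "\<pi> x"] \<pi>(2)[of x] U(3) by (auto simp: K \<pi>_J[OF Jx] G(3)[OF Jx] J.add)
  have EJ: "E s (J x) = J (E s x)" for s x
    by (rule exp_blinfun_commutes[OF J.bounded_linear_axioms KJ])
  have d: "J x - \<pi> (J x) = J (x - \<pi> x)" by (simp add: \<pi>_J[OF Jx] J.diff)
  have hJ: "h (J x) r = J (h x r)" if "r \<ge> 0" for r
    unfolding h_def d by (simp add: C0_semigroup_J[OF sgJ that] G(3)[OF Jx] EJ)
  have "integral {0..t} (h (J x)) = integral {0..t} (J \<circ> h x)"
    by (rule integral_cong) (simp add: hJ)
  also have "\<dots> = J (integral {0..t} (h x))"
    by (rule integral_linear[OF h_integrable J.bounded_linear_axioms]) simp
  finally have I: "integral {0..t} (h (J x)) = J (integral {0..t} (h x))" .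
  show ?thesis
    unfolding S_def w_def d I by (simp add: C0_semigroup_J[OF sgJ t] \<pi>_J[OF Jx] J.add EJ flip: J.add)
qed

text \<open>
  The convolution of two functions that decay with rate \<open>\<mu>\<close> is of order \<open>t exp (- \<mu> t)\<close>; half of the rate is spent on the
  factor \<open>t\<close>.
\<close>
lemma S_decay:
  obtains M \<mu> where "M > 0" "\<mu> > 0" "\<And>x t. t \<ge> 0 \<Longrightarrow> norm (S t x) \<le> M * exp (- \<mu> * t) * norm x"
proof -
  obtain kG where kG: "kG > 0" "\<And>x. norm (G x) \<le> norm x * kG" using G.pos_bounded by blast
  obtain k\<pi> where k\<pi>: "k\<pi> > 0" "\<And>x. norm (\<pi> x) \<le> norm x * k\<pi>" using \<pi>.pos_bounded by blast
  have compl: "norm (x - \<pi> x) \<le> (1 + k\<pi>) * norm x" for x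
    using norm_triangle_ineq4[of x "\<pi> x"] k\<pi>(2)[of x] by (simp add: algebra_simps)
  define \<mu> where "\<mu> = min 1 \<omega>s"
  have \<mu>: "\<mu> > 0" "\<mu> \<le> 1" "\<mu> \<le> \<omega>s" using stable by (auto simp: \<mu>_def)
  define c where "c = N * Ms * kG * (1 + k\<pi>)"
  have c: "c > 0" unfolding c_def using decay(1) stable(1) kG(1) k\<pi>(1) by simp
  have bound: "norm (S t x) \<le> (N * k\<pi> + c * (2 / \<mu>) + Ms * (1 + k\<pi>)) * exp (- (\<mu> / 2) * t) * norm x" if t: "t \<ge> 0" for t x
  proof -
    have ex: "exp (- t) \<le> exp (- (\<mu> / 2) * t)" "exp (- \<omega>s * t) \<le> exp (- (\<mu> / 2) * t)"
      using \<mu> t mult_right_mono[of "\<mu> / 2" 1 t] mult_right_mono[of "\<mu> / 2" \<omega>s t] by auto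
    have "norm (E t (\<pi> x)) \<le> N * exp (- t) * norm (\<pi> x)" by (rule decay(2)[OF \<pi>(2) t])
    also have "\<dots> \<le> N * exp (- (\<mu> / 2) * t) * (norm x * k\<pi>)"
      using decay(1) ex(1) k\<pi> by (intro mult_mono mult_left_mono) auto
    finally have 1: "norm (E t (\<pi> x)) \<le> N * k\<pi> * exp (- (\<mu> / 2) * t) * norm x" by (simp add: mult_ac)
    have "norm (E t (h x r)) \<le> c * exp (- \<mu> * t) * norm x" if r: "r \<in> {0..t}" for r
    proof -
      have "E t (h x r) = E (t - r) (G (T r (x - \<pi> x)))"
        unfolding h_def E_add[symmetric] by simp
      also have "norm \<dots> \<le> N * exp (- (t - r)) * norm (G (T r (x - \<pi> x)))"
        using r by (intro decay(2) G(2)) auto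
      also have "\<dots> \<le> N * exp (- (t - r)) * (Ms * exp (- \<omega>s * r) * norm (x - \<pi> x) * kG)"
        using decay(1) kG(1) stable(3)[of r x] r
        by (intro mult_left_mono order_trans[OF kG(2)] mult_right_mono) auto
      also have "\<dots> \<le> N * exp (- (t - r)) * (Ms * exp (- \<omega>s * r) * ((1 + k\<pi>) * norm x) * kG)"
        using decay(1) kG(1) stable(1) by (intro mult_left_mono mult_right_mono compl) auto
      also have "\<dots> = c * norm x * (exp (- (t - r)) * exp (- \<omega>s * r))" by (simp add: c_def mult_ac)
      also have "\<dots> \<le> c * norm x * (exp (- \<mu> * (t - r)) * exp (- \<mu> * r))"
        using c \<mu> r mult_right_mono[of \<mu> 1 "t - r"] mult_right_mono[of \<mu> \<omega>s r]
        by (intro mult_left_mono mult_mono) auto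
      also have "exp (- \<mu> * (t - r)) * exp (- \<mu> * r) = exp (- \<mu> * t)"
        by (simp add: exp_add[symmetric] algebra_simps)
      finally show ?thesis by (simp add: mult_ac)
    qed
    then have "norm (integral {0..t} (E t \<circ> h x)) \<le> (c * exp (- \<mu> * t) * norm x) * (t - 0)"
      using t blinfun.continuous_on[OF continuous_on_const continuous_on_subset[OF h_continuous], of "{0..t}" "E t" x]
      by (intro integral_bound) (auto simp: o_def)
    also have "integral {0..t} (E t \<circ> h x) = E t (integral {0..t} (h x))"
      by (rule integral_linear[OF h_integrable blinfun.bounded_linear_right]) simp
    finally have I: "norm (E t (integral {0..t} (h x))) \<le> (c * norm x) * (t * exp (- \<mu> * t))" by (simp add: mult_ac)
    have te: "t * exp (- \<mu> * t) \<le> (2 / \<mu>) * exp (- (\<mu> / 2) * t)"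
    proof -
      have "\<mu> / 2 * t \<le> exp (\<mu> / 2 * t)" using exp_ge_add_one_self[of "\<mu> / 2 * t"] by linarith
      then have "t \<le> (2 / \<mu>) * exp (\<mu> / 2 * t)" using \<mu>(1) by (simp add: field_simps)
      then have "t * exp (- \<mu> * t) \<le> (2 / \<mu>) * exp (\<mu> / 2 * t) * exp (- \<mu> * t)" by (intro mult_right_mono) auto
      also have "\<dots> = (2 / \<mu>) * exp (- (\<mu> / 2) * t)" by (simp add: exp_add[symmetric] mult.assoc)
      finally show ?thesis .
    qed
    have "norm (E t (integral {0..t} (h x))) \<le> (c * norm x) * ((2 / \<mu>) * exp (- (\<mu> / 2) * t))"
      by (rule order_trans[OF I mult_left_mono[OF te]]) (use c in simp)
    then have 2: "norm (E t (integral {0..t} (h x))) \<le> c * (2 / \<mu>) * exp (- (\<mu> / 2) * t) * norm x"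
      by (simp only: mult_ac)
    have "norm (T t (x - \<pi> x)) \<le> Ms * exp (- \<omega>s * t) * norm (x - \<pi> x)" by (rule stable(3)[OF t])
    also have "\<dots> \<le> Ms * exp (- (\<mu> / 2) * t) * ((1 + k\<pi>) * norm x)"
      using stable(1) ex(2) compl by (intro mult_mono mult_left_mono) auto
    finally have 3: "norm (T t (x - \<pi> x)) \<le> Ms * (1 + k\<pi>) * exp (- (\<mu> / 2) * t) * norm x" by (simp add: mult_ac)
    have "norm (S t x) \<le> norm (E t (\<pi> x)) + norm (E t (integral {0..t} (h x))) + norm (T t (x - \<pi> x))"
      unfolding S_def w_def blinfun.add_right by (meson norm_triangle_ineq norm_triangle_le add_mono order_refl)
    then show ?thesis using 1 2 3 by (simp add: algebra_simps)
  qed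
  show ?thesis
    by (rule that[OF _ _ bound]) (use decay(1) c \<mu>(1) stable(1) k\<pi>(1) in \<open>auto intro!: add_pos_pos\<close>)
qed

lemma w_derivative: "((\<lambda>t. w t x) has_vector_derivative (A (\<pi> x) + G x)) (at_right 0)"
proof -
  have "((\<lambda>t. integral {0..t} (h x)) has_vector_derivative h x 0) (at 0 within {0..1})"
    by (rule integral_has_vector_derivative) (auto intro: continuous_on_subset[OF h_continuous])
  then have I: "((\<lambda>t. \<pi> x + integral {0..t} (h x)) has_vector_derivative h x 0) (at_right 0)"
    by (simp add: at_within_Icc_at_right has_vector_derivative_add_const add.commute[of "\<pi> x"])
  have "((\<lambda>t. w t x) has_vector_derivative E 0 (h x 0) + (K o\<^sub>L E 0) (\<pi> x + integral {0..0} (h x))) (at_right 0)"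
    unfolding w_def by (rule blinfun.has_vector_derivative[OF exp_blinfun_has_vector_derivative I])
  moreover have "E 0 (h x 0) + (K o\<^sub>L E 0) (\<pi> x + integral {0..0} (h x)) = A (\<pi> x) + G x"
    using C0_semigroupD(5)[OF sg] \<pi>(3)[OF \<pi>(2)] by (simp add: h_def K G.diff)
  ultimately show ?thesis by simp
qed

lemma w_0: "w 0 x = \<pi> x" by (simp add: w_def)

text \<open>
  As \<open>w\<close> is differentiable at 0 for every state \<open>x\<close>, only the part in \<open>ker \<pi>\<close> decides whether \<open>x\<close> belongs to the domain.
\<close>
lemma S_quotient:
  "((\<lambda>t. (S t x - x) /\<^sub>R t) \<longlongrightarrow> y) (at_right 0) \<longleftrightarrow>
   ((\<lambda>t. (T t (x - \<pi> x) - (x - \<pi> x)) /\<^sub>R t) \<longlongrightarrow> y - (A (\<pi> x) + G x)) (at_right 0)"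
proof -
  have w: "((\<lambda>t. (w t x - \<pi> x) /\<^sub>R t) \<longlongrightarrow> A (\<pi> x) + G x) (at_right 0)"
    using w_derivative[of x] unfolding has_vector_derivative_at_right_iff by (simp add: w_0)
  have eq: "(S t x - x) /\<^sub>R t = (w t x - \<pi> x) /\<^sub>R t + (T t (x - \<pi> x) - (x - \<pi> x)) /\<^sub>R t" for t
    by (simp add: S_def algebra_simps)
  show ?thesis
  proof
    assume "((\<lambda>t. (S t x - x) /\<^sub>R t) \<longlongrightarrow> y) (at_right 0)"
    from tendsto_diff[OF this w] show "((\<lambda>t. (T t (x - \<pi> x) - (x - \<pi> x)) /\<^sub>R t) \<longlongrightarrow> y - (A (\<pi> x) + G x)) (at_right 0)"
      unfolding eq by simp
  next
    assume "((\<lambda>t. (T t (x - \<pi> x) - (x - \<pi> x)) /\<^sub>R t) \<longlongrightarrow> y - (A (\<pi> x) + G x)) (at_right 0)"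
    from tendsto_add[OF w this] show "((\<lambda>t. (S t x - x) /\<^sub>R t) \<longlongrightarrow> y) (at_right 0)"
      unfolding eq by simp
  qed
qed

lemma C0_semigroup_S: "C0_semigroup JX UNIV S"
  unfolding C0_semigroup_def
proof (intro conjI allI impI ballI)
  fix t :: real assume t: "t \<ge> 0"
  obtain M \<mu> where M: "M > 0" "\<mu> > 0" "\<And>x t. t \<ge> 0 \<Longrightarrow> norm (S t x) \<le> M * exp (- \<mu> * t) * norm x"
    by (rule S_decay, rule that)
  then have "\<exists>M. \<forall>x. norm (S t x) \<le> M * norm x" using t by blast
  then show "S t \<in> bounded_ops JX JX UNIV UNIV"
    using S_linear[OF t] S_J[OF _ t] by (auto simp: bounded_ops_def)
next
  fix x
  show "S 0 x = x" by (simp add: S_def w_0 C0_semigroupD(5)[OF sg])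
  have "((\<lambda>t. w t x) \<longlongrightarrow> w 0 x) (at_right 0)"
    using has_vector_derivative_continuous[OF w_derivative[of x]] by (simp add: continuous_within)
  moreover have "((\<lambda>t. T t (x - \<pi> x)) \<longlongrightarrow> x - \<pi> x) (at_right 0)" by (rule C0_semigroupD(7)[OF sg]) simp
  ultimately have "((\<lambda>t. S t x) \<longlongrightarrow> w 0 x + (x - \<pi> x)) (at_right 0)"
    unfolding S_def by (rule tendsto_add)
  then show "((\<lambda>t. S t x) \<longlongrightarrow> x) (at_right 0)" by (simp add: w_0)
qed (rule S_add)

lemma D_iff: "x - \<pi> x \<in> D \<longleftrightarrow> x \<in> D" and A_split: "x \<in> D \<Longrightarrow> A x = A (\<pi> x) + A (x - \<pi> x)"
proof -
  note add = generator_add[OF gen subspace_UNIV]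
  note scale = generator_scale[OF gen subspace_UNIV]
  have \<pi>D: "\<pi> x \<in> D" using \<pi>(2) U(3) by blast
  show 1: "x - \<pi> x \<in> D \<longleftrightarrow> x \<in> D"
    using add[OF _ \<pi>D, of "x - \<pi> x"] add[of x "(-1) *\<^sub>R \<pi> x"] scale[OF \<pi>D, of "-1"] by auto
  show "A x = A (\<pi> x) + A (x - \<pi> x)" if "x \<in> D"
    using add[OF \<pi>D, of "x - \<pi> x"] 1 that by simp
qed

lemma generates_S: "generates JX UNIV D (\<lambda>x. A x + G x) S"
  unfolding generates_def
proof (intro conjI ballI)
  show "C0_semigroup JX UNIV S" by (rule C0_semigroup_S)
  show "((\<lambda>t. (S t x - x) /\<^sub>R t) \<longlongrightarrow> A x + G x) (at_right 0)" if "x \<in> D" for x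
  proof -
    have "((\<lambda>t. (T t (x - \<pi> x) - (x - \<pi> x)) /\<^sub>R t) \<longlongrightarrow> A (x - \<pi> x)) (at_right 0)"
      using D_iff that by (intro generates_D(3)[OF gen]) auto
    moreover have "A (x - \<pi> x) = A x + G x - (A (\<pi> x) + G x)" using A_split[OF that] by simp
    ultimately show ?thesis by (simp only: S_quotient)
  qed
  then show "D = {x \<in> UNIV. \<exists>y. ((\<lambda>t. (S t x - x) /\<^sub>R t) \<longlongrightarrow> y) (at_right 0)}"
    using S_quotient generates_D(4)[OF gen] D_iff by blast
qed

lemma exp_stable_S: "exp_stable UNIV S"
  unfolding exp_stable_def using S_decay by metis

lemma S_U: "x \<in> U \<Longrightarrow> t \<ge> 0 \<Longrightarrow> S t x \<in> U"
proof -
  assume x: "x \<in> U" and t: "t \<ge> 0"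
  have "S t x = w t x" using \<pi>(3)[OF x] linear_0[OF T_lin[OF t]] by (simp add: S_def)
  then show "S t x \<in> U" using w_U by simp
qed

end

section \<open>Lyapunov functions from output injection\<close>

text \<open>
  The function \<open>exp (a s) (v s - c / a)\<close> has a nonpositive upper right derivative.
\<close>
lemma Gronwall_upper_Dini:
  fixes v :: "real \<Rightarrow> real"
  assumes t: "0 \<le> t" and a: "a > 0" and cont: "continuous_on {0..t} v"
    and dini: "\<And>s e. 0 \<le> s \<Longrightarrow> s < t \<Longrightarrow> e > 0 \<Longrightarrow> \<forall>\<^sub>F h in at_right 0. v (s + h) \<le> v s + h * (- a * v s + c + e)"
  shows "v t \<le> exp (- a * t) * v 0 + (1 - exp (- a * t)) * (c / a)"
proof -
  define f where "f s = exp (a * s) * (v s - c / a)" for s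
  have "f t \<le> f 0"
  proof (rule nonincreasing_if_upper_Dini_nonpos[OF t])
    show "continuous_on {0..t} f" unfolding f_def by (intro continuous_intros cont)
    fix s e :: real assume s: "0 \<le> s" "s < t" and e: "e > 0"
    define u where "u = v s - c / a"
    \<comment> \<open>half of \<open>e\<close> pays for the growth of \<open>exp\<close> over the step \<open>h\<close>\<close>
    define e' where "e' = e * exp (- a * s) / 2"
    have e': "e' > 0" using e by (simp add: e'_def)
    define \<phi> where "\<phi> h = exp (a * h) * (u + h * (- a * u + e'))" for h
    have "(\<phi> has_real_derivative e') (at 0)"
      unfolding \<phi>_def by (auto intro!: derivative_eq_intros)
    then have "((\<lambda>h. (\<phi> (0 + h) - \<phi> 0) / h) \<longlongrightarrow> e') (at 0)" by (simp add: DERIV_def)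
    then have "((\<lambda>h. (\<phi> (0 + h) - \<phi> 0) / h) \<longlongrightarrow> e') (at_right 0)"
      by (rule tendsto_mono[rotated]) (simp add: at_le)
    then have "\<forall>\<^sub>F h in at_right 0. (\<phi> (0 + h) - \<phi> 0) / h < 2 * e'"
      by (rule order_tendstoD) (use e' in simp)
    moreover have "\<forall>\<^sub>F h in at_right 0. v (s + h) \<le> v s + h * (- a * v s + c + e')" by (rule dini[OF s e'])
    ultimately show "\<forall>\<^sub>F h in at_right 0. f (s + h) \<le> f s + e * h"
      using eventually_at_right_less[of "0::real"]
    proof eventually_elim
      case (elim h)
      have "v (s + h) - c / a \<le> u + h * (- a * u + e')"
        using elim(2) a by (simp add: u_def algebra_simps)
      then have "exp (a * h) * (v (s + h) - c / a) \<le> \<phi> h" by (simp add: \<phi>_def)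
      also have "\<phi> h \<le> u + 2 * e' * h" using elim(1,3) by (simp add: \<phi>_def pos_divide_less_eq)
      finally have "exp (a * s) * (exp (a * h) * (v (s + h) - c / a)) \<le> exp (a * s) * (u + 2 * e' * h)"
        by (intro mult_left_mono) auto
      then have "f (s + h) \<le> exp (a * s) * (u + 2 * e' * h)" by (simp add: f_def exp_add distrib_left mult.assoc)
      also have "\<dots> = f s + e * h" by (simp add: f_def u_def e'_def distrib_left exp_minus)
      finally show ?case .
    qed
  qed
  then have "v t - c / a \<le> exp (- a * t) * (v 0 - c / a)" by (simp add: f_def exp_minus field_simps)
  then show ?thesis by (simp add: algebra_simps)
qed

text \<open>
  A supremum of real numbers is meaningful only for bounded sets, which is what local boundedness of \<open>T\<close> provides.
\<close>
lemma max_output_bounds: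
  fixes T :: "real \<Rightarrow> 'x::real_normed_vector \<Rightarrow> 'x" and C :: "'x \<Rightarrow> 'y::real_normed_vector"
  assumes lb: "locally_bounded_on H T" and C: "bounded_linear C" and t: "t \<ge> 0"
  shows "\<And>x s. x \<in> H \<Longrightarrow> 0 \<le> s \<Longrightarrow> s \<le> t \<Longrightarrow> norm (C (T s x)) \<le> max_output T C t x"
    and "\<And>x m. (\<And>s. 0 \<le> s \<Longrightarrow> s \<le> t \<Longrightarrow> norm (C (T s x)) \<le> m) \<Longrightarrow> max_output T C t x \<le> m"
proof -
  obtain k where k: "k > 0" "\<And>x. norm (C x) \<le> norm x * k" using bounded_linear.pos_bounded[OF C] by blast
  obtain K where K: "K \<ge> 0" "\<And>s x. 0 \<le> s \<Longrightarrow> s \<le> t \<Longrightarrow> x \<in> H \<Longrightarrow> norm (T s x) \<le> K * norm x"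
    by (rule locally_bounded_onE[OF lb], rule that)
  show "norm (C (T s x)) \<le> max_output T C t x" if x: "x \<in> H" and s: "0 \<le> s" "s \<le> t" for x s
    unfolding max_output_def
  proof (rule cSUP_upper)
    show "bdd_above ((\<lambda>s. norm (C (T s x))) ` {0..t})"
    proof (rule bdd_aboveI2)
      fix s assume "s \<in> {0..t}"
      then show "norm (C (T s x)) \<le> (K * norm x) * k"
        using k(1) x by (intro order_trans[OF k(2)] mult_right_mono K(2)) auto
    qed
  qed (use s in auto)
  show "max_output T C t x \<le> m" if "\<And>s. 0 \<le> s \<Longrightarrow> s \<le> t \<Longrightarrow> norm (C (T s x)) \<le> m" for x m
    unfolding max_output_def by (rule cSUP_least) (use t that in auto)
qed

lemma linear_class_K: "c > 0 \<Longrightarrow> (\<lambda>r. c * r) \<in> class_K"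
  by (auto simp: class_K_def strict_mono_on_def intro!: continuous_intros)

lemma linear_class_K_inf:
  assumes c: "c > 0"
  shows "(\<lambda>r. c * r) \<in> class_K_inf"
proof -
  have "\<not> bdd_above ((\<lambda>r. c * r) ` {0..})"
  proof
    assume "bdd_above ((\<lambda>r. c * r) ` {0..})"
    then obtain m where m: "\<And>r. r \<ge> 0 \<Longrightarrow> c * r \<le> m" by (auto simp: bdd_above_def)
    from m[of "(\<bar>m\<bar> + 1) / c"] c show False by simp
  qed
  then show ?thesis using linear_class_K[OF c] by (simp add: class_K_inf_def)
qed

text \<open>
  The carrier \<open>H\<close> is the whole space or the unstable subspace. The generators of \<open>T\<close> and \<open>S\<close> have the
  same domain and differ by \<open>L C\<close>.
\<close>
locale output_injection =
  fixes JX :: "('x::banach \<Rightarrow> 'x) option" and H D :: "'x set" and A :: "'x \<Rightarrow> 'x"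
    and T S :: "real \<Rightarrow> 'x \<Rightarrow> 'x" and C :: "'x \<Rightarrow> 'y::banach" and L :: "'y \<Rightarrow> 'x" and M \<mu> :: real
  assumes H: "subspace H" "closed H"
    and genT: "generates JX H D A T" and genS: "generates JX H D (\<lambda>x. A x + L (C x)) S"
    and lb: "locally_bounded_on H T"
    and dense: "\<And>x. x \<in> H \<Longrightarrow> \<exists>z :: real \<Rightarrow> 'x. (\<forall>h>0. z h \<in> D) \<and> (z \<longlongrightarrow> x) (at_right 0)"
    and C: "bounded_linear C" and L: "bounded_linear L"
    and stable: "M > 0" "\<mu> > 0" "\<And>x t. x \<in> H \<Longrightarrow> t \<ge> 0 \<Longrightarrow> norm (S t x) \<le> M * exp (- \<mu> * t) * norm x"
begin

text \<open>An equivalent norm in which \<open>S\<close> decays with rate \<open>\<mu> / 2\<close> from time 0 on.\<close>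
definition V :: "'x \<Rightarrow> real" where
  "V x = (SUP t\<in>{0..}. exp (\<mu> / 2 * t) * norm (S t x))"

lemmas sgT = generates_D(1)[OF genT]
lemmas sgS = generates_D(1)[OF genS]

lemma weighted_bound:
  assumes "x \<in> H" "t \<ge> 0"
  shows "exp (\<mu> / 2 * t) * norm (S t x) \<le> M * norm x"
proof -
  have "exp (\<mu> / 2 * t) * norm (S t x) \<le> exp (\<mu> / 2 * t) * (M * exp (- \<mu> * t) * norm x)"
    by (intro mult_left_mono stable assms) auto
  also have "\<dots> = (M * norm x) * (exp (\<mu> / 2 * t) * exp (- \<mu> * t))" by (simp add: mult_ac)
  also have "exp (\<mu> / 2 * t) * exp (- \<mu> * t) = exp (- (\<mu> / 2 * t))" by (simp add: exp_add[symmetric])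
  also have "(M * norm x) * \<dots> \<le> (M * norm x) * 1"
    using stable assms by (intro mult_left_mono) auto
  finally show ?thesis by simp
qed

lemma V_upper: "x \<in> H \<Longrightarrow> t \<ge> 0 \<Longrightarrow> exp (\<mu> / 2 * t) * norm (S t x) \<le> V x"
  unfolding V_def by (intro cSUP_upper bdd_aboveI2[of _ _ "M * norm x"] weighted_bound) simp_all

lemma V_least: "(\<And>t. t \<ge> 0 \<Longrightarrow> exp (\<mu> / 2 * t) * norm (S t x) \<le> m) \<Longrightarrow> V x \<le> m"
  unfolding V_def by (rule cSUP_least) auto

lemma V_bounds: "x \<in> H \<Longrightarrow> norm x \<le> V x" "x \<in> H \<Longrightarrow> V x \<le> M * norm x"
  using V_upper[of x 0] C0_semigroupD(5)[OF sgS, of x] by (auto intro: V_least weighted_bound)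

lemma V_triangle:
  assumes "x \<in> H" "y \<in> H"
  shows "V (x + y) \<le> V x + V y"
proof (rule V_least)
  fix t :: real assume t: "t \<ge> 0"
  have "norm (S t (x + y)) \<le> norm (S t x) + norm (S t y)"
    using C0_semigroupD(2)[OF sgS t assms] norm_triangle_ineq by simp
  then have "exp (\<mu> / 2 * t) * norm (S t (x + y)) \<le> exp (\<mu> / 2 * t) * (norm (S t x) + norm (S t y))"
    by (intro mult_left_mono) auto
  then show "exp (\<mu> / 2 * t) * norm (S t (x + y)) \<le> V x + V y"
    using V_upper[OF assms(1) t] V_upper[OF assms(2) t] by (simp add: distrib_left)
qed

lemma V_Lipschitz:
  assumes "x \<in> H" "y \<in> H"
  shows "V x \<le> V y + M * norm (x - y)" "\<bar>V x - V y\<bar> \<le> M * norm (x - y)"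
proof -
  have *: "V x \<le> V y + M * norm (x - y)" if "x \<in> H" "y \<in> H" for x y
    using V_triangle[of y "x - y"] V_bounds(2)[of "x - y"] subspace_diff[OF H(1)] that by fastforce
  show "V x \<le> V y + M * norm (x - y)" by (rule *[OF assms])
  then show "\<bar>V x - V y\<bar> \<le> M * norm (x - y)"
    using *[OF assms(2,1)] by (simp add: norm_minus_commute abs_le_iff)
qed

lemma V_tendsto:
  assumes z: "(z \<longlongrightarrow> x) F" "x \<in> H" "\<forall>\<^sub>F h in F. z h \<in> H"
  shows "((\<lambda>h. V (z h)) \<longlongrightarrow> V x) F"
proof -
  have "((\<lambda>h. V (z h) - V x) \<longlongrightarrow> 0) F"
  proof (rule Lim_null_comparison)
    show "\<forall>\<^sub>F h in F. norm (V (z h) - V x) \<le> M * norm (z h - x)"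
      using z(3) by eventually_elim (simp add: V_Lipschitz(2) z(2))
    have "((\<lambda>h. M * norm (z h - x)) \<longlongrightarrow> M * norm (x - x)) F" by (intro tendsto_intros z(1))
    then show "((\<lambda>h. M * norm (z h - x)) \<longlongrightarrow> 0) F" by simp
  qed
  then show ?thesis by (simp add: Lim_null[symmetric])
qed

lemma V_contraction:
  assumes "x \<in> H" "h \<ge> 0"
  shows "V (S h x) \<le> exp (- (\<mu> / 2) * h) * V x"
proof (rule V_least)
  fix t :: real assume t: "t \<ge> 0"
  have "exp (\<mu> / 2 * (t + h)) * norm (S (t + h) x) \<le> V x" using t assms by (intro V_upper) auto
  then have "exp (- (\<mu> / 2) * h) * (exp (\<mu> / 2 * (t + h)) * norm (S (t + h) x)) \<le> exp (- (\<mu> / 2) * h) * V x"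
    by (intro mult_left_mono) auto
  moreover have "exp (- (\<mu> / 2) * h) * exp (\<mu> / 2 * (t + h)) = exp (\<mu> / 2 * t)"
    by (simp add: exp_add[symmetric] algebra_simps)
  moreover have "S (t + h) x = S t (S h x)" by (rule C0_semigroupD(6)[OF sgS t assms(2,1)])
  ultimately show "exp (\<mu> / 2 * t) * norm (S t (S h x)) \<le> exp (- (\<mu> / 2) * h) * V x"
    by (metis mult.assoc)
qed

lemma orbit_V_continuous:
  assumes "x \<in> H"
  shows "continuous_on {0..} (\<lambda>t. V (T t x))"
proof -
  have "((\<lambda>t. V (T t x)) \<longlongrightarrow> V (T t0 x)) (at t0 within {0..})" if "t0 \<in> {0..}" for t0
  proof (rule V_tendsto)
    show "((\<lambda>t. T t x) \<longlongrightarrow> T t0 x) (at t0 within {0..})"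
      using orbit_continuous[OF sgT H(1) lb assms] that by (simp add: continuous_on_def)
    show "T t0 x \<in> H" using C0_semigroupD(1)[OF sgT _ assms] that by simp
    show "\<forall>\<^sub>F t in at t0 within {0..}. T t x \<in> H"
      using C0_semigroupD(1)[OF sgT _ assms] by (auto simp: eventually_at_filter intro: always_eventually)
  qed
  then show ?thesis by (simp add: continuous_on_def)
qed

definition gain :: real where "gain = M * onorm L"

lemma gain: "gain \<ge> 0" "M * norm (L y) \<le> gain * norm y"
proof -
  show "gain \<ge> 0" using stable(1) onorm_pos_le[OF L] by (simp add: gain_def)
  show "M * norm (L y) \<le> gain * norm y"
    using mult_left_mono[OF onorm[OF L, of y], of M] stable(1) by (simp add: gain_def mult_ac)
qed

text \<open>
  For a state \<open>x\<close> in the domain, \<open>T h x\<close> and \<open>S h x\<close> differ by \<open>h L C x\<close> to first order. As \<open>S\<close> contracts \<open>V\<close>, this yields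
  \<open>V' \<le> - (\<mu> / 2) V + gain max \<parallel>y\<parallel>\<close> along \<open>T\<close>, which takes the place of the variation of constants formula.
\<close>
lemma V_estimate_domain:
  assumes z: "z \<in> D" and t: "t \<ge> 0"
  shows "V (T t z) \<le> exp (- (\<mu> / 2) * t) * V z + (1 - exp (- (\<mu> / 2) * t)) * (gain * max_output T C t z / (\<mu> / 2))"
proof -
  have zH: "z \<in> H" using z generates_D(2)[OF genT] by blast
  have "V (T t z) \<le> exp (- (\<mu> / 2) * t) * V (T 0 z) + (1 - exp (- (\<mu> / 2) * t)) * (gain * max_output T C t z / (\<mu> / 2))"
  proof (rule Gronwall_upper_Dini[OF t])
    show "\<mu> / 2 > 0" using stable(2) by simp
    show "continuous_on {0..t} (\<lambda>s. V (T s z))"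
      by (rule continuous_on_subset[OF orbit_V_continuous[OF zH]]) auto
    fix s e :: real assume s: "0 \<le> s" "s < t" and e: "e > 0"
    define x where "x = T s z"
    have xD: "x \<in> D" unfolding x_def using generator_domain_invariant[OF genT H z s(1)] by blast
    have xH: "x \<in> H" using xD generates_D(2)[OF genT] by blast
    have Cx: "norm (C x) \<le> max_output T C t z"
      unfolding x_def using max_output_bounds(1)[OF lb C t zH] s by simp
    define d where "d h = norm ((T h x - x) /\<^sub>R h - (S h x - x) /\<^sub>R h)" for h
    have "(d \<longlongrightarrow> norm (A x - (A x + L (C x)))) (at_right 0)"
      unfolding d_def by (intro tendsto_norm tendsto_diff generates_D(3)[OF genT xD] generates_D(3)[OF genS xD])
    then have d: "(d \<longlongrightarrow> norm (L (C x))) (at_right 0)" by simp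
    have "((\<lambda>h. (exp (- (\<mu> / 2) * h) - 1) / h * V x + M * d h) \<longlongrightarrow> - (\<mu> / 2) * V x + M * norm (L (C x))) (at_right 0)"
      by (intro tendsto_intros exp_right_difference_quotient d)
    moreover have "- (\<mu> / 2) * V x + M * norm (L (C x)) < - (\<mu> / 2) * V x + gain * max_output T C t z + e"
      using gain(2)[of "C x"] mult_left_mono[OF Cx gain(1)] e by simp
    ultimately have "\<forall>\<^sub>F h in at_right 0. (exp (- (\<mu> / 2) * h) - 1) / h * V x + M * d h < - (\<mu> / 2) * V x + gain * max_output T C t z + e"
      by (rule order_tendstoD)
    then show "\<forall>\<^sub>F h in at_right 0. V (T (s + h) z) \<le> V (T s z) + h * (- (\<mu> / 2) * V (T s z) + gain * max_output T C t z + e)"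
      using eventually_at_right_less[of "0::real"]
    proof eventually_elim
      case (elim h)
      have TH: "T h x \<in> H" "S h x \<in> H" using C0_semigroupD(1)[OF sgT _ xH] C0_semigroupD(1)[OF sgS _ xH] elim(2) by auto
      have "T h x - S h x = h *\<^sub>R ((T h x - x) /\<^sub>R h - (S h x - x) /\<^sub>R h)"
        using elim(2) by (simp add: scaleR_diff_right[symmetric])
      then have n: "norm (T h x - S h x) = h * d h" unfolding d_def using elim(2) by (metis abs_of_pos norm_scaleR)
      have "V (T h x) \<le> V (S h x) + M * norm (T h x - S h x)" by (rule V_Lipschitz(1)[OF TH])
      also have "\<dots> \<le> exp (- (\<mu> / 2) * h) * V x + M * (h * d h)"
        unfolding n using V_contraction[OF xH] elim(2) by simp
      also have "\<dots> = V x + h * ((exp (- (\<mu> / 2) * h) - 1) / h * V x + M * d h)"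
        using elim(2) by (simp add: field_simps)
      also have "\<dots> \<le> V x + h * (- (\<mu> / 2) * V x + gain * max_output T C t z + e)"
        using elim by (intro add_left_mono mult_left_mono) auto
      finally have "V (T h x) \<le> V x + h * (- (\<mu> / 2) * V x + gain * max_output T C t z + e)" .
      moreover have "T (s + h) z = T h x"
        unfolding x_def using C0_semigroupD(6)[OF sgT _ s(1) zH, of h] elim(2) by (simp add: add.commute)
      ultimately show ?case by (simp add: x_def)
    qed
  qed
  then show ?thesis using C0_semigroupD(5)[OF sgT zH] by simp
qed

text \<open>
  By density of the domain, since both sides depend continuously on the initial state.
\<close>
lemma V_estimate:
  assumes x: "x \<in> H" and t: "t \<ge> 0"
  shows "V (T t x) \<le> exp (- (\<mu> / 2) * t) * V x + (1 - exp (- (\<mu> / 2) * t)) * (gain * max_output T C t x / (\<mu> / 2))"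
proof -
  obtain z :: "real \<Rightarrow> 'x" where z: "\<And>h. h > 0 \<Longrightarrow> z h \<in> D" "(z \<longlongrightarrow> x) (at_right 0)"
    using dense[OF x] by blast
  have zD: "\<forall>\<^sub>F h in at_right 0. z h \<in> D"
    using eventually_at_right_less[of "0::real"] by eventually_elim (rule z(1))
  then have zH: "\<forall>\<^sub>F h in at_right 0. z h \<in> H"
    by eventually_elim (use generates_D(2)[OF genT] in blast)
  obtain k where k: "k > 0" "\<And>x. norm (C x) \<le> norm x * k" using bounded_linear.pos_bounded[OF C] by blast
  obtain K where K: "K \<ge> 0" "\<And>s x. 0 \<le> s \<Longrightarrow> s \<le> t \<Longrightarrow> x \<in> H \<Longrightarrow> norm (T s x) \<le> K * norm x"
    by (rule locally_bounded_onE[OF lb], rule that)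
  define m where "m h = max_output T C t x + K * norm (z h - x) * k" for h
  have m: "max_output T C t (z h) \<le> m h" if "z h \<in> H" for h
  proof (rule max_output_bounds(2)[OF lb C t])
    fix s assume s: "0 \<le> s" "s \<le> t"
    have "T s (z h) = T s x + T s (z h - x)" using C0_semigroup_diff[OF sgT H(1) s(1) that x] by simp
    then have "norm (C (T s (z h))) \<le> norm (C (T s x)) + norm (C (T s (z h - x)))"
      by (simp add: linear_add[OF bounded_linear.linear[OF C]] norm_triangle_ineq)
    also have "\<dots> \<le> max_output T C t x + K * norm (z h - x) * k"
      using s k(1) x that H(1)
      by (intro add_mono max_output_bounds(1)[OF lb C t] order_trans[OF k(2)] mult_right_mono K(2) subspace_diff) auto
    finally show "norm (C (T s (z h))) \<le> m h" by (simp add: m_def)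
  qed
  have "(m \<longlongrightarrow> max_output T C t x + K * norm (x - x) * k) (at_right 0)"
    unfolding m_def by (intro tendsto_intros z(2))
  then have m_lim: "(m \<longlongrightarrow> max_output T C t x) (at_right 0)" by simp
  show ?thesis
  proof (rule tendsto_le[of "at_right (0::real)"])
    show "((\<lambda>h. V (T t (z h))) \<longlongrightarrow> V (T t x)) (at_right 0)"
    proof (rule V_tendsto)
      show "((\<lambda>h. T t (z h)) \<longlongrightarrow> T t x) (at_right 0)"
        by (rule semigroup_continuous[OF sgT H(1) t z(2) x zH])
      show "\<forall>\<^sub>F h in at_right 0. T t (z h) \<in> H"
        using zH by eventually_elim (rule C0_semigroupD(1)[OF sgT t])
    qed (rule C0_semigroupD(1)[OF sgT t x])
    show "((\<lambda>h. exp (- (\<mu> / 2) * t) * V (z h) + (1 - exp (- (\<mu> / 2) * t)) * (gain * m h / (\<mu> / 2))) \<longlongrightarrow>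
        exp (- (\<mu> / 2) * t) * V x + (1 - exp (- (\<mu> / 2) * t)) * (gain * max_output T C t x / (\<mu> / 2))) (at_right 0)"
      using stable(2) by (intro tendsto_intros m_lim V_tendsto z(2) x zH) auto
    show "\<forall>\<^sub>F h in at_right 0. V (T t (z h)) \<le> exp (- (\<mu> / 2) * t) * V (z h) + (1 - exp (- (\<mu> / 2) * t)) * (gain * m h / (\<mu> / 2))"
      using zD zH
    proof eventually_elim
      case (elim h)
      have "V (T t (z h)) \<le> exp (- (\<mu> / 2) * t) * V (z h) + (1 - exp (- (\<mu> / 2) * t)) * (gain * max_output T C t (z h) / (\<mu> / 2))"
        by (rule V_estimate_domain[OF elim(1) t])
      also have "\<dots> \<le> exp (- (\<mu> / 2) * t) * V (z h) + (1 - exp (- (\<mu> / 2) * t)) * (gain * m h / (\<mu> / 2))"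
        using stable(2) t gain(1) m[OF elim(2)] by (intro add_left_mono mult_left_mono divide_right_mono) auto
      finally show ?case .
    qed
  qed simp
qed

lemma eOSS_linear_gain_T: "eOSS_linear_gain H T C"
proof -
  define c where "c = gain / (\<mu> / 2) + 1"
  have c: "c > 0" using gain(1) stable(2) by (simp add: c_def add_nonneg_pos)
  have "norm (T t x) \<le> M * exp (- (\<mu> / 2) * t) * norm x + c * max_output T C t x" if x: "x \<in> H" and t: "t \<ge> 0" for x t
  proof -
    have mo: "max_output T C t x \<ge> 0"
      using max_output_bounds(1)[OF lb C t x, of 0] t norm_ge_zero order_trans by blast
    have "norm (T t x) \<le> V (T t x)" by (rule V_bounds(1)[OF C0_semigroupD(1)[OF sgT t x]])
    also have "\<dots> \<le> exp (- (\<mu> / 2) * t) * V x + (1 - exp (- (\<mu> / 2) * t)) * (gain * max_output T C t x / (\<mu> / 2))"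
      by (rule V_estimate[OF x t])
    also have "\<dots> \<le> exp (- (\<mu> / 2) * t) * (M * norm x) + 1 * (gain * max_output T C t x / (\<mu> / 2))"
      using V_bounds(2)[OF x] mo gain(1) stable(2) by (intro add_mono mult_left_mono mult_right_mono) auto
    also have "\<dots> \<le> M * exp (- (\<mu> / 2) * t) * norm x + c * max_output T C t x"
      using mo by (simp add: c_def algebra_simps)
    finally show ?thesis .
  qed
  then have "eOSS_gain H T C (\<lambda>r. c * r)"
    unfolding eOSS_gain_def using linear_class_K[OF c] stable by (intro conjI exI[of _ M] exI[of _ "\<mu> / 2"]) auto
  then show ?thesis unfolding eOSS_linear_gain_def linear_gain_def by blast
qed

text \<open>
  For short times the maximum of the output is close to \<open>norm (C x)\<close>, by continuity of the orbit at 0.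
\<close>
lemma lie_derivative_V:
  assumes x: "x \<in> H"
  shows "lie_derivative T V x \<le> ereal (- (\<mu> / 2) * norm x + gain * norm (C x))"
proof -
  have le: "lie_derivative T V x \<le> ereal (- (\<mu> / 2) * V x + gain * (norm (C x) + e))" if e: "e > 0" for e
  proof -
    have "((\<lambda>h. norm (C (T h x))) \<longlongrightarrow> norm (C x)) (at_right 0)"
      by (intro tendsto_norm bounded_linear.tendsto[OF C] C0_semigroupD(7)[OF sgT x])
    then have "\<forall>\<^sub>F h in at_right 0. norm (C (T h x)) < norm (C x) + e"
      by (rule order_tendstoD) (use e in simp)
    then obtain b where b: "b > 0" "\<And>h. 0 < h \<Longrightarrow> h < b \<Longrightarrow> norm (C (T h x)) < norm (C x) + e"
      by (auto simp: eventually_at_right_field)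
    have mo: "max_output T C h x \<le> norm (C x) + e" if "0 < h" "h < b" for h
    proof (rule max_output_bounds(2)[OF lb C])
      fix s assume s: "0 \<le> s" "s \<le> h"
      show "norm (C (T s x)) \<le> norm (C x) + e"
      proof (cases "s = 0")
        case True
        then show ?thesis using C0_semigroupD(5)[OF sgT x] e by simp
      next
        case False
        then show ?thesis using b(2)[of s] s that by simp
      qed
    qed (use that in simp)
    define g where "g h = (exp (- (\<mu> / 2) * h) - 1) / h * (V x - gain * (norm (C x) + e) / (\<mu> / 2))" for h
    have "(g \<longlongrightarrow> - (\<mu> / 2) * (V x - gain * (norm (C x) + e) / (\<mu> / 2))) (at_right 0)"
      unfolding g_def by (intro tendsto_intros exp_right_difference_quotient)
    moreover have "- (\<mu> / 2) * (V x - gain * (norm (C x) + e) / (\<mu> / 2)) = - (\<mu> / 2) * V x + gain * (norm (C x) + e)"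
      using stable(2) by (simp add: field_simps)
    ultimately have g: "((\<lambda>h. ereal (g h)) \<longlongrightarrow> ereal (- (\<mu> / 2) * V x + gain * (norm (C x) + e))) (at_right 0)"
      by simp
    have "\<forall>\<^sub>F h in at_right 0. h \<in> {0<..<b}" using b(1) by (rule eventually_at_right_real)
    then have "\<forall>\<^sub>F h in at_right 0. ereal ((V (T h x) - V x) / h) \<le> ereal (g h)"
    proof eventually_elim
      case (elim h)
      have "V (T h x) \<le> exp (- (\<mu> / 2) * h) * V x + (1 - exp (- (\<mu> / 2) * h)) * (gain * max_output T C h x / (\<mu> / 2))"
        using elim by (intro V_estimate[OF x]) auto
      also have "\<dots> \<le> exp (- (\<mu> / 2) * h) * V x + (1 - exp (- (\<mu> / 2) * h)) * (gain * (norm (C x) + e) / (\<mu> / 2))"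
        using stable(2) elim gain(1) mo by (intro add_left_mono mult_left_mono divide_right_mono) auto
      finally have "V (T h x) - V x \<le> (exp (- (\<mu> / 2) * h) - 1) * (V x - gain * (norm (C x) + e) / (\<mu> / 2))"
        by (simp only: left_diff_distrib right_diff_distrib)
      also have "\<dots> = h * g h" using elim by (simp add: g_def)
      finally have "V (T h x) - V x \<le> h * g h" .
      then have "(V (T h x) - V x) / h \<le> g h" using elim by (simp add: pos_divide_le_eq mult.commute)
      then show ?case by simp
    qed
    then have "lie_derivative T V x \<le> Limsup (at_right 0) (\<lambda>h. ereal (g h))"
      unfolding lie_derivative_def by (rule Limsup_mono)
    also have "\<dots> = ereal (- (\<mu> / 2) * V x + gain * (norm (C x) + e))"
      by (rule lim_imp_Limsup[OF _ g]) simp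
    finally show ?thesis .
  qed
  have "lie_derivative T V x \<le> ereal (- (\<mu> / 2) * V x + gain * norm (C x))"
  proof (rule ereal_le_epsilon2)
    fix e :: real assume e: "e > 0"
    have "lie_derivative T V x \<le> ereal (- (\<mu> / 2) * V x + gain * (norm (C x) + e / (gain + 1)))"
      using e gain(1) by (intro le) simp
    also have "\<dots> \<le> ereal (- (\<mu> / 2) * V x + gain * norm (C x)) + ereal e"
      using e gain(1) by (simp add: distrib_left pos_divide_le_eq)
    finally show "lie_derivative T V x \<le> ereal (- (\<mu> / 2) * V x + gain * norm (C x)) + ereal e" .
  qed
  also have "\<dots> \<le> ereal (- (\<mu> / 2) * norm x + gain * norm (C x))"
    using V_bounds(1)[OF x] stable(2) by simp
  finally show ?thesis .
qed

lemma Lyapunov_dissipation: "\<exists>V \<sigma>. linear_gain \<sigma> \<and> eOSS_Lyapunov_dissipation H T C V \<sigma>"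
proof (intro exI conjI)
  show "linear_gain (\<lambda>r. (gain + 1) * r)" by (auto simp: linear_gain_def)
  show "eOSS_Lyapunov_dissipation H T C V (\<lambda>r. (gain + 1) * r)"
    unfolding eOSS_Lyapunov_dissipation_def
  proof (intro conjI exI ballI)
    show "(\<lambda>r. (gain + 1) * r) \<in> class_K_inf" using gain(1) by (intro linear_class_K_inf) simp
    show "(0::real) < 1" "0 < M" "(0::real) < 1" "0 < \<mu> / 2" using stable by auto
    fix x assume x: "x \<in> H"
    show "V x \<ge> 0" using V_bounds(1)[OF x] norm_ge_zero order_trans by blast
    show "continuous_on {0..} (\<lambda>t. V (T t x))" by (rule orbit_V_continuous[OF x])
    show "1 * norm x powr 1 \<le> V x" "V x \<le> M * norm x powr 1" using V_bounds[OF x] by auto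
    have "lie_derivative T V x \<le> ereal (- (\<mu> / 2) * norm x + gain * norm (C x))" by (rule lie_derivative_V[OF x])
    also have "\<dots> \<le> ereal (- (\<mu> / 2) * norm x powr 1 + (gain + 1) * norm (C x))" by (simp add: distrib_right)
    finally show "lie_derivative T V x \<le> ereal (- (\<mu> / 2) * norm x powr 1 + (gain + 1) * norm (C x))" .
  qed
qed

text \<open>
  With \<open>p = 1\<close> the dissipation inequality is homogeneous, so a linear \<open>\<kappa>\<close> with a large enough slope lets half of
  the decay absorb the output term.
\<close>
lemma Lyapunov_implication: "\<exists>V \<kappa>. linear_gain \<kappa> \<and> eOSS_Lyapunov_implication H T C V \<kappa>"
proof (intro exI conjI)
  define c where "c = (gain + 1) / (\<mu> / 4)"
  have c: "c > 0" using gain(1) stable(2) by (simp add: c_def)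
  show "linear_gain (\<lambda>r. c * r)" by (auto simp: linear_gain_def)
  show "eOSS_Lyapunov_implication H T C V (\<lambda>r. c * r)"
    unfolding eOSS_Lyapunov_implication_def
  proof (intro conjI exI ballI impI)
    show "(\<lambda>r. c * r) \<in> class_K_inf" by (rule linear_class_K_inf[OF c])
    show "(0::real) < 1" "0 < M" "(0::real) < 1" "0 < \<mu> / 4" using stable by auto
    fix x assume x: "x \<in> H"
    show "V x \<ge> 0" using V_bounds(1)[OF x] norm_ge_zero order_trans by blast
    show "continuous_on {0..} (\<lambda>t. V (T t x))" by (rule orbit_V_continuous[OF x])
    show "1 * norm x powr 1 \<le> V x" "V x \<le> M * norm x powr 1" using V_bounds[OF x] by auto
    assume "c * norm (C x) \<le> norm x"
    then have "(gain + 1) * norm (C x) \<le> (\<mu> / 4) * norm x" using stable(2) by (simp add: c_def field_simps)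
    moreover have "gain * norm (C x) \<le> (gain + 1) * norm (C x)" by (simp add: distrib_right)
    ultimately have "- (\<mu> / 2) * norm x + gain * norm (C x) \<le> - (\<mu> / 4) * norm x" by simp
    then show "lie_derivative T V x \<le> ereal (- (\<mu> / 4) * norm x powr 1)"
      using lie_derivative_V[OF x] by (simp add: order_trans)
  qed
qed

end

section \<open>States without output\<close>

lemma max_output_zero:
  assumes "\<And>s. s \<ge> 0 \<Longrightarrow> C (T s x) = 0" "t \<ge> 0"
  shows "max_output T C t x = 0"
proof -
  have "(\<lambda>s. norm (C (T s x))) ` {0..t} = {0}" using assms by (auto intro!: image_eqI[of _ _ 0])
  then show ?thesis by (simp add: max_output_def)
qed

text \<open>
  The decay term \<open>M exp (- \<mu> t) r\<close> is of class \<open>KL\<close>.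
\<close>
lemma eOSS_gain_imp_OSS_gain:
  assumes "eOSS_gain H T C \<gamma>"
  shows "OSS_gain H T C \<gamma>"
proof -
  obtain M \<mu> where M: "M > 0" "\<mu> > 0" and \<gamma>: "\<gamma> \<in> class_K"
    and est: "\<forall>x\<in>H. \<forall>t\<ge>0. norm (T t x) \<le> M * exp (- \<mu> * t) * norm x + \<gamma> (max_output T C t x)"
    using assms by (auto simp: eOSS_gain_def)
  define \<beta> where "\<beta> r t = M * exp (- \<mu> * t) * r" for r t
  have "\<beta> r \<in> class_L" if r: "r > 0" for r
  proof -
    have "((\<lambda>t. M * exp (- \<mu> * t) * r) \<longlongrightarrow> M * 0 * r) at_top"
      using M by (intro tendsto_intros exp_decay_tendsto_0)
    moreover have "\<beta> r = (\<lambda>t. M * exp (- \<mu> * t) * r)" by (simp add: \<beta>_def fun_eq_iff)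
    ultimately show ?thesis using M r by (auto simp: class_L_def intro!: continuous_intros)
  qed
  moreover have "(\<lambda>r. \<beta> r t) \<in> class_K" for t
    unfolding \<beta>_def by (rule linear_class_K) (use M in simp)
  moreover have "continuous_on ({0..} \<times> {0..}) (\<lambda>(r, t). \<beta> r t)"
    unfolding \<beta>_def case_prod_unfold by (intro continuous_intros)
  ultimately have "\<beta> \<in> class_KL" by (simp add: class_KL_def)
  moreover have "\<forall>x\<in>H. \<forall>t\<ge>0. norm (T t x) \<le> \<beta> (norm x) t + \<gamma> (max_output T C t x)"
    using est unfolding \<beta>_def .
  ultimately show ?thesis unfolding OSS_gain_def using \<gamma> by blast
qed

lemma eOSS_imp_exp_zero_detectable:
  assumes "eOSS H T C"
  shows "exp_zero_detectable H T C"
proof -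
  obtain \<gamma> M \<mu> where M: "M > 0" "\<mu> > 0" and \<gamma>: "\<gamma> \<in> class_K"
    and est: "\<forall>x\<in>H. \<forall>t\<ge>0. norm (T t x) \<le> M * exp (- \<mu> * t) * norm x + \<gamma> (max_output T C t x)"
    using assms by (auto simp: eOSS_def eOSS_gain_def)
  have \<gamma>0: "\<gamma> 0 = 0" using \<gamma> by (simp add: class_K_def)
  have "norm (T t x) \<le> M * exp (- \<mu> * t) * norm x"
    if "x \<in> H" "\<forall>t\<ge>0. C (T t x) = 0" "t \<ge> 0" for x t
    using est max_output_zero[of C T x t] that \<gamma>0 by fastforce
  then show ?thesis unfolding exp_zero_detectable_def using M by blast
qed

text \<open>
  On the subspace \<open>N\<close> of states without output the estimate can be rescaled to \<open>\<parallel>T t x\<parallel> \<le> \<beta> 1 t \<parallel>x\<parallel>\<close>. As \<open>\<beta> 1\<close>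
  tends to 0, norms are halved after some time \<open>t0\<close>, uniformly on \<open>N\<close>, and the rate is \<open>ln 2 / t0\<close>.
\<close>
lemma OSS_imp_exp_zero_detectable:
  assumes sg: "C0_semigroup JX H T" and H: "subspace H" and C: "bounded_linear C" and OSS: "OSS H T C"
  shows "exp_zero_detectable H T C"
proof -
  obtain \<gamma> \<beta> where \<gamma>: "\<gamma> \<in> class_K" and \<beta>: "\<beta> \<in> class_KL"
    and est: "\<forall>x\<in>H. \<forall>t\<ge>0. norm (T t x) \<le> \<beta> (norm x) t + \<gamma> (max_output T C t x)"
    using OSS by (auto simp: OSS_def OSS_gain_def)
  have \<gamma>0: "\<gamma> 0 = 0" using \<gamma> by (simp add: class_K_def)
  define N where "N = {x \<in> H. \<forall>t\<ge>0. C (T t x) = 0}"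
  have N_T: "T t x \<in> N" if "x \<in> N" "t \<ge> 0" for x t
    using that C0_semigroupD(1)[OF sg] C0_semigroupD(6)[OF sg, of _ t x] by (auto simp: N_def) (metis add_nonneg_nonneg)
  have uniform: "norm (T t x) \<le> \<beta> 1 t * norm x" if x: "x \<in> N" and t: "t \<ge> 0" for x t
  proof (cases "x = 0")
    case True
    have "T t 0 = 0" using C0_semigroupD(3)[OF sg t, of 0 0] subspace_0[OF H] by simp
    then show ?thesis using True by simp
  next
    case False
    define y where "y = (1 / norm x) *\<^sub>R x"
    have xH: "x \<in> H" using x by (simp add: N_def)
    have yT: "T s y = (1 / norm x) *\<^sub>R T s x" if "s \<ge> 0" for s
      unfolding y_def by (rule C0_semigroupD(3)[OF sg that xH])
    have Cy: "C (T s y) = 0" if "s \<ge> 0" for s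
      using x that by (simp add: yT N_def linear_cmul[OF bounded_linear.linear[OF C]])
    have "max_output T C t y = 0" by (rule max_output_zero[of C T y t, OF Cy t])
    moreover have "norm y = 1" using False by (simp add: y_def)
    moreover have "y \<in> H" using subspace_scale[OF H xH] by (simp add: y_def)
    ultimately have "norm (T t y) \<le> \<beta> 1 t" using est t \<gamma>0 by fastforce
    then show ?thesis using yT[OF t] False by (simp add: field_simps)
  qed
  have L1: "\<beta> 1 \<in> class_L" using \<beta> by (simp add: class_KL_def)
  then have "(\<beta> 1 \<longlongrightarrow> 0) at_top" by (simp add: class_L_def)
  then have "\<forall>\<^sub>F t in at_top. \<beta> 1 t < 1 / 2" by (rule order_tendstoD) simp
  then obtain t1 where t1: "\<And>t. t \<ge> t1 \<Longrightarrow> \<beta> 1 t < 1 / 2" by (auto simp: eventually_at_top_linorder)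
  define t0 where "t0 = max t1 1"
  have t0: "t0 > 0" "\<beta> 1 t0 \<le> 1 / 2" using t1[of t0] by (auto simp: t0_def)
  define b where "b = \<beta> 1 0"
  have b: "\<beta> 1 t \<le> b" "b \<ge> 0" if "t \<ge> 0" for t
    using L1 that by (cases "t = 0"; force simp: class_L_def b_def less_imp_le)+
  have halving: "norm (T (real n * t0) x) \<le> (1 / 2) ^ n * norm x" if "x \<in> N" for n x
    using that
  proof (induction n)
    case 0
    then show ?case using C0_semigroupD(5)[OF sg] by (simp add: N_def)
  next
    case (Suc n)
    have nt: "real n * t0 \<ge> 0" using t0(1) by simp
    have "T (real (Suc n) * t0) x = T t0 (T (real n * t0) x)"
      using C0_semigroupD(6)[OF sg _ nt, of t0 x] t0(1) Suc.prems by (simp add: N_def algebra_simps)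
    then have "norm (T (real (Suc n) * t0) x) \<le> \<beta> 1 t0 * norm (T (real n * t0) x)"
      using uniform[OF N_T[OF Suc.prems nt], of t0] t0(1) by simp
    also have "\<dots> \<le> 1 / 2 * ((1 / 2) ^ n * norm x)"
      using t0(2) Suc by (intro mult_mono) auto
    finally show ?case by simp
  qed
  define \<omega> where "\<omega> = ln 2 / t0"
  have \<omega>: "\<omega> > 0" using t0(1) by (simp add: \<omega>_def)
  have "norm (T t x) \<le> (2 * b + 1) * exp (- \<omega> * t) * norm x" if x: "x \<in> N" and t: "t \<ge> 0" for x t
  proof -
    define n where "n = nat \<lfloor>t / t0\<rfloor>"
    define r where "r = t - real n * t0"
    have "real n = of_int \<lfloor>t / t0\<rfloor>" using t t0(1) by (simp add: n_def)
    then have n: "real n \<le> t / t0" "t / t0 < real n + 1" by linarith+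
    then have r: "r \<ge> 0" and n': "t \<le> (real n + 1) * t0" using t0(1) by (auto simp: r_def field_simps)
    have nt: "real n * t0 \<ge> 0" using t0(1) by simp
    have "T t x = T r (T (real n * t0) x)"
      using C0_semigroupD(6)[OF sg r nt, of x] x by (simp add: N_def r_def)
    then have "norm (T t x) \<le> b * norm (T (real n * t0) x)"
      using uniform[OF N_T[OF x nt] r] mult_right_mono[OF b(1)[OF r] norm_ge_zero] by (metis order_trans)
    also have "\<dots> \<le> b * ((1 / 2) ^ n * norm x)" using b(2)[OF r] halving[OF x] by (intro mult_left_mono) auto
    also have "(1 / 2) ^ n \<le> 2 * exp (- \<omega> * t)"
    proof -
      have "\<omega> * t \<le> \<omega> * ((real n + 1) * t0)" using \<omega> n' by (intro mult_left_mono) auto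
      also have "\<dots> = real n * ln 2 + ln 2" using t0(1) by (simp add: \<omega>_def field_simps)
      finally have "exp (\<omega> * t) \<le> exp (real n * ln 2 + ln 2)" by simp
      also have "\<dots> = 2 ^ n * 2" by (simp add: exp_add exp_of_nat_mult)
      finally show ?thesis by (simp add: exp_minus power_one_over field_simps)
    qed
    then have "b * ((1 / 2) ^ n * norm x) \<le> b * ((2 * exp (- \<omega> * t)) * norm x)"
      using b(2)[OF r] by (intro mult_left_mono mult_right_mono) auto
    also have "\<dots> \<le> (2 * b + 1) * exp (- \<omega> * t) * norm x" by (simp add: algebra_simps)
    finally show ?thesis .
  qed
  then show ?thesis
    unfolding exp_zero_detectable_def using b(2)[of 0] \<omega>
    by (intro exI[of _ "2 * b + 1"] conjI exI[of _ \<omega>]) (auto simp: N_def)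
qed

text \<open>
  Along the orbit \<open>V' \<le> - (\<alpha> / k2) V\<close>; taking roots of order \<open>p\<close> divides the rate by \<open>p\<close>.
\<close>
lemma Lyapunov_decay:
  assumes sg: "C0_semigroup JX H T" and x: "x \<in> H"
    and cont: "continuous_on {0..} (\<lambda>t. V (T t x))"
    and pos: "k1 > 0" "k2 > 0" "p > 0" "\<alpha> > 0"
    and bounds: "\<And>x. x \<in> H \<Longrightarrow> k1 * norm x powr p \<le> V x \<and> V x \<le> k2 * norm x powr p"
    and lie: "\<And>s. 0 \<le> s \<Longrightarrow> s < t \<Longrightarrow> lie_derivative T V (T s x) \<le> ereal (- \<alpha> * norm (T s x) powr p)"
    and t: "t \<ge> 0"
  shows "norm (T t x) \<le> (k2 / k1) powr (1 / p) * exp (- (\<alpha> / k2 / p) * t) * norm x"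
proof -
  define a where "a = \<alpha> / k2"
  have a: "a > 0" using pos by (simp add: a_def)
  have TH: "T s x \<in> H" if "s \<ge> 0" for s by (rule C0_semigroupD(1)[OF sg that x])
  have "V (T t x) \<le> exp (- a * t) * V (T 0 x) + (1 - exp (- a * t)) * (0 / a)"
  proof (rule Gronwall_upper_Dini[OF t a])
    show "continuous_on {0..t} (\<lambda>s. V (T s x))" by (rule continuous_on_subset[OF cont]) auto
    fix s e :: real assume s: "0 \<le> s" "s < t" and e: "e > 0"
    define y where "y = T s x"
    have "\<alpha> * norm y powr p \<ge> a * V y"
    proof -
      have "a * V y \<le> a * (k2 * norm y powr p)" using bounds TH[OF s(1)] a by (intro mult_left_mono) (auto simp: y_def)
      then show ?thesis using pos by (simp add: a_def)
    qed
    then have "lie_derivative T V y < ereal (- a * V y + 0 + e)"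
      using lie[OF s] e by (auto simp: y_def intro: order.strict_trans1)
    then have "\<forall>\<^sub>F h in at_right 0. ereal ((V (T h y) - V y) / h) < ereal (- a * V y + 0 + e)"
      unfolding lie_derivative_def by (rule Limsup_lessD)
    then show "\<forall>\<^sub>F h in at_right 0. V (T (s + h) x) \<le> V (T s x) + h * (- a * V (T s x) + 0 + e)"
      using eventually_at_right_less[of "0::real"]
    proof eventually_elim
      case (elim h)
      have "T (s + h) x = T h y" using C0_semigroupD(6)[OF sg _ s(1) x, of h] elim(2) by (simp add: y_def add.commute)
      moreover have "V (T h y) - V y \<le> h * (- a * V y + 0 + e)"
        using elim by (simp add: pos_divide_less_eq mult.commute)
      ultimately show ?case by (simp add: y_def)
    qed
  qed
  then have "V (T t x) \<le> exp (- a * t) * V x" using C0_semigroupD(5)[OF sg x] by simp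
  also have "\<dots> \<le> exp (- a * t) * (k2 * norm x powr p)" using bounds[OF x] by (intro mult_left_mono) auto
  finally have "k1 * norm (T t x) powr p \<le> exp (- a * t) * (k2 * norm x powr p)"
    using bounds[OF TH[OF t]] by linarith
  then have "norm (T t x) powr p \<le> (k2 / k1) * exp (- a * t) * norm x powr p"
    using pos by (simp add: field_simps)
  then have "(norm (T t x) powr p) powr (1 / p) \<le> ((k2 / k1) * exp (- a * t) * norm x powr p) powr (1 / p)"
    using pos by (intro powr_mono2) auto
  also have "((k2 / k1) * exp (- a * t) * norm x powr p) powr (1 / p)
      = (k2 / k1) powr (1 / p) * exp (- a * t) powr (1 / p) * (norm x powr p) powr (1 / p)"
    using pos by (simp only: powr_mult)
  also have "exp (- a * t) powr (1 / p) = exp (- (\<alpha> / k2 / p) * t)"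
    by (simp add: exp_powr_real a_def)
  finally show ?thesis using pos by (simp add: powr_powr)
qed

lemma Lyapunov_implication_imp_UGESMO:
  assumes sg: "C0_semigroup JX H T" and lin: "linear_gain \<kappa>" and V: "eOSS_Lyapunov_implication H T C V \<kappa>"
  shows "UGESMO H T C"
proof -
  obtain k1 k2 p \<alpha> where \<kappa>: "\<kappa> \<in> class_K_inf" and "\<forall>x\<in>H. V x \<ge> 0"
    and cont': "\<forall>x\<in>H. continuous_on {0..} (\<lambda>t. V (T t x))"
    and pos: "k1 > 0" "k2 > 0" "p > 0" "\<alpha> > 0"
    and bounds': "\<forall>x\<in>H. k1 * norm x powr p \<le> V x \<and> V x \<le> k2 * norm x powr p"
    and lie': "\<forall>x\<in>H. norm x \<ge> \<kappa> (norm (C x)) \<longrightarrow> lie_derivative T V x \<le> ereal (- \<alpha> * norm x powr p)"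
    using V unfolding eOSS_Lyapunov_implication_def by (elim conjE exE) (rule that)
  note cont = cont'[rule_format] and bounds = bounds'[rule_format] and lie = lie'[rule_format]
  obtain c where c: "\<And>r. r \<ge> 0 \<Longrightarrow> \<kappa> r = c * r" using lin by (auto simp: linear_gain_def)
  have "strict_mono_on {0..} \<kappa>" using \<kappa> by (simp add: class_K_inf_def class_K_def)
  from strict_mono_onD[OF this, of 0 1] have "\<kappa> 0 < \<kappa> 1" by simp
  then have "c > 0" using c[of 0] c[of 1] by simp
  show ?thesis
    unfolding UGESMO_def
  proof (intro exI conjI ballI allI impI)
    show "c > 0" "(k2 / k1) powr (1 / p) > 0" "\<alpha> / k2 / p > 0" using \<open>c > 0\<close> pos by auto
    fix x \<tau> t assume x: "x \<in> H" and \<tau>: "0 \<le> \<tau>" "\<forall>t\<in>{0..\<tau>}. norm (T t x) \<ge> c * norm (C (T t x))" and t: "t \<in> {0..\<tau>}"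
    have "lie_derivative T V (T s x) \<le> ereal (- \<alpha> * norm (T s x) powr p)" if "0 \<le> s" "s < t" for s
    proof (rule lie)
      show "T s x \<in> H" by (rule C0_semigroupD(1)[OF sg that(1) x])
      show "\<kappa> (norm (C (T s x))) \<le> norm (T s x)" using \<tau>(2) that t c by simp
    qed
    then show "norm (T t x) \<le> (k2 / k1) powr (1 / p) * exp (- (\<alpha> / k2 / p) * t) * norm x"
      using t by (intro Lyapunov_decay[OF sg x cont[OF x] pos bounds]) auto
  qed
qed

lemma UGESMO_imp_exp_zero_detectable:
  assumes "UGESMO H T C"
  shows "exp_zero_detectable H T C"
proof -
  obtain \<rho> M \<mu> where M: "M > 0" "\<mu> > 0" and
    est: "\<forall>x\<in>H. \<forall>\<tau>\<ge>0. (\<forall>t\<in>{0..\<tau>}. norm (T t x) \<ge> \<rho> * norm (C (T t x))) \<longrightarrow>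
      (\<forall>t\<in>{0..\<tau>}. norm (T t x) \<le> M * exp (- \<mu> * t) * norm x)"
    using assms by (auto simp: UGESMO_def)
  have "norm (T t x) \<le> M * exp (- \<mu> * t) * norm x" if "x \<in> H" "\<forall>t\<ge>0. C (T t x) = 0" "t \<ge> 0" for x t
    by (rule est[rule_format, of x t]) (use that in auto)
  then show ?thesis unfolding exp_zero_detectable_def using M by blast
qed

lemma Lyapunov_dissipation_imp_exp_zero_detectable:
  assumes sg: "C0_semigroup JX H T" and V: "eOSS_Lyapunov_dissipation H T C V \<sigma>"
  shows "exp_zero_detectable H T C"
proof -
  obtain k1 k2 p \<alpha> where \<sigma>: "\<sigma> \<in> class_K_inf" and "\<forall>x\<in>H. V x \<ge> 0"
    and cont': "\<forall>x\<in>H. continuous_on {0..} (\<lambda>t. V (T t x))"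
    and pos: "k1 > 0" "k2 > 0" "p > 0" "\<alpha> > 0"
    and bounds': "\<forall>x\<in>H. k1 * norm x powr p \<le> V x \<and> V x \<le> k2 * norm x powr p"
    and lie': "\<forall>x\<in>H. lie_derivative T V x \<le> ereal (- \<alpha> * norm x powr p + \<sigma> (norm (C x)))"
    using V unfolding eOSS_Lyapunov_dissipation_def by (elim conjE exE) (rule that)
  note cont = cont'[rule_format] and bounds = bounds'[rule_format] and lie = lie'[rule_format]
  have \<sigma>0: "\<sigma> 0 = 0" using \<sigma> by (simp add: class_K_inf_def class_K_def)
  show ?thesis
    unfolding exp_zero_detectable_def
  proof (intro exI conjI ballI allI impI)
    show "(k2 / k1) powr (1 / p) > 0" "\<alpha> / k2 / p > 0" using pos by auto
    fix x t assume x: "x \<in> H" and zero: "\<forall>t\<ge>0. C (T t x) = 0" and t: "(0::real) \<le> t"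
    have "lie_derivative T V (T s x) \<le> ereal (- \<alpha> * norm (T s x) powr p)" if "s \<ge> 0" for s
      using lie[OF C0_semigroupD(1)[OF sg that x]] zero that \<sigma>0 by simp
    then show "norm (T t x) \<le> (k2 / k1) powr (1 / p) * exp (- (\<alpha> / k2 / p) * t) * norm x"
      by (intro Lyapunov_decay[OF sg x cont[OF x] pos bounds _ t])
  qed
qed

section \<open>Restriction and complexification of semigroups\<close>

text \<open>
  The function \<open>exp (- s M) T s x\<close> has right derivative zero.
\<close>
lemma semigroup_eq_exp_blinfun:
  fixes T :: "real \<Rightarrow> 'x::banach \<Rightarrow> 'x" and M :: "'x \<Rightarrow>\<^sub>L 'x"
  assumes gen: "generates JX UNIV D A T" and lb: "locally_bounded_on UNIV T"
    and U: "U \<subseteq> D" "\<And>t x. t \<ge> 0 \<Longrightarrow> x \<in> U \<Longrightarrow> T t x \<in> U"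
    and M: "\<And>x. x \<in> U \<Longrightarrow> M x = A x" and x: "x \<in> U" and t: "t \<ge> 0"
  shows "T t x = exp_blinfun M t x"
proof -
  let ?E = "exp_blinfun M"
  note sg = generates_D(1)[OF gen]
  define f where "f s = ?E (- s) (T s x)" for s
  have "f t = f 0"
  proof (rule constant_if_right_derivative_zero[OF t])
    show "continuous_on {0..t} f"
      unfolding f_def
      by (intro blinfun.continuous_on continuous_on_vector_derivative[OF exp_blinfun_uminus_has_vector_derivative]
          continuous_on_subset[OF orbit_continuous[OF sg subspace_UNIV lb]]) auto
    fix s :: real assume s: "0 \<le> s" "s < t"
    have "(f has_vector_derivative ?E (- s) (A (T s x)) + (- (M o\<^sub>L ?E (- s))) (T s x)) (at_right s)"
      unfolding f_def
      by (rule blinfun.has_vector_derivative[OF exp_blinfun_uminus_has_vector_derivative orbit_right_derivative[OF gen subspace_UNIV closed_UNIV _ s(1)]])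
        (use x U in auto)
    moreover have "A (T s x) = M (T s x)" using M U(2)[OF s(1) x] by simp
    moreover have "?E (- s) (M (T s x)) = M (?E (- s) (T s x))"
      using arg_cong[OF exp_blinfun_commute[of M "- s"], of "\<lambda>f. blinfun_apply f (T s x)"] by simp
    ultimately show "(f has_vector_derivative 0) (at_right s)" by (simp add: blinfun.minus_left)
  qed
  then have "?E (- t) (T t x) = x" using C0_semigroupD(5)[OF sg] by (simp add: f_def)
  then have "?E t x = ?E (t + - t) (T t x)" unfolding exp_blinfun_add by simp
  then show ?thesis by simp
qed

lemma generates_restrict:
  assumes gen: "generates JX UNIV D A T" and U: "closed_subspace JX U" "\<And>t x. t \<ge> 0 \<Longrightarrow> x \<in> U \<Longrightarrow> T t x \<in> U"
  shows "generates JX U (D \<inter> U) A T"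
proof -
  note sg = generates_D(1)[OF gen]
  have "C0_semigroup JX U T"
    unfolding C0_semigroup_def
  proof (intro conjI allI impI ballI)
    fix t :: real assume t: "t \<ge> 0"
    obtain M where M: "\<forall>x\<in>UNIV. norm (T t x) \<le> M * norm x" using C0_semigroupD(4)[OF sg t] by blast
    show "T t \<in> bounded_ops JX JX U U"
      unfolding bounded_ops_def mem_Collect_eq
    proof (intro conjI allI ballI impI exI[of _ M])
      show "T t ` U \<subseteq> U" using U(2)[OF t] by blast
      show "T t (I x) = K (T t x)" if "JX = Some I \<and> JX = Some K" for I K x
        using C0_semigroup_J[of I UNIV T t x] sg t that by auto
    qed (use M C0_semigroupD(2,3)[OF sg t] in auto)
  qed (auto intro: C0_semigroupD(5,6,7)[OF sg])
  moreover have "D \<inter> U = {x \<in> U. \<exists>y. ((\<lambda>h. (T h x - x) /\<^sub>R h) \<longlongrightarrow> y) (at_right 0)}"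
    using generates_D(3,4)[OF gen] by blast
  ultimately show ?thesis unfolding generates_def using generates_D(3)[OF gen] by blast
qed

lemma generates_cong:
  assumes "generates JX H D A T" "\<And>x. x \<in> D \<Longrightarrow> A x = A' x"
  shows "generates JX H D A' T"
  using assms unfolding generates_def by auto

lemma generates_unique:
  assumes "generates JX H D A T" "generates JX H D' A' T"
  shows "D = D'" "x \<in> D \<Longrightarrow> A x = A' x"
  using generates_D(2-4)[OF assms(1)] generates_D(2-4)[OF assms(2)] by blast+

text \<open>
  Near time 0 the semigroup is bounded on a finite basis of the range of \<open>\<pi>\<close>, hence uniformly on this range, and
  on the complement it is bounded by assumption.
\<close>
lemma locally_bounded_if_stable_complement:
  assumes sg: "C0_semigroup JX UNIV T" and \<pi>: "bounded_linear \<pi>" "\<And>x. \<pi> x \<in> span B" and B: "finite B"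
    and stable: "\<And>x t. t \<ge> 0 \<Longrightarrow> norm (T t (x - \<pi> x)) \<le> Ms * norm (x - \<pi> x)" "Ms \<ge> 0"
  shows "locally_bounded_on UNIV T"
proof -
  have "\<forall>\<^sub>F t in at_right 0. norm (T t b) < norm b + 1" for b
    using order_tendstoD(2)[OF tendsto_norm[OF C0_semigroupD(7)[OF sg, of b]], of "norm b + 1"] by simp
  then have "\<forall>\<^sub>F t in at_right 0. \<forall>b\<in>B. norm (T t b) < norm b + 1"
    by (intro eventually_ball_finite B) auto
  then obtain d where d: "d > 0" "\<And>t b. 0 < t \<Longrightarrow> t < d \<Longrightarrow> b \<in> B \<Longrightarrow> norm (T t b) < norm b + 1"
    by (auto simp: eventually_at_right_field)
  obtain K where K: "K \<ge> 0" "\<And>f x. f \<in> T ` {0..d/2} \<Longrightarrow> x \<in> span B \<Longrightarrow> norm (f x) \<le> K * norm x"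
  proof (rule uniformly_bounded_on_span[OF B, of "T ` {0..d/2}"])
    show "f (x + y) = f x + f y" if "f \<in> T ` {0..d/2}" for f x y
      using that C0_semigroupD(2)[OF sg] by auto
    show "f (c *\<^sub>R x) = c *\<^sub>R f x" if "f \<in> T ` {0..d/2}" for f c x
      using that C0_semigroupD(3)[OF sg] by auto
    show "\<exists>m. \<forall>f\<in>T ` {0..d/2}. norm (f b) \<le> m" if b: "b \<in> B" for b
    proof (intro exI[of _ "norm b + 1"] ballI)
      fix f assume "f \<in> T ` {0..d/2}"
      then obtain t where t: "f = T t" "0 \<le> t" "t \<le> d/2" by auto
      show "norm (f b) \<le> norm b + 1"
      proof (cases "t = 0")
        case True
        then show ?thesis using t(1) C0_semigroupD(5)[OF sg, of b] by simp
      next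
        case False
        then show ?thesis using d(2)[of t b] t b d(1) by simp
      qed
    qed
  qed (rule that)
  obtain k where k: "k > 0" "\<And>x. norm (\<pi> x) \<le> norm x * k" using bounded_linear.pos_bounded[OF \<pi>(1)] by blast
  have "norm (T t x) \<le> (K * k + Ms * (1 + k)) * norm x" if t: "0 \<le> t" "t \<le> d/2" for t x
  proof -
    have "T t x = T t (\<pi> x) + T t (x - \<pi> x)"
      using C0_semigroupD(2)[OF sg t(1), of "\<pi> x" "x - \<pi> x"] by simp
    then have "norm (T t x) \<le> norm (T t (\<pi> x)) + norm (T t (x - \<pi> x))" by (simp add: norm_triangle_ineq)
    also have "\<dots> \<le> K * norm (\<pi> x) + Ms * norm (x - \<pi> x)"
      using t by (intro add_mono K(2) stable \<pi>) auto
    also have "\<dots> \<le> K * (norm x * k) + Ms * (norm x + norm x * k)"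
      using K(1) stable(2) k(2)[of x] norm_triangle_ineq4[of x "\<pi> x"]
      by (intro add_mono mult_left_mono) auto
    finally show ?thesis by (simp add: algebra_simps)
  qed
  then show ?thesis using d(1) by (intro locally_bounded_on_if_near_0[OF sg, of "d/2"]) auto
qed

lemma span_Times_finite:
  fixes B :: "'a::real_vector set"
  shows "span B \<times> span B = span ((\<lambda>b. (b, 0)) ` B \<union> (\<lambda>b. (0, b)) ` B)"
proof
  have l1: "linear (\<lambda>b::'a. (b, 0::'a))" and l2: "linear (\<lambda>b::'a. (0::'a, b))" by (auto simp: linear_iff)
  have s1: "(\<lambda>b. (b, 0)) ` span B \<subseteq> span ((\<lambda>b. (b, 0)) ` B \<union> (\<lambda>b. (0, b)) ` B)"
    unfolding linear_span_image[OF l1, symmetric] by (rule span_mono) auto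
  have s2: "(\<lambda>b. (0, b)) ` span B \<subseteq> span ((\<lambda>b. (b, 0)) ` B \<union> (\<lambda>b. (0, b)) ` B)"
    unfolding linear_span_image[OF l2, symmetric] by (rule span_mono) auto
  show "span B \<times> span B \<subseteq> span ((\<lambda>b. (b, 0)) ` B \<union> (\<lambda>b. (0, b)) ` B)"
  proof
    fix p assume "p \<in> span B \<times> span B"
    then have "(fst p, 0) + (0, snd p) \<in> span ((\<lambda>b. (b, 0)) ` B \<union> (\<lambda>b. (0, b)) ` B)"
      using s1 s2 by (intro span_add) auto
    then show "p \<in> span ((\<lambda>b. (b, 0)) ` B \<union> (\<lambda>b. (0, b)) ` B)" by simp
  qed
  show "span ((\<lambda>b. (b, 0)) ` B \<union> (\<lambda>b. (0, b)) ` B) \<subseteq> span B \<times> span B"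
    by (rule span_minimal) (auto intro: span_base span_zero subspace_Times)
qed

lemma imaginary_unit_complexification:
  "imaginary_unit (\<lambda>(x, y). (- y, x) :: 'x::banach \<times> 'x)"
proof (rule imaginary_unit.intro)
  show "bounded_linear (\<lambda>(x, y). (- y, x) :: 'x \<times> 'x)"
    unfolding case_prod_unfold
    by (intro bounded_linear_Pair bounded_linear_minus bounded_linear_fst bounded_linear_snd)
qed auto

lemma bounded_linear_map_prod:
  assumes "bounded_linear f" "bounded_linear g"
  shows "bounded_linear (map_prod f g)"
  unfolding map_prod_def case_prod_unfold
  by (intro bounded_linear_Pair bounded_linear_compose[OF assms(1) bounded_linear_fst] bounded_linear_compose[OF assms(2) bounded_linear_snd])

lemma generates_complexification:
  fixes T :: "real \<Rightarrow> 'x::banach \<Rightarrow> 'x"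
  assumes gen: "generates JX UNIV D A T"
  shows "generates (Some (\<lambda>(x, y). (- y, x))) UNIV (D \<times> D) (map_prod A A) (\<lambda>t. map_prod (T t) (T t))"
proof -
  note sg = generates_D(1)[OF gen]
  let ?T = "\<lambda>t. map_prod (T t) (T t)"
  let ?J = "\<lambda>(x, y). (- y, x) :: 'x \<times> 'x"
  have "C0_semigroup (Some ?J) UNIV ?T"
    unfolding C0_semigroup_def
  proof (intro conjI allI impI ballI)
    fix t :: real assume t: "t \<ge> 0"
    note bl = C0_semigroup_bounded_linear[OF sg t]
    have bl2: "bounded_linear (?T t)" by (rule bounded_linear_map_prod[OF bl bl])
    obtain M where "\<And>z. norm (?T t z) \<le> norm z * M" using bounded_linear.bounded[OF bl2] by blast
    then have M: "\<forall>z\<in>UNIV. norm (?T t z) \<le> M * norm z" by (simp add: mult.commute)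
    have JT: "?T t (?J z) = ?J (?T t z)" for z
      by (cases z) (simp add: linear_neg[OF bounded_linear.linear[OF bl]])
    show "?T t \<in> bounded_ops (Some ?J) (Some ?J) UNIV UNIV"
      unfolding bounded_ops_def
      using M JT linear_add[OF bounded_linear.linear[OF bl2]] linear_cmul[OF bounded_linear.linear[OF bl2]] by blast
  next
    fix z :: "'x \<times> 'x"
    show "?T 0 z = z" by (cases z) (simp add: C0_semigroupD(5)[OF sg])
    show "((\<lambda>t. ?T t z) \<longlongrightarrow> z) (at_right 0)"
      by (cases z) (auto intro!: tendsto_Pair C0_semigroupD(7)[OF sg])
    fix s t :: real assume "s \<ge> 0" "t \<ge> 0"
    then show "?T (s + t) z = ?T s (?T t z)" by (cases z) (simp add: C0_semigroupD(6)[OF sg])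
  qed
  moreover have q: "(?T h z - z) /\<^sub>R h = ((T h (fst z) - fst z) /\<^sub>R h, (T h (snd z) - snd z) /\<^sub>R h)" for h z
    by (cases z) simp
  have "z \<in> D \<times> D" if "((\<lambda>h. (?T h z - z) /\<^sub>R h) \<longlongrightarrow> y) (at_right 0)" for z y
    using tendsto_fst[OF that] tendsto_snd[OF that] generates_D(4)[OF gen] unfolding q by (cases z) auto
  moreover have "((\<lambda>h. (?T h z - z) /\<^sub>R h) \<longlongrightarrow> map_prod A A z) (at_right 0)" if "z \<in> D \<times> D" for z
    using that unfolding q by (cases z) (auto intro!: tendsto_Pair generates_D(3)[OF gen])
  ultimately show ?thesis unfolding generates_def by blast
qed

text \<open>
  Over the reals, the complex statement is applied to the state \<open>(x, 0)\<close> of the complexification.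
\<close>
lemma unstable_subspace_has_no_stable_orbit:
  fixes T :: "real \<Rightarrow> 'x::banach \<Rightarrow> 'x"
  assumes J: "\<And>J. JX = Some J \<Longrightarrow> complex_structure J"
    and gen: "generates JX UNIV D A T" and lb: "locally_bounded_on UNIV T" and U: "U = span B" "finite B"
    and \<pi>: "bounded_linear \<pi>" "\<And>x. \<pi> x \<in> U" "\<And>u. u \<in> U \<Longrightarrow> \<pi> u = u"
    and comm: "\<And>J x. JX = Some J \<Longrightarrow> \<pi> (J x) = J (\<pi> x)" "\<And>t x. t \<ge> 0 \<Longrightarrow> T t (\<pi> x) = \<pi> (T t x)"
    and spec: "spectral_subspace JX D A {\<zeta>. Re \<zeta> \<ge> 0} U"
    and x: "x \<in> U" and \<omega>: "\<omega> > 0" and decay: "\<And>t. t \<ge> 0 \<Longrightarrow> norm (T t x) \<le> M * exp (- \<omega> * t)"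
  shows "x = 0"
proof (cases JX)
  case (Some J)
  have cs: "complex_structure J" by (rule J[OF Some])
  interpret complex_semigroup J D A T
  proof (intro complex_semigroup.intro imaginary_unit.intro complex_semigroup_axioms.intro)
    show "bounded_linear J" by (rule complex_structure_simps(1)[OF cs])
    show "J (J x) = - x" for x by (rule complex_structure_simps(2)[OF cs])
    show "generates (Some J) UNIV D A T" using gen Some by simp
  qed
  show ?thesis
    by (rule no_stable_orbit_in_unstable_subspace[OF lb U \<pi> comm(1)[OF Some] comm(2) _ x \<omega> decay])
      (use spec Some in \<open>auto simp: spectral_subspace_def\<close>)
next
  case None
  note sgT = generates_D(1)[OF gen]
  let ?J = "\<lambda>(x, y). (- y, x) :: 'x \<times> 'x"
  let ?T = "\<lambda>t. map_prod (T t) (T t)"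
  interpret complex_semigroup ?J "D \<times> D" "map_prod A A" ?T
    by (intro complex_semigroup.intro imaginary_unit_complexification complex_semigroup_axioms.intro generates_complexification[OF gen])
  have lb2: "locally_bounded_on UNIV ?T"
    unfolding locally_bounded_on_def
  proof
    fix \<tau>
    obtain K where K: "K \<ge> 0" "\<And>t x. 0 \<le> t \<Longrightarrow> t \<le> \<tau> \<Longrightarrow> x \<in> UNIV \<Longrightarrow> norm (T t x) \<le> K * norm x"
      by (rule locally_bounded_onE[OF lb], rule that)
    show "\<exists>K. \<forall>t\<in>{0..\<tau>}. \<forall>z\<in>UNIV. norm (?T t z) \<le> K * norm z"
    proof (intro exI ballI)
      fix t and z :: "'x \<times> 'x" assume t: "t \<in> {0..\<tau>}"
      have "norm (?T t z) \<le> norm (T t (fst z)) + norm (T t (snd z))"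
        by (cases z) (simp add: norm_Pair_le)
      also have "\<dots> \<le> K * norm (fst z) + K * norm (snd z)" using t by (intro add_mono K(2)) auto
      also have "\<dots> \<le> K * norm z + K * norm z"
        using K(1) norm_fst_le[of "fst z" "snd z"] norm_snd_le[of "snd z" "fst z"] by (intro add_mono mult_left_mono) auto
      finally show "norm (?T t z) \<le> (2 * K) * norm z" by simp
    qed
  qed
  have "(x, 0::'x) = 0"
  proof (rule no_stable_orbit_in_unstable_subspace[OF lb2, of "U \<times> U" "(\<lambda>b. (b, 0)) ` B \<union> (\<lambda>b. (0, b)) ` B" "map_prod \<pi> \<pi>" _ \<omega> M])
    show "U \<times> U = span ((\<lambda>b. (b, 0)) ` B \<union> (\<lambda>b. (0, b)) ` B)" unfolding U(1) by (rule span_Times_finite)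
    show "finite ((\<lambda>b. (b, 0::'x)) ` B \<union> (\<lambda>b. (0::'x, b)) ` B)" using U(2) by simp
    show "bounded_linear (map_prod \<pi> \<pi>)" by (rule bounded_linear_map_prod[OF \<pi>(1) \<pi>(1)])
    show "map_prod \<pi> \<pi> z \<in> U \<times> U" for z using \<pi>(2) by (cases z) auto
    show "map_prod \<pi> \<pi> u = u" if "u \<in> U \<times> U" for u using \<pi>(3) that by (cases u) auto
    show "map_prod \<pi> \<pi> (?J z) = ?J (map_prod \<pi> \<pi> z)" for z
      by (cases z) (simp add: linear_neg[OF bounded_linear.linear[OF \<pi>(1)]])
    show "?T t (map_prod \<pi> \<pi> z) = map_prod \<pi> \<pi> (?T t z)" if "t \<ge> 0" for t z
      using comm(2)[OF that] by (cases z) simp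
    show "complex_spectral_subspace ?J (D \<times> D) (map_prod A A) {\<zeta>. Re \<zeta> \<ge> 0} (U \<times> U)"
      using spec None by (simp add: spectral_subspace_def)
    show "(x, 0) \<in> U \<times> U" using x U(1) span_zero by auto
    show "norm (?T t (x, 0)) \<le> M * exp (- \<omega> * t)" if "t \<ge> 0" for t
      using decay[OF that] linear_0[OF bounded_linear.linear[OF C0_semigroup_bounded_linear[OF sgT that]]] by simp
  qed (rule \<omega>)
  then show ?thesis by (simp add: zero_prod_def)
qed

section \<open>The equivalences\<close>

lemma exp_detectable_imp_output_injection:
  assumes det: "exp_detectable JX JY H D A C" and H: "subspace H" "closed H"
    and gen: "generates JX H D A T" and lb: "locally_bounded_on H T"
    and dense: "\<And>x. x \<in> H \<Longrightarrow> \<exists>z :: real \<Rightarrow> 'x::banach. (\<forall>h>0. z h \<in> D) \<and> (z \<longlongrightarrow> x) (at_right 0)"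
    and C: "bounded_linear (C :: 'x \<Rightarrow> 'y::banach)"
  obtains S L M \<mu> where "output_injection JX H D A T S C L M \<mu>"
proof -
  obtain L S where L: "L \<in> bounded_ops JY JX UNIV H" and S: "generates JX H D (\<lambda>x. A x + L (C x)) S" "exp_stable H S"
    using det by (auto simp: exp_detectable_def)
  obtain M \<mu> where "M > 0" "\<mu> > 0" "\<forall>x\<in>H. \<forall>t\<ge>0. norm (S t x) \<le> M * exp (- \<mu> * t) * norm x"
    using S(2) by (auto simp: exp_stable_def)
  then have "output_injection JX H D A T S C L M \<mu>"
    by (intro output_injection.intro H gen S(1) lb dense C bounded_ops_bounded_linear[OF L]) auto
  then show ?thesis by (rule that)
qed

lemma locally_bounded_on_subset:
  "locally_bounded_on H T \<Longrightarrow> G \<subseteq> H \<Longrightarrow> locally_bounded_on G T"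
  unfolding locally_bounded_on_def by (meson subsetD)

text \<open>
  The implications form cycles through observability of the unstable part.
\<close>
lemma all_equivalent_from_implications:
  fixes det det_u :: bool
  assumes "det \<Longrightarrow> lin \<and> dis \<and> imp" "lin \<Longrightarrow> eoss" "lin \<Longrightarrow> osslin" "eoss \<Longrightarrow> oss" "osslin \<Longrightarrow> oss"
    "oss \<Longrightarrow> zero" "dis \<Longrightarrow> zero" "imp \<Longrightarrow> ug" "ug \<Longrightarrow> zero"
    "zero \<Longrightarrow> zero_u" "zero_u \<Longrightarrow> obs" "obs \<Longrightarrow> det \<and> det_u" "det_u \<Longrightarrow> zero_u"
  shows "all_equivalent [det, eoss, zero, zero_u, det_u, obs] \<and>
    all_equivalent [det, dis, imp, lin, eoss, osslin, oss, ug, zero]"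
proof -
  have "det = obs" "eoss = obs" "zero = obs" "zero_u = obs" "det_u = obs" "dis = obs" "imp = obs"
    "lin = obs" "osslin = obs" "oss = obs" "ug = obs"
    using assms by blast+
  then show ?thesis by (simp add: all_equivalent_def)
qed

theorem theorem6p4:
  fixes JX :: "('x::banach \<Rightarrow> 'x) option"
    and JY :: "('y::banach \<Rightarrow> 'y) option"
    and D :: "'x set" and A :: "'x \<Rightarrow> 'x"
    and T :: "real \<Rightarrow> 'x \<Rightarrow> 'x"
    and C :: "'x \<Rightarrow> 'y"
    and Xu Xs :: "'x set"
    and Ms \<omega>s :: real
    and Du :: "'x set" and Au :: "'x \<Rightarrow> 'x"
  assumes scalars: "same_scalar_field JX JY"
    and gen: "generates JX UNIV D A T"
    and C: "C \<in> bounded_ops JX JY UNIV UNIV"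
    and Xu: "closed_subspace JX Xu" "\<forall>t\<ge>0. T t ` Xu \<subseteq> Xu"
    and Xs: "closed_subspace JX Xs" "\<forall>t\<ge>0. T t ` Xs \<subseteq> Xs"
    and direct_sum: "Xu \<inter> Xs = {0}" "\<forall>x. \<exists>!p\<in>Xu \<times> Xs. x = fst p + snd p"
    and fin_dim: "\<exists>B. finite B \<and> span B = Xu"
    and spectral: "spectral_subspace JX D A {\<zeta>. Re \<zeta> \<ge> 0} Xu"
    and stable: "Ms > 0" "\<omega>s > 0"
      "\<forall>x\<in>Xs. \<forall>t\<ge>0. norm (T t x) \<le> Ms * exp (- \<omega>s * t) * norm x"
    and gen_u: "generates JX Xu Du Au T"
  shows
    "all_equivalent
       [exp_detectable JX JY UNIV D A C,
        eOSS UNIV T C,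
        exp_zero_detectable UNIV T C,
        exp_zero_detectable Xu T C,
        exp_detectable JX JY Xu Du Au C,
        observable Xu T C]
   \<and> all_equivalent
       [exp_detectable JX JY UNIV D A C,
        \<exists>V \<sigma>. linear_gain \<sigma> \<and> eOSS_Lyapunov_dissipation UNIV T C V \<sigma>,
        \<exists>V \<kappa>. linear_gain \<kappa> \<and> eOSS_Lyapunov_implication UNIV T C V \<kappa>,
        eOSS_linear_gain UNIV T C,
        eOSS UNIV T C,
        OSS_linear_gain UNIV T C,
        OSS UNIV T C,
        UGESMO UNIV T C,
        exp_zero_detectable UNIV T C]"
proof -
  note sg = generates_D(1)[OF gen]
  note T_lin = bounded_linear.linear[OF C0_semigroup_bounded_linear[OF sg]]
  have blC: "bounded_linear C" by (rule bounded_ops_bounded_linear[OF C])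
  obtain B where B: "finite B" "Xu = span B" using fin_dim by blast
  have sXu: "subspace Xu" "closed Xu" and sXs: "subspace Xs" "closed Xs"
    using Xu(1) Xs(1) by (auto simp: closed_subspace_def)
  have TU: "T t x \<in> Xu" if "t \<ge> 0" "x \<in> Xu" for t x using Xu(2) that by blast
  have TS: "T t x \<in> Xs" if "t \<ge> 0" "x \<in> Xs" for t x using Xs(2) that by blast
  have dec: "\<exists>u\<in>Xu. \<exists>v\<in>Xs. x = u + v" for x
  proof -
    have "\<exists>p. p \<in> Xu \<times> Xs \<and> x = fst p + snd p"
      using direct_sum(2) by (intro ex1_implies_ex) blast
    then show ?thesis unfolding mem_Times_iff by blast
  qed
  obtain \<pi> where \<pi>: "bounded_linear \<pi>" "\<And>x. \<pi> x \<in> Xu" "\<And>x. x - \<pi> x \<in> Xs"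
    "\<And>u. u \<in> Xu \<Longrightarrow> \<pi> u = u" "\<And>v. v \<in> Xs \<Longrightarrow> \<pi> v = 0"
    by (rule bounded_projection_onto_span[OF B(2,1) sXs direct_sum(1) dec], rule that)
  interpret \<pi>: bounded_linear \<pi> by (rule \<pi>(1))
  have J: "complex_structure J" if "JX = Some J" for J using scalars that by (auto simp: same_scalar_field_def)
  \<comment> \<open>an operator that preserves both summands commutes with the projection\<close>
  have commutes: "P (\<pi> x) = \<pi> (P x)" if P: "linear P" "\<And>x. x \<in> Xu \<Longrightarrow> P x \<in> Xu" "\<And>x. x \<in> Xs \<Longrightarrow> P x \<in> Xs" for P x
  proof -
    have "\<pi> (P x) = \<pi> (P (\<pi> x)) + \<pi> (P (x - \<pi> x))"
      unfolding \<pi>.add[symmetric] linear_add[OF P(1), symmetric] by simp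
    then show ?thesis using P(2,3) \<pi> by simp
  qed
  have \<pi>_T: "T t (\<pi> x) = \<pi> (T t x)" if "t \<ge> 0" for t x
    by (rule commutes[OF T_lin[OF that]]) (use TU TS that in auto)
  have \<pi>_J: "\<pi> (J x) = J (\<pi> x)" if "JX = Some J" for J x
  proof (rule commutes[symmetric])
    show "linear J" using J[OF that] by (simp add: complex_structure_def)
  qed (use Xu(1) Xs(1) that in \<open>auto simp: closed_subspace_def\<close>)
  have stable_compl: "norm (T t (x - \<pi> x)) \<le> Ms * exp (- \<omega>s * t) * norm (x - \<pi> x)" if "t \<ge> 0" for t x
    using stable(3) \<pi>(3) that by blast
  have lb: "locally_bounded_on UNIV T"
  proof (rule locally_bounded_if_stable_complement[OF sg \<pi>(1) _ B(1), where Ms = Ms])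
    show "\<pi> x \<in> span B" for x using \<pi>(2) B(2) by simp
    show "norm (T t (x - \<pi> x)) \<le> Ms * norm (x - \<pi> x)" if "t \<ge> 0" for t x
    proof (rule order_trans[OF stable_compl[OF that]])
      have "exp (- \<omega>s * t) \<le> 1" using stable(2) that by simp
      then show "Ms * exp (- \<omega>s * t) * norm (x - \<pi> x) \<le> Ms * norm (x - \<pi> x)"
        using stable(1) by (intro mult_right_mono) auto
    qed
  qed (use stable(1) in simp)
  have UD: "Xu \<subseteq> D" by (rule finite_dim_invariant_subset_domain[OF gen lb B(2,1) \<pi>(1,2,4) \<pi>_T])
  note gen_r = generates_restrict[OF gen Xu(1) TU]
  have Du: "Du = Xu" "\<And>x. x \<in> Xu \<Longrightarrow> Au x = A x"
    using generates_unique[OF gen_u gen_r] UD by auto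

  have det: "eOSS_linear_gain UNIV T C \<and>
      (\<exists>V \<sigma>. linear_gain \<sigma> \<and> eOSS_Lyapunov_dissipation UNIV T C V \<sigma>) \<and>
      (\<exists>V \<kappa>. linear_gain \<kappa> \<and> eOSS_Lyapunov_implication UNIV T C V \<kappa>)"
    if d: "exp_detectable JX JY UNIV D A C"
  proof -
    have dense: "\<exists>z :: real \<Rightarrow> 'x. (\<forall>h>0. z h \<in> D) \<and> (z \<longlongrightarrow> x) (at_right 0)" for x
      by (rule semigroup_averages_in_domain[OF gen lb, of x]) blast
    obtain S L M \<mu> where "output_injection JX UNIV D A T S C L M \<mu>"
      by (rule exp_detectable_imp_output_injection[OF d subspace_UNIV closed_UNIV gen lb dense blC], rule that)
    then interpret output_injection JX UNIV D A T S C L M \<mu> .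
    show ?thesis using eOSS_linear_gain_T Lyapunov_dissipation Lyapunov_implication by blast
  qed
  have det_u: "exp_zero_detectable Xu T C" if d: "exp_detectable JX JY Xu Du Au C"
  proof -
    have dense: "\<exists>z :: real \<Rightarrow> 'x. (\<forall>h>0. z h \<in> Du) \<and> (z \<longlongrightarrow> x) (at_right 0)" if "x \<in> Xu" for x
      using that Du(1) by (intro exI[of _ "\<lambda>_. x"]) auto
    have lb_u: "locally_bounded_on Xu T" by (rule locally_bounded_on_subset[OF lb]) simp
    obtain S L M \<mu> where "output_injection JX Xu Du Au T S C L M \<mu>"
      by (rule exp_detectable_imp_output_injection[OF d sXu gen_u lb_u dense blC], assumption, rule that)
    then interpret output_injection JX Xu Du Au T S C L M \<mu> .
    have "eOSS Xu T C" using eOSS_linear_gain_T by (auto simp: eOSS_linear_gain_def eOSS_def)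
    then show ?thesis by (rule eOSS_imp_exp_zero_detectable)
  qed
  have zero_u: "exp_zero_detectable Xu T C" if "exp_zero_detectable UNIV T C"
    using that unfolding exp_zero_detectable_def by blast
  \<comment> \<open>here, and only here, the spectral hypothesis enters\<close>
  have obs: "observable Xu T C" if zd: "exp_zero_detectable Xu T C"
    unfolding observable_def
  proof (intro ballI impI)
    fix x assume x: "x \<in> Xu" and zero: "\<forall>t\<ge>0. C (T t x) = 0"
    obtain M \<omega> where M: "\<omega> > 0" "\<And>t. t \<ge> 0 \<Longrightarrow> norm (T t x) \<le> M * exp (- \<omega> * t) * norm x"
      using zd x zero unfolding exp_zero_detectable_def by blast
    show "x = 0"
    proof (rule unstable_subspace_has_no_stable_orbit[OF J gen lb B(2,1) \<pi>(1,2,4) \<pi>_J \<pi>_T spectral x M(1)])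
      show "norm (T t x) \<le> (M * norm x) * exp (- \<omega> * t)" if "t \<ge> 0" for t
        using M(2)[OF that] by (simp add: mult_ac)
    qed
  qed
  have detectable: "exp_detectable JX JY UNIV D A C \<and> exp_detectable JX JY Xu Du Au C" if o: "observable Xu T C"
  proof -
    have A\<pi>: "bounded_linear (\<lambda>x. A (\<pi> x))"
    proof -
      obtain K where K: "K \<ge> 0" "\<And>f x. f \<in> {A} \<Longrightarrow> x \<in> span B \<Longrightarrow> norm (f x) \<le> K * norm x"
      proof (rule uniformly_bounded_on_span[OF B(1), of "{A}"])
        show "f (x + y) = f x + f y" if "f \<in> {A}" "x \<in> span B" "y \<in> span B" for f x y
          using generator_add[OF gen subspace_UNIV, of x y] that UD B(2) by blast
        show "f (c *\<^sub>R x) = c *\<^sub>R f x" if "f \<in> {A}" "x \<in> span B" for f c x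
          using generator_scale[OF gen subspace_UNIV, of x c] that UD B(2) by blast
        show "\<exists>m. \<forall>f\<in>{A}. norm (f b) \<le> m" for b by auto
      qed (rule that)
      obtain k where k: "\<And>x. norm (\<pi> x) \<le> norm x * k" using \<pi>.bounded by blast
      have "norm (A (\<pi> x)) \<le> norm x * (k * K)" for x
      proof -
        have "norm (A (\<pi> x)) \<le> K * norm (\<pi> x)" using K(2)[of A "\<pi> x"] \<pi>(2) B(2) by simp
        also have "\<dots> \<le> K * (norm x * k)" by (intro mult_left_mono k K(1))
        finally show ?thesis by (simp add: mult_ac)
      qed
      moreover have "\<pi> x \<in> D" for x using \<pi>(2) UD by blast
      ultimately show ?thesis
        using generator_add[OF gen subspace_UNIV] generator_scale[OF gen subspace_UNIV]
        by (intro bounded_linear_intro[of _ "k * K"]) (auto simp: \<pi>.add \<pi>.scaleR)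
    qed
    define M where "M = Blinfun (\<lambda>x. A (\<pi> x))"
    have M: "M x = A (\<pi> x)" for x unfolding M_def by (simp add: bounded_linear_Blinfun_apply[OF A\<pi>])
    have MU: "M x \<in> Xu" for x
      using generator_commutes[OF gen \<pi>(1) \<pi>_T, of "\<pi> x"] \<pi>(2)[of x] \<pi>(2)[of "A (\<pi> x)"] \<pi>(4)[OF \<pi>(2)] UD by (auto simp: M)
    have M_J: "M (I x) = I (M x)" if I: "JX = Some I" for I x
    proof -
      have "T t (I y) = I (T t y)" if "t \<ge> 0" for t y
        using C0_semigroup_J[of I UNIV T t y] sg I that by simp
      then show ?thesis
        using generator_commutes[OF gen complex_structure_simps(1)[OF J[OF I]], of "\<pi> x"] \<pi>(2)[of x] UD \<pi>_J[OF I] by (auto simp: M)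
    qed
    \<comment> \<open>on \<open>Xu\<close> the semigroup is the exponential of \<open>M\<close>, so observability carries over\<close>
    have obs_M: "x = 0" if x: "x \<in> Xu" "\<And>t. t \<ge> 0 \<Longrightarrow> C (exp_blinfun M t x) = 0" for x
    proof -
      have "T t x = exp_blinfun M t x" if "t \<ge> 0" for t
        by (rule semigroup_eq_exp_blinfun[OF gen lb UD TU _ x(1) that]) (use M \<pi>(4) in auto)
      then show ?thesis using o x unfolding observable_def by simp
    qed
    obtain L K N where L: "L \<in> bounded_ops JY JX UNIV Xu" "bounded_linear L"
      and K: "\<And>x. blinfun_apply K x = M x + L (C x)" and N: "N > 0"
        "\<And>x t. x \<in> Xu \<Longrightarrow> t \<ge> 0 \<Longrightarrow> norm (exp_blinfun K t x) \<le> N * exp (- t) * norm x"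
    proof (rule stabilizing_output_injection[OF scalars C B(2,1) Xu(1), of M])
      show "x = 0" if "x \<in> Xu" "\<And>t. t \<ge> 0 \<Longrightarrow> C (exp_blinfun M t x) = 0" for x
        by (rule obs_M) (use that in auto)
    qed (rule MU M_J that; assumption?)+
    have LJ: "L (C (I x)) = I (L (C x))" if I: "JX = Some I" for I x
    proof -
      obtain K' where K': "JY = Some K'" using scalars I by (auto simp: same_scalar_field_def)
      then show ?thesis using L(1) C I by (simp add: bounded_ops_def)
    qed
    interpret tp: triangular_perturbation JX D A T Xu \<pi> "\<lambda>x. L (C x)" K Ms \<omega>s N
    proof (rule triangular_perturbation.intro)
      show "bounded_linear J" if "JX = Some J" for J by (rule complex_structure_simps(1)[OF J[OF that]])
      show "bounded_linear (\<lambda>x. L (C x))" by (rule bounded_linear_compose[OF L(2) blC])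
      show "L (C x) \<in> Xu" for x using L(1) by (auto simp: bounded_ops_def)
    qed (use gen lb sXu UD \<pi> \<pi>_T \<pi>_J LJ K M stable stable_compl N in auto)
    have L': "L \<in> bounded_ops JY JX UNIV UNIV" using L(1) by (simp add: bounded_ops_def)
    have "exp_detectable JX JY UNIV D A C"
      unfolding exp_detectable_def using L' tp.generates_S tp.exp_stable_S by blast
    moreover have "generates JX Xu Du (\<lambda>x. Au x + L (C x)) tp.S"
    proof (rule generates_cong)
      have "D \<inter> Xu = Du" using UD Du(1) by blast
      then show "generates JX Xu Du (\<lambda>x. A x + L (C x)) tp.S"
        using generates_restrict[OF tp.generates_S Xu(1) tp.S_U] by simp
    qed (use Du in simp)
    moreover have "exp_stable Xu tp.S"
      using tp.exp_stable_S unfolding exp_stable_def by blast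
    ultimately show ?thesis unfolding exp_detectable_def using L(1) by blast
  qed
  have lin: "eOSS_linear_gain UNIV T C \<Longrightarrow> eOSS UNIV T C" "eOSS_linear_gain UNIV T C \<Longrightarrow> OSS_linear_gain UNIV T C"
    "eOSS UNIV T C \<Longrightarrow> OSS UNIV T C" "OSS_linear_gain UNIV T C \<Longrightarrow> OSS UNIV T C"
    using eOSS_gain_imp_OSS_gain
    unfolding eOSS_linear_gain_def eOSS_def OSS_linear_gain_def OSS_def by blast+
  have OSS_zero: "exp_zero_detectable UNIV T C" if "OSS UNIV T C"
    by (rule OSS_imp_exp_zero_detectable[OF sg subspace_UNIV blC that])
  have diss_zero: "exp_zero_detectable UNIV T C"
    if "\<exists>V \<sigma>. linear_gain \<sigma> \<and> eOSS_Lyapunov_dissipation UNIV T C V \<sigma>"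
    using that Lyapunov_dissipation_imp_exp_zero_detectable[OF sg] by blast
  have impl: "UGESMO UNIV T C"
    if "\<exists>V \<kappa>. linear_gain \<kappa> \<and> eOSS_Lyapunov_implication UNIV T C V \<kappa>"
    using that Lyapunov_implication_imp_UGESMO[OF sg] by blast
  have ug: "exp_zero_detectable UNIV T C" if "UGESMO UNIV T C"
    by (rule UGESMO_imp_exp_zero_detectable[OF that])
  show ?thesis
    by (rule all_equivalent_from_implications[OF det lin OSS_zero diss_zero impl ug zero_u obs detectable det_u])
qed

end
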